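(* Let $T$ be a self-adjoint and boundedly invertible operator in the Hilbert space $(H,(\cdot,\cdot))$, and let $\mathcal M_T$, $\mathcal N_T$ and $\Phi_T:\mathcal M_T\to\mathcal N_T$ be as in the context. Then: (i) One closure $\mathfrak t_0[\cdot,\cdot]\in\mathcal M_T$ is regular. It is characterized by the property $\operatorname{dom}\mathfrak t_0=\operatorname{dom}|T|^{1/2}$. All other closures in $\mathcal M_T$ are not regular. (ii) For one element $(K_0,[\cdot,\cdot]_0,A_0)\in\mathcal N_T$ infinity is not a singular critical point of the J-self-adjoint, J-non-negative and boundedly invertible operator $A_0$. For all other elements of $\mathcal N_T$ infinity is a singular critical point of the corresponding operator. (iii) $(K_0,[\cdot,\cdot]_0,A_0)=\Phi_T(\mathfrak t_0[\cdot,\cdot])$. (iv) For two closures $\mathfrak t_1[\cdot,\cdot],\mathfrak t_2[\cdot,\cdot]\in\mathcal M_T$ the relation $\operatorname{dom}\mathfrak t_1\subset\operatorname{dom}\mathfrak t_2$ implies $\mathfrak t_1[\cdot,\cdot]=\mathfrak t_2[\cdot,\cdot]$. (v) For two Krein space completions $(K_1,[\cdot,\cdot]_1)$, $(K_2,[\cdot,\cdot]_2)$ of $(\operatorname{dom}T,(T\cdot,\cdot))$ which are continuously embedded in $(H,(\cdot,\cdot))$ the relation $K_1\subset K_2$ implies $K_1=K_2$ and $[\cdot,\cdot]_1=[\cdot,\cdot]_2$.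
   Context: All spaces are complex; sesquilinear forms are linear in the first argument. "Boundedly invertible" means having an everywhere defined bounded inverse. Krein spaces. $(K,[\cdot,\cdot])$ is a Krein space if $K=K^+\oplus K^-$ (direct, $[\cdot,\cdot]$-orthogonal) with $(K^+,[\cdot,\cdot])$ and $(K^-,-[\cdot,\cdot])$ Hilbert spaces. With the projections $P^\pm$ onto $K^\pm$, $J:=P^+-P^-$ is a fundamental symmetry and $\{\cdot,\cdot\}:=[J\cdot,\cdot]$ is a Hilbert space inner product on $K$; its topology (independent of $J$) is the topology of $K$. A densely defined operator $A$ in $K$ is J-self-adjoint (J-non-negative) if $JA$ is self-adjoint (non-negative) in $(K,\{\cdot,\cdot\})$. A Krein space $(K,[\cdot,\cdot])$ is a Krein space completion of an inner product space $(\widetilde K,[\cdot,\cdot]^\sim)$ if $\widetilde K$ is a dense subspace of $K$ and the inner products coincide on $\widetilde K$. Forms. A form is a densely defined symmetric sesquilinear form $\mathfrak t[\cdot,\cdot]$ in $(H,(\cdot,\cdot))$. Put $\mathfrak t_\lambda[\cdot,\cdot]:=\mathfrak t[\cdot,\cdot]-\lambda(\cdot,\cdot)$. It is closed if for some $\lambda\in\mathbb R$ (a gap point) $(\operatorname{dom}\mathfrak t,\mathfrak t_\lambda[\cdot,\cdot])$ is a Krein space continuously embedded in $(H,(\cdot,\cdot))$. A closed extension $\mathfrak t$ of a form $\tilde{\mathfrak t}$ is a closure of $\tilde{\mathfrak t}$ if $\operatorname{dom}\tilde{\mathfrak t}$ is dense in the Krein space $(\operatorname{dom}\mathfrak t,\mathfrak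 t_\lambda[\cdot,\cdot])$ for some gap point $\lambda$. For a closed form there is a unique self-adjoint operator $T_{\mathfrak t}$ in $H$ with $\operatorname{dom}T_{\mathfrak t}\subset\operatorname{dom}\mathfrak t$ and $\mathfrak t[u,v]=(T_{\mathfrak t}u,v)$ for $u\in\operatorname{dom}T_{\mathfrak t}$, $v\in\operatorname{dom}\mathfrak t$. The range restriction $A_{\mathfrak t}$ is the restriction of $T_{\mathfrak t}$ to $\operatorname{dom}A_{\mathfrak t}:=\{f\in\operatorname{dom}T_{\mathfrak t}:T_{\mathfrak t}f\in\operatorname{dom}\mathfrak t\}$. A closed form is regular if $\operatorname{dom}\mathfrak t=\operatorname{dom}|T_{\mathfrak t}|^{1/2}$. The sets. $\mathcal M_T$ is the set of all closures of the form $(T\cdot,\cdot)$ (defined on $\operatorname{dom}T$) in $(H,(\cdot,\cdot))$. $\mathcal N_T$ is the set of all triples $(K,[\cdot,\cdot],A)$ where $(K,[\cdot,\cdot])$ is a Krein space completion of $(\operatorname{dom}T,(T\cdot,\cdot))$ continuously embedded in $(H,(\cdot,\cdot))$ and $A=T|_{\operatorname{dom}A}$, $\operatorname{dom}A=T^{-1}(K)$; each such $A$ is J-self-adjoint, J-non-negative and boundedly invertible in $(K,[\cdot,\cdot])$. The bijection $\Phi_T$ maps $\mathfrak t[\cdot,\cdot]$ to $(\operatorname{dom}\mathfrak t,\mathfrak t[\cdot,\cdot],A_{\mathfrak t})$. Singular critical point infinity. Let $A$ be J-self-adjoint, J-non-negative and boundedly invertible in a Krein space $K$, and let $\Sigma$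 be the semiring of all bounded intervals in $\mathbb R$ and their complements. Langer's eigenspectral function $E:\Sigma\to L(K)$ (with $L(K)$ the bounded operators on $K$) is given, for a non-empty bounded interval $\Delta$ with endpoints $\alpha\le\beta$, by $$E(\Delta)f=\lim_{\epsilon\searrow0}\lim_{\delta\searrow0}-\frac1{2\pi i}\int_{C^\delta_{\Delta_\epsilon}}(A-\lambda)^{-1}f\,d\lambda\quad(f\in K)$$ (limits in $K$), where $\Delta_\epsilon=[\alpha\mp\epsilon,\beta\pm\epsilon]$, the upper (lower) sign being taken at an endpoint if that endpoint belongs (does not belong) to $\Delta$ ($\Delta_\epsilon=\emptyset$ if the left end exceeds the right end), and for $\Delta'=[\alpha',\beta']$, $C^\delta_{\Delta'}$ is the positively oriented polygon $\beta'+i,\alpha'+i,\alpha'-i,\beta'-i,\beta'+i$ with the segments between $\alpha'\pm i\delta$ and between $\beta'\pm i\delta$ removed. Moreover $E(\emptyset)=0$ and $E(\Delta)=I-E(\mathbb R\setminus\Delta)$ for unbounded $\Delta\in\Sigma$. Infinity is a singular critical point of $A$ if for some $\varepsilon>0$ and some $f\in K$ one of the limits $\lim_{\lambda\to\infty}E([\varepsilon,\lambda])f$, $\lim_{\lambda\to\infty}E([-\lambda,-\varepsilon])f$ does not exist in $K$. *)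

theory Defs
  imports "HOL-Analysis.Analysis"
begin

section \<open>Complex Hilbert spaces\<close>

class complex_vector = ab_group_add +
  fixes scaleC :: "complex \<Rightarrow> 'a \<Rightarrow> 'a" (infixr \<open>*\<^sub>C\<close> 75)
  assumes scaleC_add_right: "a *\<^sub>C (x + y) = a *\<^sub>C x + a *\<^sub>C y"
    and scaleC_add_left: "(a + b) *\<^sub>C x = a *\<^sub>C x + b *\<^sub>C x"
    and scaleC_scaleC: "a *\<^sub>C (b *\<^sub>C x) = (a * b) *\<^sub>C x"
    and scaleC_one: "1 *\<^sub>C x = x"

global_interpretation complex_vector:
  vector_space "scaleC :: complex \<Rightarrow> 'a \<Rightarrow> 'a::complex_vector"
  by unfold_locales
    (simp_all add: scaleC_add_right scaleC_add_left scaleC_scaleC scaleC_one)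

abbreviation csubspace :: "'a::complex_vector set \<Rightarrow> bool"
  where "csubspace \<equiv> complex_vector.subspace"

text \<open>
  Positive definiteness of \<open>cinner\<close> is not an axiom: by \<open>cinner_commute\<close> and
  \<open>inner_eq_Re_cinner\<close> we have \<open>cinner x x = of_real (inner x x)\<close>. The norm, the metric and
  the topology are those of the underlying real inner product space.
\<close>

class chilbert_space = complex_vector + real_inner + complete_space +
  fixes cinner :: "'a \<Rightarrow> 'a \<Rightarrow> complex"
  assumes scaleR_scaleC: "scaleR r x = complex_of_real r *\<^sub>C x"
    and cinner_commute: "cinner x y = cnj (cinner y x)"
    and cinner_add_left: "cinner (x + y) z = cinner x z + cinner y z"
    and cinner_scaleC_left: "cinner (c *\<^sub>C x) y = c * cinner x y"
    and inner_eq_Re_cinner: "inner x y = Re (cinner x y)"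

instantiation complex :: chilbert_space
begin
definition scaleC_complex :: "complex \<Rightarrow> complex \<Rightarrow> complex"
  where "scaleC_complex = (*)"
definition cinner_complex :: "complex \<Rightarrow> complex \<Rightarrow> complex"
  where "cinner_complex z w = z * cnj w"
instance
  by standard
    (simp_all add: scaleC_complex_def cinner_complex_def algebra_simps scaleR_conv_of_real
      inner_complex_def)
end

section \<open>Inner products on subspaces\<close>

text \<open>
  Krein and Hilbert spaces other than the ambient space are given by a carrier set and a function
  whose values on the carrier form the inner product.
\<close>

definition sesquilinear_on :: "'a::complex_vector set \<Rightarrow> ('a \<Rightarrow> 'a \<Rightarrow> complex) \<Rightarrow> bool"
  where "sesquilinear_on K q \<longleftrightarrow> csubspace K \<and>
    (\<forall>x\<in>K. \<forall>y\<in>K. \<forall>z\<in>K. q (x + y) z = q x z + q y z \<and> q z (x + y) = q z x + q z y) \<and>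
    (\<forall>c. \<forall>x\<in>K. \<forall>y\<in>K. q (c *\<^sub>C x) y = c * q x y \<and> q x (c *\<^sub>C y) = cnj c * q x y)"

definition symmetric_on :: "'a set \<Rightarrow> ('a \<Rightarrow> 'a \<Rightarrow> complex) \<Rightarrow> bool"
  where "symmetric_on K q \<longleftrightarrow> (\<forall>x\<in>K. \<forall>y\<in>K. q x y = cnj (q y x))"

definition ip_norm :: "('a \<Rightarrow> 'a \<Rightarrow> complex) \<Rightarrow> 'a \<Rightarrow> real"
  where "ip_norm q x = sqrt (Re (q x x))"

text \<open>
  The value \<open>0\<close> off the carrier makes \<open>Metric_space K (ip_dist K q)\<close> hold for every positive
  definite \<open>q\<close>, because that locale demands non-negativity and symmetry everywhere.
\<close>

definition ip_dist :: "'a::complex_vector set \<Rightarrow> ('a \<Rightarrow> 'a \<Rightarrow> complex) \<Rightarrow> 'a \<Rightarrow> 'a \<Rightarrow> real"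
  where "ip_dist K q x y = (if x \<in> K \<and> y \<in> K then ip_norm q (x - y) else 0)"

definition ip_topology :: "'a::complex_vector set \<Rightarrow> ('a \<Rightarrow> 'a \<Rightarrow> complex) \<Rightarrow> 'a topology"
  where "ip_topology K q = Metric_space.mtopology K (ip_dist K q)"

definition hilbert_space_on :: "'a::complex_vector set \<Rightarrow> ('a \<Rightarrow> 'a \<Rightarrow> complex) \<Rightarrow> bool"
  where "hilbert_space_on K q \<longleftrightarrow>
    sesquilinear_on K q \<and> symmetric_on K q \<and>
    (\<forall>x\<in>K. q x x \<in> \<real>\<^sub>\<ge>\<^sub>0 \<and> (q x x = 0 \<longrightarrow> x = 0)) \<and>
    Metric_space.mcomplete K (ip_dist K q)"

section \<open>Unbounded operators in a Hilbert space\<close>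

text \<open>
  Operators are partial functions with their domain built in, so equality of operators includes
  equality of domains; the product of operators on its maximal domain is \<open>(\<circ>\<^sub>m)\<close>, and
  restriction is \<open>(|`)\<close>.
\<close>

definition linear_operator :: "'a::complex_vector set \<Rightarrow> ('a \<rightharpoonup> 'a) \<Rightarrow> bool"
  where "linear_operator K S \<longleftrightarrow> csubspace (dom S) \<and> dom S \<subseteq> K \<and> ran S \<subseteq> K \<and>
    (\<forall>u\<in>dom S. \<forall>v\<in>dom S. the (S (u + v)) = the (S u) + the (S v)) \<and>
    (\<forall>c. \<forall>u\<in>dom S. the (S (c *\<^sub>C u)) = c *\<^sub>C the (S u))"

definition densely_defined ::
    "'a::complex_vector set \<Rightarrow> ('a \<Rightarrow> 'a \<Rightarrow> complex) \<Rightarrow> ('a \<rightharpoonup> 'a) \<Rightarrow> bool"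
  where "densely_defined K q S \<longleftrightarrow> ip_topology K q closure_of dom S = K"

definition op_adjoint ::
    "'a::complex_vector set \<Rightarrow> ('a \<Rightarrow> 'a \<Rightarrow> complex) \<Rightarrow> ('a \<rightharpoonup> 'a) \<Rightarrow> ('a \<rightharpoonup> 'a)"
  where "op_adjoint K q S = (\<lambda>v.
    if v \<in> K \<and> (\<exists>w\<in>K. \<forall>u\<in>dom S. q (the (S u)) v = q u w)
    then Some (THE w. w \<in> K \<and> (\<forall>u\<in>dom S. q (the (S u)) v = q u w))
    else None)"

definition self_adjoint ::
    "'a::complex_vector set \<Rightarrow> ('a \<Rightarrow> 'a \<Rightarrow> complex) \<Rightarrow> ('a \<rightharpoonup> 'a) \<Rightarrow> bool"
  where "self_adjoint K q S \<longleftrightarrow>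
    linear_operator K S \<and> densely_defined K q S \<and> op_adjoint K q S = S"

definition non_negative ::
    "('a \<Rightarrow> 'a \<Rightarrow> complex) \<Rightarrow> ('a \<rightharpoonup> 'a) \<Rightarrow> bool"
  where "non_negative q S \<longleftrightarrow> (\<forall>u\<in>dom S. q (the (S u)) u \<in> \<real>\<^sub>\<ge>\<^sub>0)"

definition boundedly_invertible ::
    "'a::complex_vector set \<Rightarrow> ('a \<Rightarrow> 'a \<Rightarrow> complex) \<Rightarrow> ('a \<rightharpoonup> 'a) \<Rightarrow> bool"
  where "boundedly_invertible K q S \<longleftrightarrow>
    bij_betw (\<lambda>u. the (S u)) (dom S) K \<and>
    (\<exists>C. \<forall>u\<in>dom S. ip_norm q u \<le> C * ip_norm q (the (S u)))"

definition op_sqrt :: "('h::chilbert_space \<rightharpoonup> 'h) \<Rightarrow> ('h \<rightharpoonup> 'h)"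
  where "op_sqrt S =
    (THE R. self_adjoint UNIV cinner R \<and> non_negative cinner R \<and> R \<circ>\<^sub>m R = S)"

definition op_abs :: "('h::chilbert_space \<rightharpoonup> 'h) \<Rightarrow> ('h \<rightharpoonup> 'h)"
  where "op_abs S = op_sqrt (op_adjoint UNIV cinner S \<circ>\<^sub>m S)"

section \<open>Krein spaces\<close>

definition fundamental_decomposition ::
    "'a::complex_vector set \<Rightarrow> ('a \<Rightarrow> 'a \<Rightarrow> complex) \<Rightarrow> 'a set \<Rightarrow> 'a set \<Rightarrow> bool"
  where "fundamental_decomposition K q Kp Km \<longleftrightarrow>
    K = {x + y | x y. x \<in> Kp \<and> y \<in> Km} \<and> Kp \<inter> Km = {0} \<and>
    (\<forall>x\<in>Kp. \<forall>y\<in>Km. q x y = 0) \<and>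
    hilbert_space_on Kp q \<and> hilbert_space_on Km (\<lambda>x y. - q x y)"

text \<open>
  The inner product is normalised to vanish off the carrier, so that equality of pairs
  (carrier, inner product) is equality of inner product spaces.
\<close>

definition zero_outside :: "'a set \<Rightarrow> ('a \<Rightarrow> 'a \<Rightarrow> complex) \<Rightarrow> bool"
  where "zero_outside K q \<longleftrightarrow> (\<forall>x y. x \<notin> K \<or> y \<notin> K \<longrightarrow> q x y = 0)"

definition krein_space :: "'a::complex_vector set \<Rightarrow> ('a \<Rightarrow> 'a \<Rightarrow> complex) \<Rightarrow> bool"
  where "krein_space K q \<longleftrightarrow>
    sesquilinear_on K q \<and> symmetric_on K q \<and> zero_outside K q \<and>
    (\<exists>Kp Km. fundamental_decomposition K q Kp Km)"

definition projection_along :: "'a::complex_vector set \<Rightarrow> 'a set \<Rightarrow> 'a \<Rightarrow> 'a"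
  where "projection_along M N x = (THE y. y \<in> M \<and> x - y \<in> N)"

text \<open>
  One fundamental symmetry is fixed. The topology and the notions of J-self-adjoint,
  J-non-negative and boundedly invertible operators do not depend on this choice.
\<close>

definition fundamental_symmetry ::
    "'a::complex_vector set \<Rightarrow> ('a \<Rightarrow> 'a \<Rightarrow> complex) \<Rightarrow> 'a \<Rightarrow> 'a"
  where "fundamental_symmetry K q =
    (case (SOME (Kp, Km). fundamental_decomposition K q Kp Km) of
      (Kp, Km) \<Rightarrow> (\<lambda>x. projection_along Kp Km x - projection_along Km Kp x))"

definition krein_ip ::
    "'a::complex_vector set \<Rightarrow> ('a \<Rightarrow> 'a \<Rightarrow> complex) \<Rightarrow> 'a \<Rightarrow> 'a \<Rightarrow> complex"
  where "krein_ip K q x y = q (fundamental_symmetry K q x) y"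

definition krein_topology ::
    "'a::complex_vector set \<Rightarrow> ('a \<Rightarrow> 'a \<Rightarrow> complex) \<Rightarrow> 'a topology"
  where "krein_topology K q = ip_topology K (krein_ip K q)"

definition J_self_adjoint ::
    "'a::complex_vector set \<Rightarrow> ('a \<Rightarrow> 'a \<Rightarrow> complex) \<Rightarrow> ('a \<rightharpoonup> 'a) \<Rightarrow> bool"
  where "J_self_adjoint K q A \<longleftrightarrow>
    self_adjoint K (krein_ip K q) (map_option (fundamental_symmetry K q) \<circ> A)"

definition J_non_negative ::
    "'a::complex_vector set \<Rightarrow> ('a \<Rightarrow> 'a \<Rightarrow> complex) \<Rightarrow> ('a \<rightharpoonup> 'a) \<Rightarrow> bool"
  where "J_non_negative K q A \<longleftrightarrow>
    non_negative (krein_ip K q) (map_option (fundamental_symmetry K q) \<circ> A)"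

definition continuously_embedded ::
    "'h::chilbert_space set \<Rightarrow> ('h \<Rightarrow> 'h \<Rightarrow> complex) \<Rightarrow> bool"
  where "continuously_embedded K q \<longleftrightarrow>
    continuous_map (krein_topology K q) euclidean (\<lambda>x. x)"

definition krein_completion ::
    "'a::complex_vector set \<Rightarrow> ('a \<Rightarrow> 'a \<Rightarrow> complex) \<Rightarrow> 'a set \<Rightarrow> ('a \<Rightarrow> 'a \<Rightarrow> complex) \<Rightarrow> bool"
  where "krein_completion D p K q \<longleftrightarrow>
    krein_space K q \<and> csubspace D \<and> D \<subseteq> K \<and> krein_topology K q closure_of D = K \<and>
    (\<forall>u\<in>D. \<forall>v\<in>D. q u v = p u v)"

section \<open>Forms\<close>

text \<open>
  A form is a pair (domain, values), with values \<open>0\<close> off the domain.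
\<close>

type_synonym 'h form = "'h set \<times> ('h \<Rightarrow> 'h \<Rightarrow> complex)"

abbreviation form_dom :: "'h form \<Rightarrow> 'h set"
  where "form_dom \<equiv> fst"

abbreviation form_val :: "'h form \<Rightarrow> 'h \<Rightarrow> 'h \<Rightarrow> complex"
  where "form_val \<equiv> snd"

definition is_form :: "'h::chilbert_space form \<Rightarrow> bool"
  where "is_form t \<longleftrightarrow>
    closure (form_dom t) = UNIV \<and> sesquilinear_on (form_dom t) (form_val t) \<and>
    symmetric_on (form_dom t) (form_val t) \<and> zero_outside (form_dom t) (form_val t)"

definition form_shift :: "'h::chilbert_space form \<Rightarrow> real \<Rightarrow> 'h \<Rightarrow> 'h \<Rightarrow> complex"
  where "form_shift t \<gamma> u v =
    (if u \<in> form_dom t \<and> v \<in> form_dom t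
     then form_val t u v - complex_of_real \<gamma> * cinner u v else 0)"

definition gap_point :: "'h::chilbert_space form \<Rightarrow> real \<Rightarrow> bool"
  where "gap_point t \<gamma> \<longleftrightarrow>
    krein_space (form_dom t) (form_shift t \<gamma>) \<and>
    continuously_embedded (form_dom t) (form_shift t \<gamma>)"

definition closed_form :: "'h::chilbert_space form \<Rightarrow> bool"
  where "closed_form t \<longleftrightarrow> is_form t \<and> (\<exists>\<gamma>. gap_point t \<gamma>)"

definition form_closure_of :: "'h::chilbert_space form \<Rightarrow> 'h form \<Rightarrow> bool"
  where "form_closure_of s t \<longleftrightarrow>
    closed_form t \<and> form_dom s \<subseteq> form_dom t \<and>
    (\<forall>u\<in>form_dom s. \<forall>v\<in>form_dom s. form_val t u v = form_val s u v) \<and>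
    (\<exists>\<gamma>. gap_point t \<gamma> \<and>
      krein_topology (form_dom t) (form_shift t \<gamma>) closure_of form_dom s = form_dom t)"

definition form_operator :: "'h::chilbert_space form \<Rightarrow> ('h \<rightharpoonup> 'h)"
  where "form_operator t = (THE S. self_adjoint UNIV cinner S \<and> dom S \<subseteq> form_dom t \<and>
    (\<forall>u\<in>dom S. \<forall>v\<in>form_dom t. form_val t u v = cinner (the (S u)) v))"

definition range_restriction :: "'h::chilbert_space form \<Rightarrow> ('h \<rightharpoonup> 'h)"
  where "range_restriction t =
    form_operator t |` {f \<in> dom (form_operator t). the (form_operator t f) \<in> form_dom t}"

definition regular_form :: "'h::chilbert_space form \<Rightarrow> bool"
  where "regular_form t \<longleftrightarrow>
    closed_form t \<and> form_dom t = dom (op_sqrt (op_abs (form_operator t)))"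

section \<open>The eigenspectral function and the critical point infinity\<close>

text \<open>
  Limits and integrals are taken in a topology \<open>X\<close> on a subset of the vector space. The integral
  over \<open>{0..1}\<close> is the gauge integral, that is \<open>has_integral_cbox\<close> with the norm topology
  replaced by \<open>X\<close>.
\<close>

definition lim_in :: "'a topology \<Rightarrow> ('b \<Rightarrow> 'a) \<Rightarrow> 'b filter \<Rightarrow> 'a"
  where "lim_in X g F = (THE l. limitin X g l F)"

definition segment_integral ::
    "'a::complex_vector topology \<Rightarrow> complex \<Rightarrow> complex \<Rightarrow> (complex \<Rightarrow> 'a) \<Rightarrow> 'a"
  where "segment_integral X a b g =
    lim_in X (\<lambda>p. \<Sum>(s, k)\<in>p. complex_of_real (measure lborel k) *\<^sub>C ((b - a) *\<^sub>C g (linepath a b s)))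
      (division_filter {0..1::real})"

definition cut_polygon_integral ::
    "'a::complex_vector topology \<Rightarrow> real \<Rightarrow> real \<Rightarrow> real \<Rightarrow> (complex \<Rightarrow> 'a) \<Rightarrow> 'a"
  where "cut_polygon_integral X \<alpha> \<beta> \<delta> g =
    segment_integral X (Complex \<beta> \<delta>) (Complex \<beta> 1) g +
    segment_integral X (Complex \<beta> 1) (Complex \<alpha> 1) g +
    segment_integral X (Complex \<alpha> 1) (Complex \<alpha> \<delta>) g +
    segment_integral X (Complex \<alpha> (- \<delta>)) (Complex \<alpha> (- 1)) g +
    segment_integral X (Complex \<alpha> (- 1)) (Complex \<beta> (- 1)) g +
    segment_integral X (Complex \<beta> (- 1)) (Complex \<beta> (- \<delta>)) g"

definition resolvent :: "('a::complex_vector \<rightharpoonup> 'a) \<Rightarrow> complex \<Rightarrow> 'a \<Rightarrow> 'a"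
  where "resolvent A \<mu> f = (THE u. u \<in> dom A \<and> the (A u) - \<mu> *\<^sub>C u = f)"

definition eigenspectral_bounded ::
    "'a::complex_vector set \<Rightarrow> ('a \<Rightarrow> 'a \<Rightarrow> complex) \<Rightarrow> ('a \<rightharpoonup> 'a) \<Rightarrow> real set \<Rightarrow> 'a \<Rightarrow> 'a"
  where "eigenspectral_bounded K q A \<Delta> f =
    (if \<Delta> = {} then 0 else
      lim_in (krein_topology K q) (\<lambda>\<epsilon>.
        let \<alpha> = (if Inf \<Delta> \<in> \<Delta> then Inf \<Delta> - \<epsilon> else Inf \<Delta> + \<epsilon>);
            \<beta> = (if Sup \<Delta> \<in> \<Delta> then Sup \<Delta> + \<epsilon> else Sup \<Delta> - \<epsilon>)
        in if \<alpha> > \<beta> then 0 else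
          lim_in (krein_topology K q) (\<lambda>\<delta>.
            (- 1 / (2 * complex_of_real pi * \<i>)) *\<^sub>C
              cut_polygon_integral (krein_topology K q) \<alpha> \<beta> \<delta> (\<lambda>\<mu>. resolvent A \<mu> f))
          (at_right 0))
      (at_right 0))"

text \<open>
  Only meaningful on bounded intervals and their complements.
\<close>

definition eigenspectral ::
    "'a::complex_vector set \<Rightarrow> ('a \<Rightarrow> 'a \<Rightarrow> complex) \<Rightarrow> ('a \<rightharpoonup> 'a) \<Rightarrow> real set \<Rightarrow> 'a \<Rightarrow> 'a"
  where "eigenspectral K q A \<Delta> f =
    (if bounded \<Delta> then eigenspectral_bounded K q A \<Delta> f
     else f - eigenspectral_bounded K q A (- \<Delta>) f)"

definition infinity_singular_critical_point ::
    "'a::complex_vector set \<Rightarrow> ('a \<Rightarrow> 'a \<Rightarrow> complex) \<Rightarrow> ('a \<rightharpoonup> 'a) \<Rightarrow> bool"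
  where "infinity_singular_critical_point K q A \<longleftrightarrow>
    (\<exists>\<epsilon>>0. \<exists>f\<in>K.
      \<not> (\<exists>l. limitin (krein_topology K q) (\<lambda>r. eigenspectral K q A {\<epsilon>..r} f) l at_top) \<or>
      \<not> (\<exists>l. limitin (krein_topology K q) (\<lambda>r. eigenspectral K q A {-r..-\<epsilon>} f) l at_top))"

section \<open>Closures and Krein space completions associated with an operator\<close>

definition operator_form :: "('h::chilbert_space \<rightharpoonup> 'h) \<Rightarrow> 'h form"
  where "operator_form T =
    (dom T, \<lambda>u v. if u \<in> dom T \<and> v \<in> dom T then cinner (the (T u)) v else 0)"

definition form_closures :: "('h::chilbert_space \<rightharpoonup> 'h) \<Rightarrow> 'h form set" (\<open>\<M>\<close>)
  where "\<M> T = {t. form_closure_of (operator_form T) t}"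

definition embedded_completion ::
    "('h::chilbert_space \<rightharpoonup> 'h) \<Rightarrow> 'h set \<Rightarrow> ('h \<Rightarrow> 'h \<Rightarrow> complex) \<Rightarrow> bool"
  where "embedded_completion T K q \<longleftrightarrow>
    krein_completion (form_dom (operator_form T)) (form_val (operator_form T)) K q \<and>
    continuously_embedded K q"

definition krein_triples ::
    "('h::chilbert_space \<rightharpoonup> 'h) \<Rightarrow> ('h set \<times> ('h \<Rightarrow> 'h \<Rightarrow> complex) \<times> ('h \<rightharpoonup> 'h)) set" (\<open>\<N>\<close>)
  where "\<N> T = {(K, q, A). embedded_completion T K q \<and> A = T |` {u \<in> dom T. the (T u) \<in> K}}"

definition form_triple ::
    "'h::chilbert_space form \<Rightarrow> 'h set \<times> ('h \<Rightarrow> 'h \<Rightarrow> complex) \<times> ('h \<rightharpoonup> 'h)" (\<open>\<Phi>\<close>)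
  where "\<Phi> t = (form_dom t, form_val t, range_restriction t)"

end

theory Submission
  imports Defs "HOL-Probability.Probability"
begin

text \<open>
  Put \<open>G = T\<^sup>-\<^sup>1\<close>. A Krein space completion \<open>(K, q)\<close> of \<open>(dom T, (T \<cdot>, \<cdot>))\<close> that is continuously
  embedded in \<open>H\<close> amounts to a factorization \<open>G = S J S\<close> with \<open>S\<close> positive and injective, \<open>J\<close> a
  hermitian symmetry, \<open>K = range S\<close> and \<open>q (S x) (S y) = (J x, y)\<close>. An inclusion \<open>K\<^sub>1 \<subseteq> K\<^sub>2\<close> gives
  \<open>S\<^sub>1 = S\<^sub>2 X\<close> with \<open>X\<close> bounded, so that \<open>J\<^sub>2 = X J\<^sub>1 X\<^sup>*\<close>; hence \<open>X\<close> is invertible and the two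
  completions agree. The choice \<open>S = \<bar>G\<bar>\<^sup>1\<^sup>/\<^sup>2\<close>, \<open>J = sgn G\<close> is the regular completion.

  The Cauchy integrals defining \<open>E(\<Delta>)\<close> act as functions of \<open>G\<close>, so \<open>E(\<Delta>)\<close> restricts the spectral
  projection of \<open>T\<close>. Functions of \<open>G\<close> commute with \<open>\<bar>G\<bar>\<^sup>1\<^sup>/\<^sup>2\<close>, so in the regular completion the
  limits at infinity exist. Conversely, if they exist in \<open>K\<close>, then \<open>sgn G\<close> maps \<open>K\<close> into itself,
  which forces \<open>range \<bar>G\<bar>\<^sup>1\<^sup>/\<^sup>2 \<subseteq> K\<close> and therefore equality by the inclusion argument.
\<close>

text \<open>The eigenspectral function is defined by limits in the topology of \<open>K\<close>,
  whereas a functional calculus of \<open>G\<close> converges in \<open>H\<close>. The bridge is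
  that the resolvent of the restricted operator is \<open>G\<close> times the bounded function
  \<open>1 / (1 - mu t)\<close> of \<open>G\<close>, and that \<open>G = S J S\<close> maps
  \<open>H\<close> continuously into \<open>K\<close>. Integrals and limits over bounded intervals
  are therefore taken in \<open>H\<close> and carried into \<open>K\<close> by one application of
  \<open>G\<close>. This always succeeds, because the indicator of \<open>a <= 1 / t <= b\<close> is
  \<open>t\<close> times the function \<open>1 / t\<close> cut off to that set, which is bounded. As
  the interval grows, \<open>1 / t\<close> becomes unbounded on it, the factor \<open>G\<close> can
  no longer be split off, and the limit may exist in \<open>H\<close> but not in \<open>K\<close>.
  The other obstacle is that a closure comes with an arbitrary gap point, whereas a completion
  corresponds to the gap point \<open>0\<close>; the shift is removed by a change of coordinates.
  Operators obtained by formally cancelling \<open>S\<close> are bounded because they have an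
  explicit adjoint on a dense set.\<close>

instance chilbert_space \<subseteq> banach ..

section \<open>Complex inner products\<close>

lemma cinner_add_right: "cinner x (y + z) = cinner x y + cinner x z"
  for x :: "'h::chilbert_space"
  by (metis cinner_commute cinner_add_left complex_cnj_add)

lemma cinner_scaleC_right: "cinner x (c *\<^sub>C y) = cnj c * cinner x y"
  for x :: "'h::chilbert_space"
  by (metis cinner_commute cinner_scaleC_left complex_cnj_mult)

lemma scaleC_minus1: "(-1) *\<^sub>C x = - x" for x :: "'a::complex_vector"
  by simp

lemma cinner_minus_left: "cinner (- x) y = - cinner x y" for x :: "'h::chilbert_space"
  by (metis cinner_scaleC_left mult_minus1 scaleC_minus1)

lemma cinner_minus_right: "cinner x (- y) = - cinner x y" for x :: "'h::chilbert_space"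
  by (metis cinner_commute cinner_minus_left complex_cnj_minus)

lemma cinner_diff_left: "cinner (x - y) z = cinner x z - cinner y z" for x :: "'h::chilbert_space"
  by (metis cinner_add_left cinner_minus_left uminus_add_conv_diff add.commute)

lemma cinner_diff_right: "cinner x (y - z) = cinner x y - cinner x z" for x :: "'h::chilbert_space"
  by (metis cinner_add_right cinner_minus_right uminus_add_conv_diff add.commute)

lemma cinner_zero [simp]: "cinner 0 x = 0" "cinner x 0 = 0" for x :: "'h::chilbert_space"
  using cinner_diff_left[of x x x] cinner_diff_right[of x x x] cinner_diff_left[of 0 0 x]
    cinner_diff_right[of x 0 0] by simp_all

lemma cinner_self: "cinner x x = of_real ((norm x)\<^sup>2)" for x :: "'h::chilbert_space"
proof -
  have "cinner x x = cnj (cinner x x)" by (rule cinner_commute)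
  then have "Im (cinner x x) = 0" by (simp add: complex_eq_iff)
  moreover have "Re (cinner x x) = (norm x)\<^sup>2"
    by (metis inner_eq_Re_cinner power2_norm_eq_inner)
  ultimately show ?thesis by (simp add: complex_eq_iff)
qed

lemma norm_scaleC: "norm (c *\<^sub>C x) = norm c * norm x" for x :: "'h::chilbert_space"
proof -
  have "cinner (c *\<^sub>C x) (c *\<^sub>C x) = (c * cnj c) * of_real ((norm x)\<^sup>2)"
    by (simp only: cinner_scaleC_left cinner_scaleC_right cinner_self[of x] mult_ac)
  also have "\<dots> = of_real ((norm c * norm x)\<^sup>2)"
    by (simp only: complex_norm_square[symmetric] of_real_mult[symmetric] of_real_power[symmetric] power_mult_distrib)
  finally have "cinner (c *\<^sub>C x) (c *\<^sub>C x) = of_real ((norm c * norm x)\<^sup>2)" .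
  then have "(norm (c *\<^sub>C x))\<^sup>2 = (norm c * norm x)\<^sup>2"
    by (metis cinner_self of_real_eq_iff)
  then show ?thesis by (simp add: power2_eq_iff_nonneg)
qed

lemma norm_cinner_le: "norm (cinner x y) \<le> norm x * norm y" for x :: "'h::chilbert_space"
proof (cases "cinner x y = 0")
  case False
  \<comment> \<open>A unimodular factor rotates the inner product onto the positive real axis, where
    the real Cauchy-Schwarz inequality applies.\<close>
  define u where "u = cnj (cinner x y) / norm (cinner x y)"
  have nu: "norm u = 1" using False by (simp add: u_def norm_divide)
  have "cinner (u *\<^sub>C x) y = of_real (norm (cinner x y))"
    using False by (simp add: cinner_scaleC_left u_def mult.commute complex_norm_square[symmetric] power2_eq_square)
  then have "norm (cinner x y) = inner (u *\<^sub>C x) y" by (simp add: inner_eq_Re_cinner)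
  also have "\<dots> \<le> norm (u *\<^sub>C x) * norm y" by (rule norm_cauchy_schwarz)
  finally show ?thesis by (simp add: norm_scaleC nu)
qed simp

lemma cinner_scaleR_left: "cinner (r *\<^sub>R x) y = of_real r * cinner x y" for x :: "'h::chilbert_space"
  by (simp add: scaleR_scaleC cinner_scaleC_left)

lemma cinner_scaleR_right: "cinner x (r *\<^sub>R y) = of_real r * cinner x y" for x :: "'h::chilbert_space"
  by (simp add: scaleR_scaleC cinner_scaleC_right)

lemma bounded_bilinear_cinner: "bounded_bilinear (cinner :: 'h::chilbert_space \<Rightarrow> 'h \<Rightarrow> complex)"
  by standard
    (auto simp: cinner_add_left cinner_add_right cinner_scaleR_left cinner_scaleR_right
      scaleR_conv_of_real intro!: exI[of _ 1] norm_cinner_le)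

lemma bounded_bilinear_scaleC: "bounded_bilinear (scaleC :: complex \<Rightarrow> 'h::chilbert_space \<Rightarrow> 'h)"
  by standard
    (auto simp: scaleC_add_left scaleC_add_right scaleR_scaleC scaleC_scaleC norm_scaleC
      scaleC_complex_def mult.commute intro!: exI[of _ 1])

lemmas tendsto_cinner = bounded_bilinear.tendsto[OF bounded_bilinear_cinner]
lemmas tendsto_scaleC = bounded_bilinear.tendsto[OF bounded_bilinear_scaleC]
lemmas cinner_sum_left = bounded_bilinear.sum_left[OF bounded_bilinear_cinner]
lemmas cinner_sum_right = bounded_bilinear.sum_right[OF bounded_bilinear_cinner]

text \<open>The vector \<open>a - b\<close> is itself a limit of points of \<open>D\<close>, hence
  orthogonal to itself. Vector identities can thus be tested on a dense range.\<close>

lemma eq_if_cinner_eq: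
  fixes a :: "'h::chilbert_space"
  assumes "closure D = UNIV" "\<And>z. z \<in> D \<Longrightarrow> cinner a z = cinner b z"
  shows "a = b"
proof -
  have "a - b \<in> closure D" using assms(1) by simp
  then obtain s where s: "\<And>n. s n \<in> D" "s \<longlonglongrightarrow> a - b" unfolding closure_sequential by blast
  have "(\<lambda>n. cinner (a - b) (s n)) \<longlonglongrightarrow> cinner (a - b) (a - b)"
    by (intro tendsto_cinner tendsto_const s)
  moreover have "cinner (a - b) (s n) = 0" for n using assms(2)[OF s(1)] by (simp add: cinner_diff_left)
  ultimately have "cinner (a - b) (a - b) = 0" by (simp add: LIMSEQ_const_iff)
  then show ?thesis by (simp add: cinner_self)
qed

lemma cinner_left_cancel: "(\<And>z. cinner a z = cinner b z) \<Longrightarrow> a = b" for a :: "'h::chilbert_space"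
  by (rule eq_if_cinner_eq[of UNIV]) auto

lemma cinner_right_cancel: "(\<And>z. cinner z a = cinner z b) \<Longrightarrow> a = b" for a :: "'h::chilbert_space"
  by (rule cinner_left_cancel) (metis cinner_commute)

text \<open>
  The uniform boundedness argument of Hellinger and Toeplitz: each functional
  \<open>y \<mapsto> cinner (f y) z\<close> with \<open>z \<in> D\<close> is continuous, so the sets below are closed.
\<close>

lemma bounded_linear_if_dense_adjoint:
  fixes f :: "'h::chilbert_space \<Rightarrow> 'h"
  assumes "linear f" and dense: "closure D = UNIV"
    and adj: "\<And>z. z \<in> D \<Longrightarrow> \<exists>w. \<forall>y. cinner (f y) z = cinner y w"
  shows "bounded_linear f"
proof -
  interpret linear f by fact
  define C where "C n = {y. \<forall>z\<in>D. norm (cinner (f y) z) \<le> real n * norm z}" for n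
  have closed: "closed (C n)" for n
  proof -
    have "closed {y. norm (cinner (f y) z) \<le> real n * norm z}" if z: "z \<in> D" for z
    proof -
      obtain w where "\<And>y. cinner (f y) z = cinner y w" using adj[OF z] by blast
      moreover have "closed {y. norm (cinner y w) \<le> real n * norm z}"
        by (intro closed_Collect_le continuous_on_norm continuous_on_const
            bounded_bilinear.continuous_on[OF bounded_bilinear_cinner] continuous_on_id)
      ultimately show ?thesis by simp
    qed
    moreover have "C n = (\<Inter>z\<in>D. {y. norm (cinner (f y) z) \<le> real n * norm z})"
      by (auto simp: C_def)
    ultimately show ?thesis by auto
  qed
  have "y \<in> (\<Union>n. C n)" for y
  proof -
    obtain n where n: "norm (f y) \<le> real n" using real_arch_simple by blast
    have "norm (cinner (f y) z) \<le> real n * norm z" for z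
      using norm_cinner_le[of "f y" z] mult_right_mono[OF n norm_ge_zero[of z]] by linarith
    then show ?thesis unfolding C_def by blast
  qed
  then have cover: "\<Union>(range C) = UNIV" by auto
  \<comment> \<open>The closed sets \<open>C n\<close> cover the complete space, so by Baire one of
    them has interior points.\<close>
  have "\<exists>n. interior (C n) \<noteq> {}"
  proof (rule ccontr)
    assume "\<not> ?thesis"
    then have "\<And>T. T \<in> range C \<Longrightarrow> closedin Met_TC.mtopology T \<and> Met_TC.mtopology interior_of T = {}"
      using closed by auto
    moreover have "Met_TC.mcomplete (TYPE('h))"
      by (simp add: complete_UNIV)
    ultimately have "Met_TC.mtopology interior_of (\<Union>(range C)) = {}"
      by (intro Met_TC.metric_Baire_category_alt) auto
    then show False by (simp add: cover)
  qed
  then obtain n y0 r where r: "r > 0" "cball y0 r \<subseteq> C n" 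
    by (metis ex_in_conv mem_interior_cball)
  \<comment> \<open>A short vector is the difference of two points of the ball inside
    \<open>C n\<close>, which costs the factor 2.\<close>
  have small: "norm (f y) \<le> 2 * real n" if y: "norm y \<le> r" for y
  proof -
    have le: "norm (cinner (f y) z) \<le> 2 * real n * norm z" if "z \<in> D" for z
    proof -
      have "y0 + y \<in> C n" "y0 \<in> C n" using r y by (auto simp: dist_norm subset_iff)
      then have "norm (cinner (f (y0 + y)) z) \<le> real n * norm z" "norm (cinner (f y0) z) \<le> real n * norm z"
        using that by (auto simp: C_def)
      moreover have eq: "cinner (f y) z = cinner (f (y0 + y)) z - cinner (f y0) z"
        by (simp add: add cinner_add_left)
      ultimately show ?thesis
        using norm_triangle_ineq4[of "cinner (f (y0 + y)) z" "cinner (f y0) z"] unfolding eq by linarith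
    qed
    \<comment> \<open>The estimate is available for \<open>z\<close> in \<open>D\<close> only;
      letting such \<open>z\<close> tend to \<open>f y\<close> turns it into a bound on the norm of
      \<open>f y\<close>.\<close>
    have "f y \<in> closure D" using dense by simp
    then obtain s where s: "\<And>n. s n \<in> D" "s \<longlonglongrightarrow> f y" unfolding closure_sequential by blast
    have "norm (cinner (f y) (f y)) \<le> 2 * real n * norm (f y)"
    proof (rule LIMSEQ_le)
      show "(\<lambda>k. norm (cinner (f y) (s k))) \<longlonglongrightarrow> norm (cinner (f y) (f y))"
        by (intro tendsto_norm tendsto_cinner tendsto_const s)
      show "(\<lambda>k. 2 * real n * norm (s k)) \<longlonglongrightarrow> 2 * real n * norm (f y)"
        by (intro tendsto_intros s)
    qed (use le s in auto)
    then have "norm (f y) * norm (f y) \<le> 2 * real n * norm (f y)"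
      by (simp add: cinner_self power2_eq_square norm_mult)
    then show ?thesis by (cases "f y = 0") auto
  qed
  show ?thesis
  proof (rule bounded_linear_intro[of f "2 * real n / r"])
    fix x
    show "norm (f x) \<le> norm x * (2 * real n / r)"
    proof (cases "x = 0")
      case False
      have "norm (f ((r / norm x) *\<^sub>R x)) \<le> 2 * real n" using r(1) False by (intro small) simp
      then show ?thesis using r(1) False by (simp add: scale field_simps)
    qed (simp add: zero)
  qed (simp_all add: add scale)
qed

section \<open>Bounded complex-linear and hermitian operators\<close>

definition bounded_clinear :: "('h::chilbert_space \<Rightarrow> 'h) \<Rightarrow> bool"
  where "bounded_clinear X \<longleftrightarrow> bounded_linear X \<and> (\<forall>c x. X (c *\<^sub>C x) = c *\<^sub>C X x)"

text \<open>Symmetric and everywhere defined; linearity and boundedness are automatic.\<close>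

definition hermitian :: "('h::chilbert_space \<Rightarrow> 'h) \<Rightarrow> bool"
  where "hermitian X \<longleftrightarrow> (\<forall>x y. cinner (X x) y = cinner x (X y))"

lemma hermitianD: "hermitian X \<Longrightarrow> cinner (X x) y = cinner x (X y)"
  by (simp add: hermitian_def)

text \<open>Linearity is automatic: for fixed \<open>z\<close> in \<open>D\<close> the map
  \<open>y\<close> to \<open>cinner (f y) z\<close> is an inner product with a fixed vector, and
  \<open>D\<close> separates points. This is how operators defined pointwise through
  \<open>inv S\<close> are shown to be bounded.\<close>

lemma bounded_clinear_if_dense_adjoint:
  fixes f :: "'h::chilbert_space \<Rightarrow> 'h"
  assumes dense: "closure D = UNIV"
    and adj: "\<And>z. z \<in> D \<Longrightarrow> \<exists>w. \<forall>y. cinner (f y) z = cinner y w"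
  shows "bounded_clinear f"
proof -
  have add: "f (x + y) = f x + f y" for x y
    by (rule eq_if_cinner_eq[OF dense]) (metis adj cinner_add_left)
  have scale: "f (c *\<^sub>C x) = c *\<^sub>C f x" for c x
    by (rule eq_if_cinner_eq[OF dense]) (metis adj cinner_scaleC_left)
  have "linear f" by (rule linearI) (simp_all add: add scale scaleR_scaleC)
  from bounded_linear_if_dense_adjoint[OF this dense adj] scale show ?thesis
    by (simp add: bounded_clinear_def)
qed

lemma hermitian_bounded_clinear: "hermitian X \<Longrightarrow> bounded_clinear X"
  by (rule bounded_clinear_if_dense_adjoint[of UNIV]) (auto simp: hermitian_def)

lemma bounded_clinearD:
  assumes "bounded_clinear X"
  shows "X (x + y) = X x + X y" "X (x - y) = X x - X y" "X (c *\<^sub>C x) = c *\<^sub>C X x" "X 0 = 0"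
    "X (r *\<^sub>R x) = r *\<^sub>R X x" "X (- x) = - X x"
  using assms linear_simps[of X] by (simp_all add: bounded_clinear_def)

lemma bounded_clinear_tendsto:
  "bounded_clinear X \<Longrightarrow> (f \<longlongrightarrow> l) F \<Longrightarrow> ((\<lambda>i. X (f i)) \<longlongrightarrow> X l) F"
  by (simp add: bounded_clinear_def bounded_linear.tendsto)

lemma bounded_clinear_bound:
  assumes "bounded_clinear X" obtains B where "B > 0" "\<And>x. norm (X x) \<le> B * norm x"
  using bounded_linear.pos_bounded[of X] assms by (auto simp: bounded_clinear_def mult.commute)

lemma bounded_clinear_compose:
  "bounded_clinear X \<Longrightarrow> bounded_clinear Y \<Longrightarrow> bounded_clinear (\<lambda>x. X (Y x))"
  by (simp add: bounded_clinear_def bounded_linear_compose)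

lemma bounded_clinear_continuous: "bounded_clinear X \<Longrightarrow> continuous_on S X"
  by (simp add: bounded_clinear_def linear_continuous_on)

section \<open>Inner products on carrier sets\<close>

locale prehilbert_on =
  fixes K :: "'a::complex_vector set" and q :: "'a \<Rightarrow> 'a \<Rightarrow> complex"
  assumes sesq: "sesquilinear_on K q" and sym: "symmetric_on K q"
    and nonneg: "\<And>x. x \<in> K \<Longrightarrow> q x x \<in> \<real>\<^sub>\<ge>\<^sub>0"
    and definite: "\<And>x. x \<in> K \<Longrightarrow> q x x = 0 \<Longrightarrow> x = 0"
begin

lemma subsp: "csubspace K" using sesq by (simp add: sesquilinear_on_def)

lemmas K_add = complex_vector.subspace_add[OF subsp]
  and K_diff = complex_vector.subspace_diff[OF subsp]
  and K_scale = complex_vector.subspace_scale[OF subsp]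
  and K_0 = complex_vector.subspace_0[OF subsp]

lemma add_left: "x \<in> K \<Longrightarrow> y \<in> K \<Longrightarrow> z \<in> K \<Longrightarrow> q (x + y) z = q x z + q y z"
  and add_right: "x \<in> K \<Longrightarrow> y \<in> K \<Longrightarrow> z \<in> K \<Longrightarrow> q z (x + y) = q z x + q z y"
  and scale_left: "x \<in> K \<Longrightarrow> y \<in> K \<Longrightarrow> q (c *\<^sub>C x) y = c * q x y"
  and scale_right: "x \<in> K \<Longrightarrow> y \<in> K \<Longrightarrow> q x (c *\<^sub>C y) = cnj c * q x y"
  using sesq by (simp_all add: sesquilinear_on_def)

lemma commute: "x \<in> K \<Longrightarrow> y \<in> K \<Longrightarrow> q x y = cnj (q y x)"
  using sym unfolding symmetric_on_def by blast

lemma norm_square: "x \<in> K \<Longrightarrow> (ip_norm q x)\<^sup>2 = Re (q x x)"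
  using nonneg[of x] by (auto simp: ip_norm_def nonneg_Reals_def)

lemma ip_norm_nonneg: "x \<in> K \<Longrightarrow> 0 \<le> ip_norm q x"
  using nonneg[of x] by (auto simp: ip_norm_def nonneg_Reals_def)

lemma ip_norm_eq_0: assumes "x \<in> K" shows "ip_norm q x = 0 \<longleftrightarrow> x = 0"
proof -
  have "Im (q x x) = 0" using nonneg[OF assms] by (auto simp: nonneg_Reals_def)
  then have "ip_norm q x = 0 \<longleftrightarrow> q x x = 0" by (simp add: ip_norm_def complex_eq_iff)
  then show ?thesis using definite[OF assms] scale_left[of x x 0] assms by auto
qed

lemma Re_add_scale:
  assumes "x \<in> K" "y \<in> K"
  shows "Re (q (x + of_real s *\<^sub>C y) (x + of_real s *\<^sub>C y)) =
    Re (q x x) + 2 * s * Re (q x y) + s\<^sup>2 * Re (q y y)"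
proof -
  have "Re (q y x) = Re (q x y)" using assms commute[of y x] by simp
  then show ?thesis using assms
    by (simp add: add_left add_right scale_left scale_right K_add K_scale)
      (simp add: power2_eq_square algebra_simps)
qed

lemma Re_le: assumes "x \<in> K" "y \<in> K" shows "\<bar>Re (q x y)\<bar> \<le> ip_norm q x * ip_norm q y"
proof (cases "y = 0")
  case True
  then show ?thesis
    using assms scale_right[of x x 0] ip_norm_nonneg[of x] ip_norm_nonneg[of y] by simp
next
  case False
  define a b c where "a = Re (q x x)" and "b = Re (q x y)" and "c = Re (q y y)"
  have "c > 0" using ip_norm_eq_0[of y] norm_square[of y] False assms
    unfolding c_def by (metis zero_less_power2)
  \<comment> \<open>The value \<open>s = - b / c\<close> minimises the quadratic
    \<open>a + 2 s b + s^2 c\<close>, whose non-negativity is the Cauchy-Schwarz inequality.\<close>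
  have "0 \<le> Re (q (x + of_real (- b / c) *\<^sub>C y) (x + of_real (- b / c) *\<^sub>C y))"
    using norm_square[of "x + of_real (- b / c) *\<^sub>C y"] assms 
    by (metis K_add K_scale zero_le_power2)
  also have "\<dots> = a + 2 * (- b / c) * b + (- b / c)\<^sup>2 * c"
    unfolding a_def b_def c_def by (rule Re_add_scale[OF assms])
  also have "\<dots> = a - b\<^sup>2 / c" using \<open>c > 0\<close> by (simp add: field_simps power2_eq_square)
  finally have "b\<^sup>2 \<le> a * c" using \<open>c > 0\<close> by (simp add: field_simps)
  also have "\<dots> = (ip_norm q x * ip_norm q y)\<^sup>2"
    using assms by (simp add: a_def c_def norm_square power_mult_distrib)
  finally show ?thesis unfolding b_def 
    using ip_norm_nonneg assms by (metis abs_le_square_iff abs_of_nonneg mult_nonneg_nonneg)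
qed

lemma norm_le: assumes "x \<in> K" "y \<in> K" shows "norm (q x y) \<le> ip_norm q x * ip_norm q y"
proof (cases "q x y = 0")
  case False
  define u where "u = cnj (q x y) / norm (q x y)"
  have nu: "cnj u * u = 1" using False
    by (simp add: u_def complex_norm_square[symmetric] power2_eq_square mult.commute)
  have "q (u *\<^sub>C x) y = of_real (norm (q x y))"
    using False assms by (simp add: scale_left u_def mult.commute complex_norm_square[symmetric] power2_eq_square)
  then have "norm (q x y) \<le> ip_norm q (u *\<^sub>C x) * ip_norm q y"
    using Re_le[of "u *\<^sub>C x" y] assms by (simp add: K_scale)
  moreover have "ip_norm q (u *\<^sub>C x) = ip_norm q x"
    using nu assms by (simp add: ip_norm_def scale_left scale_right K_scale mult.assoc[symmetric] mult.commute)
  ultimately show ?thesis by simp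
qed (use assms ip_norm_nonneg in auto)

lemma triangle: assumes "x \<in> K" "y \<in> K" shows "ip_norm q (x + y) \<le> ip_norm q x + ip_norm q y"
proof -
  have "(ip_norm q (x + y))\<^sup>2 = Re (q x x) + 2 * Re (q x y) + Re (q y y)"
    using Re_add_scale[OF assms, of 1] norm_square[of "x + y"] assms by (simp add: K_add)
  also have "\<dots> \<le> (ip_norm q x + ip_norm q y)\<^sup>2"
    using Re_le[OF assms] assms by (simp add: power2_sum norm_square[symmetric])
  finally show ?thesis
    by (rule power2_le_imp_le) (use assms ip_norm_nonneg in auto)
qed

lemma ip_norm_scale: "x \<in> K \<Longrightarrow> ip_norm q (c *\<^sub>C x) = norm c * ip_norm q x"
proof -
  assume x: "x \<in> K"
  have "(ip_norm q (c *\<^sub>C x))\<^sup>2 = (norm c * ip_norm q x)\<^sup>2"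
    using x by (simp add: norm_square K_scale scale_left scale_right power_mult_distrib cmod_power2)
      (simp add: algebra_simps power2_eq_square)
  then show ?thesis
    using x ip_norm_nonneg by (simp add: power2_eq_iff_nonneg K_scale)
qed

lemma ip_norm_minus: "x \<in> K \<Longrightarrow> y \<in> K \<Longrightarrow> ip_norm q (x - y) = ip_norm q (y - x)"
  using ip_norm_scale[of "y - x" "-1"] by (simp add: K_diff)

sublocale Metric_space K "ip_dist K q"
proof
  fix x y z
  show "0 \<le> ip_dist K q x y" by (simp add: ip_dist_def ip_norm_nonneg K_diff)
  show "ip_dist K q x y = ip_dist K q y x" by (simp add: ip_dist_def ip_norm_minus)
  assume "x \<in> K" "y \<in> K"
  then show "(ip_dist K q x y = 0) = (x = y)" by (simp add: ip_dist_def ip_norm_eq_0 K_diff)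
  assume "z \<in> K"
  show "ip_dist K q x z \<le> ip_dist K q x y + ip_dist K q y z"
    using triangle[of "x - y" "y - z"] \<open>x \<in> K\<close> \<open>y \<in> K\<close> \<open>z \<in> K\<close> by (simp add: ip_dist_def K_diff)
qed

lemma ip_topology_eq: "ip_topology K q = mtopology" by (simp add: ip_topology_def)

lemma mcomplete_iff:
  "mcomplete \<longleftrightarrow> (\<forall>\<sigma>. range \<sigma> \<subseteq> K \<and> (\<forall>e>0. \<exists>N. \<forall>m\<ge>N. \<forall>n\<ge>N. ip_norm q (\<sigma> m - \<sigma> n) < e) \<longrightarrow>
     (\<exists>w\<in>K. (\<lambda>n. ip_norm q (\<sigma> n - w)) \<longlonglongrightarrow> 0))"
proof -
  have lim: "limitin mtopology \<sigma> w sequentially \<longleftrightarrow> w \<in> K \<and> (\<lambda>n. ip_norm q (\<sigma> n - w)) \<longlonglongrightarrow> 0"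
    if "range \<sigma> \<subseteq> K" for \<sigma> w
  proof -
    have "\<sigma> n \<in> K" for n using that by blast
    then have "ip_dist K q (\<sigma> n) w = ip_norm q (\<sigma> n - w)" "\<bar>ip_norm q (\<sigma> n - w)\<bar> = ip_norm q (\<sigma> n - w)"
      if "w \<in> K" for n using that by (simp_all add: ip_dist_def ip_norm_nonneg K_diff)
    with \<open>\<And>n. \<sigma> n \<in> K\<close> show ?thesis
      unfolding limit_metric_sequentially LIMSEQ_iff by (intro conj_cong refl) simp
  qed
  have cau: "MCauchy \<sigma> \<longleftrightarrow> range \<sigma> \<subseteq> K \<and> (\<forall>e>0. \<exists>N. \<forall>m\<ge>N. \<forall>n\<ge>N. ip_norm q (\<sigma> m - \<sigma> n) < e)" for \<sigma>
  proof -
    have "ip_dist K q (\<sigma> m) (\<sigma> n) = ip_norm q (\<sigma> m - \<sigma> n)" if "range \<sigma> \<subseteq> K" for m n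
      using that by (auto simp: ip_dist_def)
    then show ?thesis unfolding MCauchy_def
      by (intro conj_cong refl) (simp only:, intro all_cong1 imp_cong ex_cong1 refl, blast)
  qed
  show ?thesis unfolding mcomplete_def cau
    by (intro all_cong1 imp_cong refl) (simp add: lim Bex_def)
qed

end

lemma hilbert_space_on_iff:
  "hilbert_space_on K q \<longleftrightarrow> prehilbert_on K q \<and> Metric_space.mcomplete K (ip_dist K q)"
  by (auto simp: hilbert_space_on_def prehilbert_on_def)

text \<open>
  A minimising sequence of \<open>x \<mapsto> q x x - 2 * Re (\<phi> x)\<close> on \<open>D\<close> is Cauchy by the parallelogram law.
\<close>

lemma riesz_on:
  assumes H: "hilbert_space_on K q" and D: "csubspace D" "D \<subseteq> K"
    and add: "\<And>x y. x \<in> D \<Longrightarrow> y \<in> D \<Longrightarrow> \<phi> (x + y) = \<phi> x + \<phi> y"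
    and scale: "\<And>c x. x \<in> D \<Longrightarrow> \<phi> (c *\<^sub>C x) = c * \<phi> x"
    and bound: "\<And>x. x \<in> D \<Longrightarrow> norm (\<phi> x) \<le> B * ip_norm q x"
  obtains w where "w \<in> K" "\<And>x. x \<in> D \<Longrightarrow> \<phi> x = q x w"
proof -
  interpret prehilbert_on K q using H by (simp add: hilbert_space_on_iff)
  have DK: "x \<in> K" if "x \<in> D" for x using that D by blast
  note D_add = complex_vector.subspace_add[OF D(1)] and D_scale = complex_vector.subspace_scale[OF D(1)]
  define F where "F x = Re (q x x) - 2 * Re (\<phi> x)" for x
  define i where "i = Inf (F ` D)"
  \<comment> \<open>Completing the square bounds \<open>F x\<close> below by
    \<open>(ip_norm q x - B)^2 - B^2\<close>.\<close>
  have low: "- B\<^sup>2 \<le> F x" if "x \<in> D" for x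
  proof -
    have "Re (\<phi> x) \<le> B * ip_norm q x"
      using bound[OF that] complex_Re_le_cmod order_trans by blast
    moreover have "0 \<le> (ip_norm q x - B)\<^sup>2" by simp
    ultimately show ?thesis
      using norm_square[OF DK[OF that]] by (simp add: F_def power2_diff algebra_simps)
  qed
  have bdd: "bdd_below (F ` D)" using low by (auto simp: bdd_below_def)
  have iF: "i \<le> F x" if "x \<in> D" for x unfolding i_def using bdd that by (auto intro: cInf_lower)
  have ne: "F ` D \<noteq> {}" using complex_vector.subspace_0[OF D(1)] by blast
  have "\<exists>x\<in>D. F x < i + 1 / real (Suc n)" for n
    using cInf_lessD[OF ne, of "i + 1 / real (Suc n)"] by (auto simp: i_def)
  then obtain x where xD: "\<And>n. x n \<in> D" and xF: "\<And>n. F (x n) < i + 1 / real (Suc n)" by metis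
  have F_add: "F (y + of_real s *\<^sub>C v) = F y + 2 * s * (Re (q y v) - Re (\<phi> v)) + s\<^sup>2 * Re (q v v)"
    if "y \<in> D" "v \<in> D" for y v s
    using that Re_add_scale[of y v s] DK by (simp add: F_def add scale D_scale algebra_simps)
  have cau: "(ip_norm q (x m - x n))\<^sup>2 \<le> 2 / real (Suc n) + 2 / real (Suc m)" for m n
  proof -
    \<comment> \<open>The midpoint of \<open>x m\<close> and \<open>x n\<close>, written in the
      shape that \<open>F_add\<close> expands.\<close>
    let ?z = "x m + of_real (1/2) *\<^sub>C (x n + of_real (-1) *\<^sub>C x m)"
    have z: "?z \<in> D" using xD by (intro D_add D_scale)
    have d: "x n + of_real (-1) *\<^sub>C x m \<in> D" using xD by (intro D_add D_scale)
    have "F (x m + of_real 1 *\<^sub>C (x n + of_real (-1) *\<^sub>C x m)) = F (x n)"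
      by (simp add: scaleC_one)
    then have "4 * F ?z + Re (q (x n - x m) (x n - x m)) = 2 * F (x m) + 2 * F (x n)"
      using F_add[OF xD[of m] d, of 1] F_add[OF xD[of m] d, of "1/2"]
      by (simp add: power2_eq_square algebra_simps)
    then show ?thesis
      using iF[OF z] xF[of m] xF[of n] norm_square[of "x m - x n"] ip_norm_minus[of "x m" "x n"]
        norm_square[of "x n - x m"] DK[OF xD] by (simp add: K_diff)
  qed
  have "\<exists>N. \<forall>m\<ge>N. \<forall>n\<ge>N. ip_norm q (x m - x n) < e" if e: "e > 0" for e
  proof -
    obtain N where N: "inverse (real (Suc N)) < e\<^sup>2 / 4"
      using reals_Archimedean[of "e\<^sup>2 / 4"] e by auto
    have "ip_norm q (x m - x n) < e" if "m \<ge> N" "n \<ge> N" for m n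
    proof (rule power_less_imp_less_base[of _ 2])
      have "1 / real (Suc m) \<le> 1 / real (Suc N)" "1 / real (Suc n) \<le> 1 / real (Suc N)"
        using that by (auto simp: frac_le)
      then show "(ip_norm q (x m - x n))\<^sup>2 < e\<^sup>2"
        using cau[of m n] N by (simp add: inverse_eq_divide)
    qed (use e in simp)
    then show ?thesis by blast
  qed
  moreover have "range x \<subseteq> K" using xD DK by blast
  moreover have "mcomplete" using H by (simp add: hilbert_space_on_iff)
  ultimately obtain w where w: "w \<in> K" "(\<lambda>n. ip_norm q (x n - w)) \<longlonglongrightarrow> 0"
    unfolding mcomplete_iff by blast
  have Re_eq: "Re (\<phi> v) = Re (q v w)" if v: "v \<in> D" for v
  proof -
    have conv: "(\<lambda>n. Re (q (x n) v)) \<longlonglongrightarrow> Re (q w v)"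
    proof (rule LIM_zero_cancel, rule Lim_null_comparison)
      show "\<forall>\<^sub>F n in sequentially. norm (Re (q (x n) v) - Re (q w v)) \<le> ip_norm q (x n - w) * ip_norm q v"
      proof (rule always_eventually, rule allI)
        fix n
        have "q (x n) v = q (x n - w) v + q w v"
          using add_left[of "x n - w" w v] DK[OF xD] DK[OF v] w(1) by (simp add: K_diff)
        then show "norm (Re (q (x n) v) - Re (q w v)) \<le> ip_norm q (x n - w) * ip_norm q v"
          using Re_le[of "x n - w" v] DK[OF xD] DK[OF v] w(1) by (simp add: K_diff)
      qed
      show "(\<lambda>n. ip_norm q (x n - w) * ip_norm q v) \<longlonglongrightarrow> 0"
        using tendsto_mult_left_zero[OF w(2)] .
    qed
    \<comment> \<open>The limit \<open>w\<close> lies in \<open>K\<close> but perhaps not in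
      \<open>D\<close>, so minimality cannot be applied at \<open>w\<close>. The variation is made
      at \<open>x n\<close>, which is minimal up to \<open>1 / (n + 1)\<close>, and then passed to
      the limit.\<close>
    have quad: "0 \<le> 2 * s * (Re (q w v) - Re (\<phi> v)) + s\<^sup>2 * Re (q v v)" for s
    proof (rule LIMSEQ_le_const)
      show "(\<lambda>n. 1 / real (Suc n) + (2 * s * (Re (q (x n) v) - Re (\<phi> v)) + s\<^sup>2 * Re (q v v))) \<longlonglongrightarrow>
         2 * s * (Re (q w v) - Re (\<phi> v)) + s\<^sup>2 * Re (q v v)"
      proof -
        have "(\<lambda>n. 1 / real (Suc n)) \<longlonglongrightarrow> 0"
          using LIMSEQ_inverse_real_of_nat by (simp add: inverse_eq_divide)
        then have "(\<lambda>n. 1 / real (Suc n) + (2 * s * (Re (q (x n) v) - Re (\<phi> v)) + s\<^sup>2 * Re (q v v))) \<longlonglongrightarrow>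
            0 + (2 * s * (Re (q w v) - Re (\<phi> v)) + s\<^sup>2 * Re (q v v))"
          by (intro tendsto_add tendsto_mult tendsto_diff conv tendsto_const)
        then show ?thesis by simp
      qed
      have "0 \<le> 1 / real (Suc n) + (2 * s * (Re (q (x n) v) - Re (\<phi> v)) + s\<^sup>2 * Re (q v v))" for n
      proof -
        have "x n + of_real s *\<^sub>C v \<in> D" using xD v by (intro D_add D_scale)
        from iF[OF this] show ?thesis using F_add[OF xD[of n] v, of s] xF[of n] by simp
      qed
      then show "\<exists>N. \<forall>n\<ge>N. 0 \<le> 1 / real (Suc n) + (2 * s * (Re (q (x n) v) - Re (\<phi> v)) + s\<^sup>2 * Re (q v v))"
        by blast
    qed
    define d c where "d = Re (q w v) - Re (\<phi> v)" and "c = Re (q v v)"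
    have "d = 0"
    proof (rule ccontr)
      assume "d \<noteq> 0"
      have c: "c \<ge> 0" using norm_square[OF DK[OF v]] by (metis c_def zero_le_power2)
      \<comment> \<open>The choice \<open>s = - d / (c + 1)\<close> makes the linear term win; the
        summand 1 covers the case \<open>c = 0\<close>.\<close>
      have "0 \<le> 2 * (- d / (c + 1)) * d + (- d / (c + 1))\<^sup>2 * c" using quad unfolding d_def c_def by blast
      also have "\<dots> = d\<^sup>2 * (c - 2 * (c + 1)) / (c + 1)\<^sup>2"
        using c by (simp add: divide_simps power2_eq_square) (simp add: algebra_simps)
      also have "\<dots> < 0" using \<open>d \<noteq> 0\<close> c by (simp add: divide_less_0_iff mult_less_0_iff)
      finally show False by simp
    qed
    then show ?thesis using commute[OF DK[OF v] w(1)] by (simp add: d_def)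
  qed
  have "\<phi> v = q v w" if v: "v \<in> D" for v
  proof -
    \<comment> \<open>Testing with \<open>i v\<close> recovers the imaginary parts from the identity
      for real parts.\<close>
    have "Re (\<phi> (\<i> *\<^sub>C v)) = Re (q (\<i> *\<^sub>C v) w)" using v D_scale by (intro Re_eq)
    then have "Im (\<phi> v) = Im (q v w)" using v DK[OF v] w(1) by (simp add: scale scale_left)
    with Re_eq[OF v] show ?thesis by (simp add: complex_eq_iff)
  qed
  with w(1) show thesis by (rule that)
qed

lemma prehilbert_cinner: "csubspace M \<Longrightarrow> prehilbert_on M (cinner :: 'h::chilbert_space \<Rightarrow> 'h \<Rightarrow> complex)"
  by unfold_locales
    (auto simp: sesquilinear_on_def symmetric_on_def cinner_add_left cinner_add_right cinner_scaleC_left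
      cinner_scaleC_right cinner_self intro: cinner_commute)

lemma ip_norm_cinner [simp]: "ip_norm cinner x = norm x"
  by (simp add: ip_norm_def cinner_self)

lemma hilbert_cinner:
  fixes M :: "'h::chilbert_space set"
  assumes "csubspace M" "closed M" shows "hilbert_space_on M cinner"
proof -
  interpret prehilbert_on M cinner by (rule prehilbert_cinner[OF assms(1)])
  have "\<exists>w\<in>M. (\<lambda>n. norm (s n - w)) \<longlonglongrightarrow> 0"
    if "range s \<subseteq> M" "\<forall>e>0. \<exists>N. \<forall>m\<ge>N. \<forall>n\<ge>N. norm (s m - s n) < e" for s :: "nat \<Rightarrow> 'h"
  proof -
    have "Cauchy s" using that(2) by (simp add: Cauchy_def dist_norm)
    then obtain w where w: "s \<longlonglongrightarrow> w" by (auto simp: Cauchy_convergent_iff convergent_def)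
    with that(1) assms(2) have "w \<in> M" by (metis closed_sequentially range_subsetD)
    with w show ?thesis by (auto simp: LIM_zero_iff tendsto_norm_zero_iff)
  qed
  then show ?thesis by (auto simp: hilbert_space_on_iff prehilbert_on_axioms mcomplete_iff)
qed

lemma hilbert_UNIV: "hilbert_space_on UNIV (cinner :: 'h::chilbert_space \<Rightarrow> 'h \<Rightarrow> complex)"
  by (rule hilbert_cinner) auto

section \<open>Adjoints, orthogonality and range inclusion\<close>

lemma bounded_adjoint_ex:
  fixes X :: "'h::chilbert_space \<Rightarrow> 'h"
  assumes "bounded_clinear X"
  obtains Y where "bounded_clinear Y" "\<And>x y. cinner (X x) y = cinner x (Y y)"
proof -
  obtain B where B: "B > 0" "\<And>x. norm (X x) \<le> B * norm x" using bounded_clinear_bound[OF assms] by blast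
  have "\<exists>w. \<forall>x. cinner (X x) y = cinner x w" for y
  proof (rule riesz_on[OF hilbert_UNIV, of UNIV "\<lambda>x. cinner (X x) y" "B * norm y"])
    fix x
    show "norm (cinner (X x) y) \<le> B * norm y * ip_norm cinner x"
      using norm_cinner_le[of "X x" y] mult_right_mono[OF B(2)[of x], of "norm y"] by (simp add: mult_ac)
  qed (auto simp: bounded_clinearD[OF assms] cinner_add_left cinner_scaleC_left)
  then obtain Y where Y: "\<And>x y. cinner (X x) y = cinner x (Y y)" by metis
  have "cinner (Y x) z = cinner x (X z)" for x z by (metis Y cinner_commute)
  then have "bounded_clinear Y" by (intro bounded_clinear_if_dense_adjoint[of UNIV]) auto
  with Y show thesis by (rule that[rotated])
qed

lemma closure_csubspace:
  fixes D :: "'h::chilbert_space set"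
  assumes "csubspace D" shows "csubspace (closure D)"
proof (rule complex_vector.subspaceI)
  show "0 \<in> closure D" using complex_vector.subspace_0[OF assms] closure_subset by blast
  fix x y assume "x \<in> closure D" "y \<in> closure D"
  then obtain s t where "\<And>n. s n \<in> D" "s \<longlonglongrightarrow> x" "\<And>n. t n \<in> D" "t \<longlonglongrightarrow> y"
    unfolding closure_sequential by blast
  then have "(\<lambda>n. s n + t n) \<longlonglongrightarrow> x + y" "\<And>n. s n + t n \<in> D"
    using complex_vector.subspace_add[OF assms] by (auto intro: tendsto_add)
  then show "x + y \<in> closure D" unfolding closure_sequential by (intro exI[of _ "\<lambda>n. s n + t n"]) blast
next
  fix c x assume "x \<in> closure D"
  then obtain s where "\<And>n. s n \<in> D" "s \<longlonglongrightarrow> x" unfolding closure_sequential by blast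
  then have "(\<lambda>n. c *\<^sub>C s n) \<longlonglongrightarrow> c *\<^sub>C x" "\<And>n. c *\<^sub>C s n \<in> D"
    using complex_vector.subspace_scale[OF assms] by (auto intro: tendsto_scaleC)
  then show "c *\<^sub>C x \<in> closure D" unfolding closure_sequential by (intro exI[of _ "\<lambda>n. c *\<^sub>C s n"]) blast
qed

text \<open>The Riesz vector of \<open>cinner _ x\<close> on the closure of \<open>D\<close> is the
  orthogonal projection \<open>w\<close> of \<open>x\<close>. The remainder \<open>x - w\<close> is
  orthogonal to \<open>D\<close>, so it vanishes and \<open>x\<close> lies in the closure.\<close>

lemma dense_if_orthogonal_zero:
  fixes D :: "'h::chilbert_space set"
  assumes D: "csubspace D" and orth: "\<And>x. (\<And>d. d \<in> D \<Longrightarrow> cinner d x = 0) \<Longrightarrow> x = 0"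
  shows "closure D = UNIV"
proof -
  have "x \<in> closure D" for x
  proof (rule riesz_on[OF hilbert_cinner[OF closure_csubspace[OF D] closed_closure] closure_csubspace[OF D],
        of "\<lambda>v. cinner v x" "norm x"])
    fix w assume w: "w \<in> closure D" "\<And>v. v \<in> closure D \<Longrightarrow> cinner v x = cinner v w"
    have "cinner d (x - w) = 0" if "d \<in> D" for d
      using w(2)[of d] that closure_subset[of D] by (auto simp: cinner_diff_right)
    then have "x - w = 0" by (rule orth)
    with w(1) show ?thesis by simp
  qed (use norm_cinner_le in \<open>auto simp: cinner_add_left cinner_scaleC_left mult.commute\<close>)
  then show ?thesis by auto
qed

lemma csubspace_range: "bounded_clinear X \<Longrightarrow> csubspace (range X)"
  by (rule complex_vector.subspaceI)
    (metis bounded_clinearD(4) rangeI, auto simp: bounded_clinearD[symmetric])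

lemma hermitian_dense_range:
  assumes "hermitian S" "inj S" shows "closure (range S) = UNIV"
proof (rule dense_if_orthogonal_zero)
  note S = hermitian_bounded_clinear[OF assms(1)]
  show "csubspace (range S)" by (rule csubspace_range[OF S])
  fix x assume *: "\<And>d. d \<in> range S \<Longrightarrow> cinner d x = 0"
  have "S x = S 0"
    by (rule cinner_right_cancel) (use * hermitianD[OF assms(1), symmetric] in \<open>simp add: bounded_clinearD(4)[OF S]\<close>)
  then show "x = 0" using assms(2) by (simp add: inj_eq)
qed

text \<open>One direction of Douglas' lemma. The norm inequality makes \<open>S h\<close> to
  \<open>cinner (R h) y\<close> a well-defined bounded functional on the range of \<open>S\<close>,
  and its Riesz vector \<open>w\<close> satisfies \<open>R y = S w\<close>.\<close>

lemma range_subset_if_norm_le: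
  fixes R S :: "'h::chilbert_space \<Rightarrow> 'h"
  assumes R: "hermitian R" and S: "hermitian S" and le: "\<And>h. norm (R h) \<le> c * norm (S h)"
  shows "range R \<subseteq> range S"
proof clarify
  fix y
  note bR = hermitian_bounded_clinear[OF R] and bS = hermitian_bounded_clinear[OF S]
  define \<phi> where "\<phi> v = cinner (R (SOME h. S h = v)) y" for v
  have R_eq: "R g = R h" if "S g = S h" for g h
    using le[of "g - h"] that by (simp add: bounded_clinearD[OF bR] bounded_clinearD[OF bS])
  have \<phi>: "\<phi> (S h) = cinner (R h) y" for h
    unfolding \<phi>_def using R_eq[of "SOME g. S g = S h" h] someI[of "\<lambda>g. S g = S h" h] by simp
  obtain w where w: "\<And>x. x \<in> range S \<Longrightarrow> \<phi> x = cinner x w"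
  proof (rule riesz_on[OF hilbert_UNIV csubspace_range[OF bS], of \<phi> "\<bar>c\<bar> * norm y"])
    fix u v assume "u \<in> range S" "v \<in> range S"
    then show "\<phi> (u + v) = \<phi> u + \<phi> v"
      by (auto simp: \<phi> bounded_clinearD(1)[OF bS, symmetric]) (simp add: bounded_clinearD(1)[OF bR] cinner_add_left)
  next
    fix c u assume "u \<in> range S"
    then show "\<phi> (c *\<^sub>C u) = c * \<phi> u"
      by (auto simp: \<phi> bounded_clinearD(3)[OF bS, symmetric]) (simp add: bounded_clinearD(3)[OF bR] cinner_scaleC_left)
  next
    fix x assume "x \<in> range S"
    then obtain h where h: "x = S h" by auto
    have "norm (R h) \<le> \<bar>c\<bar> * norm (S h)"
      using le[of h] mult_right_mono[OF abs_ge_self[of c], of "norm (S h)"] by simp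
    then have "norm (R h) * norm y \<le> \<bar>c\<bar> * norm (S h) * norm y" by (rule mult_right_mono) simp
    then show "norm (\<phi> x) \<le> \<bar>c\<bar> * norm y * ip_norm cinner x"
      using norm_cinner_le[of "R h" y] by (simp add: h \<phi> mult_ac)
  qed auto
  have "R y = S w"
    by (rule cinner_right_cancel) (metis w \<phi> rangeI R S hermitianD)
  then show "R y \<in> range S" by simp
qed

section \<open>The Hausdorff moment problem\<close>

text \<open>Here \<open>c k l\<close> stands for the integral of \<open>t^k (1 - t)^l\<close>. The
  identity is the binomial expansion of \<open>(t + (1 - t))^r = 1\<close> under the integral,
  obtained by iterating the recursion.\<close>

lemma moment_expand:
  fixes c :: "nat \<Rightarrow> nat \<Rightarrow> real"
  assumes "\<And>k l. c k l = c (Suc k) l + c k (Suc l)"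
  shows "c k l = (\<Sum>i\<le>r. real (r choose i) * c (k + i) (l + (r - i)))"
proof (induction r arbitrary: k l)
  case (Suc r)
  have "(\<Sum>i\<le>Suc r. real (Suc r choose i) * c (k + i) (l + (Suc r - i))) =
      c k (l + Suc r) + (\<Sum>i\<le>r. real (Suc r choose Suc i) * c (k + Suc i) (l + (r - i)))"
    by (simp add: sum.atMost_Suc_shift del: sum.atMost_Suc binomial_Suc_Suc)
  also have "(\<Sum>i\<le>r. real (Suc r choose Suc i) * c (k + Suc i) (l + (r - i))) =
      (\<Sum>i\<le>r. real (r choose i) * c (Suc k + i) (l + (r - i))) +
      (\<Sum>i\<le>r. real (r choose Suc i) * c (k + Suc i) (l + (r - i)))"
    by (simp add: sum.distrib[symmetric] algebra_simps)
  also have "(\<Sum>i\<le>r. real (r choose i) * c (Suc k + i) (l + (r - i))) = c (Suc k) l"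
    by (rule Suc.IH[symmetric])
  also have "c k (l + Suc r) + (c (Suc k) l + (\<Sum>i\<le>r. real (r choose Suc i) * c (k + Suc i) (l + (r - i)))) =
     c (Suc k) l + (\<Sum>i\<le>Suc r. real (r choose i) * c (k + i) (l + (Suc r - i)))"
    by (simp add: sum.atMost_Suc_shift del: sum.atMost_Suc)
  also have "(\<Sum>i\<le>Suc r. real (r choose i) * c (k + i) (l + (Suc r - i))) =
     (\<Sum>i\<le>r. real (r choose i) * c (k + i) (Suc l + (r - i)))"
    by (simp add: Suc_diff_le)
  also have "\<dots> = c k (Suc l)" by (rule Suc.IH[symmetric])
  finally show ?case using assms[of k l] by simp
qed simp

text \<open>The expansion of \<open>t^j\<close> in the Bernstein basis of degree \<open>n\<close>,
  integrated term by term. The weights \<open>(n choose k) * c k (n - k)\<close> are the integrals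
  of the Bernstein polynomials.\<close>

lemma moment_weights:
  fixes c :: "nat \<Rightarrow> nat \<Rightarrow> real"
  assumes c: "\<And>k l. c k l = c (Suc k) l + c k (Suc l)" and "j \<le> n"
  shows "c j 0 = (\<Sum>k\<le>n. real (k choose j) / real (n choose j) * (real (n choose k) * c k (n - k)))"
proof -
  have nj: "real (n choose j) > 0" using \<open>j \<le> n\<close> by simp
  have "(\<Sum>k\<le>n. real (k choose j) / real (n choose j) * (real (n choose k) * c k (n - k))) =
     (\<Sum>k\<in>{j..n}. real (k choose j) / real (n choose j) * (real (n choose k) * c k (n - k)))"
    by (rule sum.mono_neutral_right) (auto simp: not_le)
  also have "\<dots> = (\<Sum>k\<in>{j..n}. real (n - j choose (k - j)) * c k (n - k))"
  proof (rule sum.cong[OF refl])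
    fix k assume "k \<in> {j..n}"
    then have "real (n choose k) * real (k choose j) = real (n choose j) * real (n - j choose (k - j))"
      by (metis atLeastAtMost_iff choose_mult of_nat_mult)
    then show "real (k choose j) / real (n choose j) * (real (n choose k) * c k (n - k)) =
        real (n - j choose (k - j)) * c k (n - k)"
      using nj by (simp add: field_simps)
  qed
  also have "\<dots> = (\<Sum>i\<le>n - j. real (n - j choose i) * c (j + i) (n - j - i))"
    by (rule sum.reindex_bij_witness[of _ "\<lambda>i. j + i" "\<lambda>k. k - j"]) (use \<open>j \<le> n\<close> in auto)
  also have "\<dots> = c j 0" using moment_expand[where c = c and k = j and l = 0 and r = "n - j", OF c] by simp
  finally show ?thesis ..
qed

text \<open>Both terms are products of \<open>j\<close> factors, \<open>k / n\<close> against
  \<open>(k - i) / (n - i)\<close>. With \<open>2 * j <= n\<close> all factors lie in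
  \<open>[-1, 1]\<close>, even those with \<open>k < i\<close>, so the products differ by at most
  the sum of the differences of the factors.\<close>

lemma binomial_ratio_approx:
  assumes "k \<le> n" "2 * j \<le> n" "0 < n"
  shows "\<bar>(real k / real n) ^ j - real (k choose j) / real (n choose j)\<bar> \<le> real j * (real j / real (n - j))"
proof -
  have kj: "real (a choose j) = (\<Prod>i<j. real a - real i) / fact j" for a
    by (simp add: binomial_gbinomial gbinomial_prod_rev atLeast0LessThan)
  have "real (k choose j) / real (n choose j) = (\<Prod>i<j. (real k - real i) / (real n - real i))"
    unfolding kj by (simp add: prod_dividef)
  moreover have "(real k / real n) ^ j = (\<Prod>i<j. real k / real n)" by simp
  moreover have "norm ((\<Prod>i<j. real k / real n) - (\<Prod>i<j. (real k - real i) / (real n - real i))) \<le>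
      (\<Sum>i<j. norm (real k / real n - (real k - real i) / (real n - real i)))"
    by (rule norm_prod_diff) (use assms in \<open>auto simp: abs_le_iff field_simps\<close>)
  moreover have "(\<Sum>i<j. norm (real k / real n - (real k - real i) / (real n - real i))) \<le> 
      (\<Sum>i<j. real j / real (n - j))"
  proof (rule sum_mono)
    fix i assume i: "i \<in> {..<j}"
    have "real k / real n - (real k - real i) / (real n - real i) =
        (real i / (real n - real i)) * ((real n - real k) / real n)"
      using i assms by (simp add: field_simps)
    moreover have "\<bar>(real i / (real n - real i)) * ((real n - real k) / real n)\<bar> \<le> (real j / real (n - j)) * 1"
      unfolding abs_mult
    proof (rule mult_mono)
      show "\<bar>real i / (real n - real i)\<bar> \<le> real j / real (n - j)"
        using i assms by (auto simp: of_nat_diff intro!: frac_le)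
    qed (use i assms in \<open>auto simp: field_simps\<close>)
    ultimately show "norm (real k / real n - (real k - real i) / (real n - real i)) \<le> real j / real (n - j)"
      by simp
  qed
  ultimately show ?thesis by simp
qed

text \<open>By \<open>moment_weights\<close> the number \<open>c j 0\<close> is the same weighted
  sum with the power replaced by a quotient of binomials. The error is at most the total mass
  \<open>c 0 0\<close> times \<open>j^2 / (n - j)\<close>.\<close>

lemma moment_limit:
  fixes c :: "nat \<Rightarrow> nat \<Rightarrow> real"
  assumes c: "\<And>k l. c k l = c (Suc k) l + c k (Suc l)" and pos: "\<And>k l. 0 \<le> c k l"
  shows "(\<lambda>n. \<Sum>k\<le>n. (real (n choose k) * c k (n - k)) * (real k / real n) ^ j) \<longlonglongrightarrow> c j 0"
proof (rule LIM_zero_cancel, rule Lim_null_comparison)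
  show "\<forall>\<^sub>F n in sequentially. norm ((\<Sum>k\<le>n. (real (n choose k) * c k (n - k)) * (real k / real n) ^ j) - c j 0)
     \<le> c 0 0 * (real j * (real j / real (n - j)))"
    using eventually_ge_at_top[of "2 * j + 1"]
  proof eventually_elim
    fix n assume n: "2 * j + 1 \<le> n"
    let ?w = "\<lambda>k. real (n choose k) * c k (n - k)"
    have "c j 0 = (\<Sum>k\<le>n. real (k choose j) / real (n choose j) * ?w k)"
      by (rule moment_weights[where c = c and j = j and n = n, OF c]) (use n in linarith)
    then have eq: "(\<Sum>k\<le>n. ?w k * (real k / real n) ^ j) - c j 0 =
        (\<Sum>k\<le>n. ?w k * ((real k / real n) ^ j - real (k choose j) / real (n choose j)))"
      by (simp only: sum_subtractf right_diff_distrib mult.commute)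
    have "norm (\<Sum>k\<le>n. ?w k * ((real k / real n) ^ j - real (k choose j) / real (n choose j))) \<le>
        (\<Sum>k\<le>n. ?w k * (real j * (real j / real (n - j))))"
    proof (rule sum_norm_le)
      fix k assume "k \<in> {..n}"
      then have "\<bar>(real k / real n) ^ j - real (k choose j) / real (n choose j)\<bar> \<le> real j * (real j / real (n - j))"
        using n by (intro binomial_ratio_approx) simp_all
      moreover have "0 \<le> ?w k" using pos by simp
      ultimately show "norm (?w k * ((real k / real n) ^ j - real (k choose j) / real (n choose j))) \<le>
          ?w k * (real j * (real j / real (n - j)))"
        by (simp only: real_norm_def abs_mult[of "?w k"] abs_of_nonneg) (rule mult_left_mono)
    qed
    moreover have "c 0 0 = (\<Sum>k\<le>n. ?w k)"
      using moment_weights[where c = c and j = 0 and n = n, OF c] by simp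
    ultimately show "norm ((\<Sum>k\<le>n. ?w k * (real k / real n) ^ j) - c j 0) \<le>
      c 0 0 * (real j * (real j / real (n - j)))"
      unfolding eq by (simp only: sum_distrib_right)
  qed
  have "(\<lambda>n. c 0 0 * (real j * (real j / real n))) \<longlonglongrightarrow> c 0 0 * (real j * 0)"
    by (rule tendsto_mult[OF tendsto_const tendsto_mult[OF tendsto_const lim_const_over_n]])
  then have "(\<lambda>n. c 0 0 * (real j * (real j / real (n + j - j)))) \<longlonglongrightarrow> 0" by simp
  then show "(\<lambda>n. c 0 0 * (real j * (real j / real (n - j)))) \<longlonglongrightarrow> 0"
    by (rule LIMSEQ_offset[where k = j and f = "\<lambda>n. c 0 0 * (real j * (real j / real (n - j)))"])
qed

text \<open>The measures with mass \<open>w n k\<close> at \<open>k / n\<close> all live in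
  \<open>[0, 1]\<close>, hence are tight, and a weakly convergent subsequence has the right moments
  in the limit. The clamp \<open>max 0 (min 1 t)\<close> makes every power a bounded continuous test
  function on the whole line and changes nothing at the atoms.\<close>

lemma hausdorff_moments:
  fixes c :: "nat \<Rightarrow> nat \<Rightarrow> real"
  assumes c: "\<And>k l. c k l = c (Suc k) l + c k (Suc l)" and pos: "\<And>k l. 0 \<le> c k l" and one: "c 0 0 = 1"
  obtains M where "real_distribution M" "\<And>j. (\<integral>t. (max 0 (min 1 t)) ^ j \<partial>M) = c j 0"
proof -
  define w where "w n k = real (n choose k) * c k (n - k)" for n k
  have w: "0 \<le> w n k" for n k using pos by (simp add: w_def)
  have w1: "(\<Sum>k\<le>n. w n k) = 1" for n
    using moment_weights[where c = c and j = 0 and n = n, OF c] one by (simp add: w_def)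
  define \<mu> where "\<mu> n = distr (point_measure {..n} (\<lambda>k. ennreal (w n k))) borel (\<lambda>k. real k / real n)" for n
  have int: "(\<integral>t. f t \<partial>\<mu> n) = (\<Sum>k\<le>n. w n k * f (real k / real n))"
    if [measurable]: "f \<in> borel_measurable borel" for f :: "real \<Rightarrow> real" and n
    unfolding \<mu>_def using w
    by (subst integral_distr) (auto simp: lebesgue_integral_point_measure_finite measurable_point_measure_eq1)
  have prob: "real_distribution (\<mu> n)" for n
  proof -
    have "prob_space (point_measure {..n} (\<lambda>k. ennreal (w n k)))"
      using w w1[of n] by (intro prob_spaceI) (simp add: emeasure_point_measure_finite sum_ennreal space_point_measure)
    then have "prob_space (\<mu> n)" unfolding \<mu>_def
      by (rule prob_space.prob_space_distr) (simp add: measurable_point_measure_eq1)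
    then show ?thesis by (simp add: real_distribution_def real_distribution_axioms_def \<mu>_def)
  qed
  have meas: "measure (\<mu> n) {-1<..2} = 1" for n
  proof -
    interpret real_distribution "\<mu> n" by (rule prob)
    have "measure (\<mu> n) {-1<..2} = (\<integral>t. indicator {-1<..2} t \<partial>\<mu> n)" by simp
    also have "\<dots> = (\<Sum>k\<le>n. w n k * indicator {-1<..2} (real k / real n))" by (rule int) simp
    also have "\<dots> = (\<Sum>k\<le>n. w n k)"
    proof (rule sum.cong[OF refl])
      fix k assume "k \<in> {..n}"
      then have "0 \<le> real k / real n" "real k / real n \<le> 1" by (auto simp: divide_le_eq_1)
      then have "real k / real n \<in> {-1<..2}" unfolding greaterThanAtMost_iff by linarith
      then show "w n k * indicator {-1<..2} (real k / real n) = w n k" by simp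
    qed
    finally show ?thesis by (simp add: w1)
  qed
  have "tight \<mu>"
    unfolding tight_def
  proof (intro conjI allI impI prob)
    fix \<epsilon> :: real assume "\<epsilon> > 0"
    then show "\<exists>a b. a < b \<and> (\<forall>n. measure (\<mu> n) {a<..b} > 1 - \<epsilon>)"
      using meas by (intro exI[of _ "-1"] exI[of _ 2]) simp
  qed
  then obtain r M where r: "strict_mono (r :: nat \<Rightarrow> nat)" and M: "real_distribution M"
    and conv: "weak_conv_m (\<mu> \<circ> id \<circ> r) M"
    using tight_imp_convergent_subsubsequence[of \<mu> id] strict_mono_id by blast
  have "(\<integral>t. (max 0 (min 1 t)) ^ j \<partial>M) = c j 0" for j
  proof -
    have 1: "(\<lambda>n. \<integral>t. (max 0 (min 1 t)) ^ j \<partial>((\<mu> \<circ> id \<circ> r) n)) \<longlonglongrightarrow> (\<integral>t. (max 0 (min 1 t)) ^ j \<partial>M)"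
    proof (rule weak_conv_imp_integral_bdd_continuous_conv[OF _ M conv, where B = 1])
      show "real_distribution ((\<mu> \<circ> id \<circ> r) n)" for n using prob by simp
      show "isCont (\<lambda>t::real. (max 0 (min 1 t)) ^ j) x" for x by (intro continuous_intros)
      show "norm ((max 0 (min 1 x)) ^ j) \<le> 1" for x :: real
        by (simp add: power_abs[symmetric] power_le_one)
    qed
    have 2: "(\<integral>t. (max 0 (min 1 t)) ^ j \<partial>((\<mu> \<circ> id \<circ> r) n)) =
        (\<Sum>k\<le>r n. w (r n) k * (real k / real (r n)) ^ j)" for n
    proof -
      have "(\<integral>t. (max 0 (min 1 t)) ^ j \<partial>\<mu> (r n)) =
          (\<Sum>k\<le>r n. w (r n) k * (max 0 (min 1 (real k / real (r n)))) ^ j)"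
        by (rule int) simp
      also have "\<dots> = (\<Sum>k\<le>r n. w (r n) k * (real k / real (r n)) ^ j)"
      proof (rule sum.cong[OF refl])
        fix k assume "k \<in> {..r n}"
        then have "0 \<le> real k / real (r n)" "real k / real (r n) \<le> 1" by (auto simp: divide_le_eq_1)
        then show "w (r n) k * (max 0 (min 1 (real k / real (r n)))) ^ j = w (r n) k * (real k / real (r n)) ^ j"
          by simp
      qed
      finally show ?thesis by simp
    qed
    have 3: "(\<lambda>n. \<Sum>k\<le>r n. w (r n) k * (real k / real (r n)) ^ j) \<longlonglongrightarrow> c j 0"
      using LIMSEQ_subseq_LIMSEQ[OF moment_limit[where c = c and j = j, OF c pos] r] by (simp add: w_def o_def)
    show ?thesis by (rule LIMSEQ_unique[OF 1[unfolded 2] 3])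
  qed
  from that[OF M this] show thesis .
qed

section \<open>Functional calculus of a hermitian operator\<close>

lemma funpow_commute: "(\<And>x. f (g x) = g (f x)) \<Longrightarrow> (f ^^ n) (g x) = g ((f ^^ n) x)"
  by (induction n) auto

lemma hermitian_funpow: "hermitian X \<Longrightarrow> cinner ((X ^^ n) x) y = cinner x ((X ^^ n) y)"
  by (induction n arbitrary: x y) (auto simp: hermitianD funpow_swap1)

lemma bounded_clinear_funpow: "bounded_clinear X \<Longrightarrow> bounded_clinear (X ^^ n)"
proof (induction n)
  case 0
  then show ?case by (simp add: bounded_clinear_def id_def bounded_linear_ident)
next
  case (Suc n)
  then show ?case using bounded_clinear_compose[of X "X ^^ n"] by (simp add: o_def)
qed

locale hermitian_bound =
  fixes G :: "'h::chilbert_space \<Rightarrow> 'h" and m :: real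
  assumes herm: "hermitian G" and m: "m > 0" and bound: "norm (G x) \<le> m * norm x"
begin

abbreviation I where "I \<equiv> {-m..m}"

lemmas G_lin = bounded_clinearD[OF hermitian_bounded_clinear[OF herm]]
lemmas Gn_lin = bounded_clinearD[OF bounded_clinear_funpow[OF hermitian_bounded_clinear[OF herm]]]

text \<open>
  The affine map \<open>t = (g / m + 1) / 2\<close> sends \<open>I\<close> to \<open>[0, 1]\<close>; the mixed moments below
  are non-negative because \<open>M N = N M N + M N M\<close> for \<open>N = 1 - M\<close>.
\<close>

lemma unit_spectral_measure:
  assumes x: "norm x = 1"
  obtains \<nu> where "prob_space \<nu>" "sets \<nu> = sets (restrict_space borel I)"
    "\<And>i. (\<integral>t. t ^ i \<partial>\<nu>) = inner ((G ^^ i) x) x"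
proof -
  define M where "M y = (1/2) *\<^sub>R ((1/m) *\<^sub>R G y + y)" for y
  define N where "N y = y - M y" for y
  have inner_G: "inner (G y) z = inner y (G z)" for y z
    using hermitianD[OF herm] by (simp add: inner_eq_Re_cinner)
  have inner_M: "inner (M y) z = inner y (M z)" for y z
    by (simp add: M_def inner_G inner_add_left inner_add_right)
  have M_lin: "M (y + z) = M y + M z" "M (y - z) = M y - M z" for y z
    by (simp_all add: M_def G_lin algebra_simps)
  have inner_N: "inner (N y) z = inner y (N z)" for y z
    by (simp add: N_def inner_M inner_diff_left inner_diff_right)
  have MN: "M (N y) = N (M y)" for y by (simp add: N_def M_lin)
  have NM: "y = M y + N y" for y by (simp add: N_def)
  have absG: "\<bar>inner (G y) y\<bar> \<le> m * (norm y)\<^sup>2" for y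
    using Cauchy_Schwarz_ineq2[of "G y" y] mult_right_mono[OF bound[of y], of "norm y"]
    by (simp add: power2_eq_square)
  have inner_My: "inner (M y) y = (inner (G y) y / m + (norm y)\<^sup>2) / 2" for y
    by (simp add: M_def inner_add_left power2_norm_eq_inner)
  have posM: "0 \<le> inner (M y) y" for y
    using absG[of y] m by (simp add: inner_My field_simps)
  have posN: "0 \<le> inner (N y) y" for y
    using absG[of y] m by (simp add: N_def inner_diff_left inner_My power2_norm_eq_inner[symmetric] field_simps)
  define c where "c y k l = inner ((M ^^ k) ((N ^^ l) y)) y" for y k l
  have Mk: "(M ^^ k) (y + z) = (M ^^ k) y + (M ^^ k) z" for k y z
    by (induction k) (auto simp: M_lin)
  have c_rec: "c y k l = c y (Suc k) l + c y k (Suc l)" for y k l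
    unfolding c_def using NM[of "(N ^^ l) y"] 
    by (metis Mk funpow.simps(2) funpow_swap1 inner_add_left o_apply)
  have c_M: "c y (Suc (Suc k)) l = c (M y) k l" for y k l
  proof -
    have "(M ^^ Suc (Suc k)) ((N ^^ l) y) = M ((M ^^ k) ((N ^^ l) (M y)))"
      using funpow_commute[of N M l y] MN by (simp add: funpow_swap1)
    then show ?thesis unfolding c_def by (simp only: inner_M)
  qed
  have c_N: "c y k (Suc (Suc l)) = c (N y) k l" for y k l
  proof -
    have "(N ^^ Suc (Suc l)) y = N ((N ^^ l) (N y))" by (simp add: funpow_swap1)
    then have "(M ^^ k) ((N ^^ Suc (Suc l)) y) = N ((M ^^ k) ((N ^^ l) (N y)))"
      by (simp only: funpow_commute[of M N k, OF MN])
    then show ?thesis unfolding c_def by (simp only: inner_N)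
  qed
  have pos11: "0 \<le> inner (M (N y)) y" for y
  proof -
    have "inner (M (N y)) y = inner (M (N y)) (M y) + inner (M (N y)) (N y)"
      using NM[of y] by (metis inner_add_right)
    also have "inner (M (N y)) (M y) = inner (N (M y)) (M y)" by (simp add: MN)
    finally show ?thesis using posM posN by simp
  qed
  \<comment> \<open>Two factors of the same kind can be shared between the two sides of the inner
    product, which replaces \<open>y\<close> by \<open>M y\<close> or \<open>N y\<close>. Only
    exponents 0 and 1 remain as base cases.\<close>
  have c_pos: "0 \<le> c y k l" for y k l
  proof (induction "k + l" arbitrary: k l y rule: less_induct)
    case less
    consider k' where "k = Suc (Suc k')" | l' where "l = Suc (Suc l')" | "k \<le> 1" "l \<le> 1"
      by (metis One_nat_def Suc_le_eq less_one not0_implies_Suc not_le not_less_eq)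
    then show ?case
    proof cases
      case 1
      then show ?thesis using less[of k' l "M y"] c_M by simp
    next
      case 2
      then show ?thesis using less[of k l' "N y"] c_N by simp
    next
      case 3
      then consider "k = 0" "l = 0" | "k = 1" "l = 0" | "k = 0" "l = 1" | "k = 1" "l = 1" by linarith
      then show ?thesis by cases (auto simp: c_def posM posN pos11)
    qed
  qed
  have "c x 0 0 = 1" using x by (simp add: c_def power2_norm_eq_inner[symmetric])
  then obtain L where L: "real_distribution L" "\<And>j. (\<integral>t. (max 0 (min 1 t)) ^ j \<partial>L) = c x j 0"
    using hausdorff_moments[of "c x"] c_rec c_pos by metis
  interpret L: real_distribution L by fact
  \<comment> \<open>Clamping pins \<open>s\<close> to \<open>I\<close> everywhere, so its
    distribution is a measure on \<open>I\<close>; the moments from \<open>hausdorff_moments\<close>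
    already refer to the clamped variable.\<close>
  define u where "u t = max 0 (min 1 t)" for t :: real
  define s where "s t = m * (2 * u t - 1)" for t
  have [measurable]: "u \<in> borel_measurable borel" "s \<in> borel_measurable borel"
    unfolding u_def s_def by simp_all
  have u: "0 \<le> u t" "u t \<le> 1" for t by (auto simp: u_def)
  have sI: "s t \<in> I" for t using u[of t] m by (simp add: s_def mult_le_cancel_left1 algebra_simps)
  have absu: "\<bar>u t\<bar> \<le> 1" for t using u[of t] by simp
  have abss: "\<bar>s t\<bar> \<le> m" for t using sI[of t] by (simp add: abs_le_iff)
  have integ: "integrable L (\<lambda>t. s t ^ i * u t ^ k)" for i k
  proof (rule L.integrable_const_bound[where B = "m ^ i * 1"])
    show "AE t in L. norm (s t ^ i * u t ^ k) \<le> m ^ i * 1"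
    proof (rule AE_I2)
      fix t
      have "\<bar>s t\<bar> ^ i * \<bar>u t\<bar> ^ k \<le> m ^ i * 1"
        using m by (intro mult_mono power_mono power_le_one) (auto simp: abss absu)
      then show "norm (s t ^ i * u t ^ k) \<le> m ^ i * 1" by (simp add: abs_mult power_abs)
    qed
  qed simp
  \<comment> \<open>The factor \<open>u ^ k\<close> is carried along to close the induction on
    \<open>i\<close>: the relation \<open>s = 2 m u - m\<close> trades a power of \<open>s\<close>
    for one of \<open>u\<close>, just as \<open>G = 2 m M - m\<close>.\<close>
  have mixed: "(\<integral>t. s t ^ i * u t ^ k \<partial>L) = inner ((G ^^ i) ((M ^^ k) x)) x" for i k
  proof (induction i arbitrary: k)
    case 0
    then show ?case using L(2)[of k] by (simp add: u_def c_def)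
  next
    case (Suc i)
    have "(\<integral>t. s t ^ Suc i * u t ^ k \<partial>L) = (\<integral>t. 2 * m * (s t ^ i * u t ^ Suc k) - m * (s t ^ i * u t ^ k) \<partial>L)"
      by (rule Bochner_Integration.integral_cong) (auto simp: s_def algebra_simps)
    also have "\<dots> = 2 * m * inner ((G ^^ i) ((M ^^ Suc k) x)) x - m * inner ((G ^^ i) ((M ^^ k) x)) x"
      by (simp only: Bochner_Integration.integral_diff integrable_mult_right integ
          integral_mult_right_zero Suc.IH)
    also have "\<dots> = inner ((G ^^ i) ((2 * m) *\<^sub>R M ((M ^^ k) x) - m *\<^sub>R (M ^^ k) x)) x"
      by (simp add: Gn_lin inner_diff_left)
    also have "(2 * m) *\<^sub>R M ((M ^^ k) x) - m *\<^sub>R (M ^^ k) x = G ((M ^^ k) x)"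
      using m by (simp add: M_def algebra_simps)
    finally show ?case by (simp add: funpow_swap1)
  qed
  define \<nu> where "\<nu> = distr L (restrict_space borel I) s"
  have smeas: "s \<in> measurable L (restrict_space borel I)"
    using sI by (intro measurable_restrict_space2) auto
  show thesis
  proof (rule that[of \<nu>])
    show "prob_space \<nu>" unfolding \<nu>_def by (rule L.prob_space_distr[OF smeas])
    show "sets \<nu> = sets (restrict_space borel I)" by (simp add: \<nu>_def)
    fix i
    have "(\<integral>t. t ^ i \<partial>\<nu>) = (\<integral>t. s t ^ i \<partial>L)"
      unfolding \<nu>_def by (rule integral_distr[OF smeas]) (auto intro: measurable_restrict_space1)
    then show "(\<integral>t. t ^ i \<partial>\<nu>) = inner ((G ^^ i) x) x" using mixed[of i 0] by simp
  qed
qed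

lemma spectral_measure_ex:
  "\<exists>\<nu>. finite_measure \<nu> \<and> sets \<nu> = sets (restrict_space borel I) \<and>
     (\<forall>i. (\<integral>t. t ^ i \<partial>\<nu>) = inner ((G ^^ i) x) x)"
proof (cases "x = 0")
  case True
  then show ?thesis
    by (intro exI[of _ "null_measure (restrict_space borel I)"])
      (auto simp: Gn_lin intro!: finite_measureI)
next
  case False
  define y where "y = (1 / norm x) *\<^sub>R x"
  have "norm y = 1" using False by (simp add: y_def)
  then obtain \<nu> where \<nu>: "prob_space \<nu>" "sets \<nu> = sets (restrict_space borel I)"
    "\<And>i. (\<integral>t. t ^ i \<partial>\<nu>) = inner ((G ^^ i) y) y"
    using unit_spectral_measure by metis
  interpret prob_space \<nu> by fact
  let ?s = "density \<nu> (\<lambda>_. ennreal ((norm x)\<^sup>2))"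
  have "finite_measure ?s"
    by (rule finite_measureI) (simp add: emeasure_density emeasure_space_1)
  moreover have "(\<integral>t. t ^ i \<partial>?s) = inner ((G ^^ i) x) x" for i
  proof -
    have "(\<integral>t. t ^ i \<partial>?s) = (norm x)\<^sup>2 * inner ((G ^^ i) y) y"
    proof -
      have "(\<lambda>t. t ^ i) \<in> borel_measurable \<nu>"
        unfolding measurable_cong_sets[OF \<nu>(2) refl] by (intro measurable_restrict_space1) simp
      then show ?thesis by (simp add: integral_density \<nu>(3))
    qed
    also have "\<dots> = inner ((G ^^ i) x) x"
      using False by (simp add: y_def Gn_lin power2_eq_square)
    finally show ?thesis .
  qed
  ultimately show ?thesis using \<nu>(2) by (intro exI[of _ ?s]) auto
qed

section \<open>Spectral measures and bounded Borel symbols\<close>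

definition spectral_measure :: "'h \<Rightarrow> real measure" where
  "spectral_measure x = (SOME \<nu>. finite_measure \<nu> \<and> sets \<nu> = sets (restrict_space borel I) \<and>
     (\<forall>i. (\<integral>t. t ^ i \<partial>\<nu>) = inner ((G ^^ i) x) x))"

lemma finite_spectral_measure: "finite_measure (spectral_measure x)"
  and sets_spectral_measure: "sets (spectral_measure x) = sets (restrict_space borel I)"
  and spectral_moment: "(\<integral>t. t ^ i \<partial>spectral_measure x) = inner ((G ^^ i) x) x"
  using someI_ex[OF spectral_measure_ex[of x]] unfolding spectral_measure_def by blast+

lemma space_spectral_measure: "space (spectral_measure x) = I"
  using sets_eq_imp_space_eq[OF sets_spectral_measure[of x]] by (simp add: space_restrict_space)

lemma measurable_spectral: "measurable (spectral_measure x) A = measurable (restrict_space borel I) A"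
  by (rule measurable_cong_sets[OF sets_spectral_measure refl])

lemma measure_spectral: "measure (spectral_measure x) I = (norm x)\<^sup>2"
  using spectral_moment[where i = 0 and x = x] by (simp add: space_spectral_measure power2_norm_eq_inner)

definition adm :: "(real \<Rightarrow> complex) \<Rightarrow> bool" where
  "adm \<phi> \<longleftrightarrow> \<phi> \<in> borel_measurable (restrict_space borel I) \<and> (\<exists>B. \<forall>t\<in>I. norm (\<phi> t) \<le> B)"

lemma admI: "\<phi> \<in> borel_measurable (restrict_space borel I) \<Longrightarrow> (\<And>t. t \<in> I \<Longrightarrow> norm (\<phi> t) \<le> B) \<Longrightarrow> adm \<phi>"
  unfolding adm_def by blast

lemma admE: assumes "adm \<phi>" obtains B where "B > 0" "\<And>t. t \<in> I \<Longrightarrow> norm (\<phi> t) \<le> B"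
proof -
  obtain B where "\<forall>t\<in>I. norm (\<phi> t) \<le> B" using assms by (auto simp: adm_def)
  then have "\<And>t. t \<in> I \<Longrightarrow> norm (\<phi> t) \<le> max 1 B" by force
  then show thesis using that[of "max 1 B"] by auto
qed

lemma adm_integrable: assumes "adm \<phi>" shows "integrable (spectral_measure x) \<phi>"
proof -
  obtain B where B: "\<And>t. t \<in> I \<Longrightarrow> norm (\<phi> t) \<le> B" using admE[OF assms] by blast
  show ?thesis
    using assms B by (intro finite_measure.integrable_const_bound[OF finite_spectral_measure, where B = B])
      (auto simp: adm_def measurable_spectral space_spectral_measure)
qed

lemma adm_mult: assumes "adm \<phi>" "adm \<psi>" shows "adm (\<lambda>t. \<phi> t * \<psi> t)"
proof -
  obtain A where A: "\<And>t. t \<in> I \<Longrightarrow> norm (\<phi> t) \<le> A" "A > 0" using admE[OF assms(1)] by blast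
  obtain B where B: "\<And>t. t \<in> I \<Longrightarrow> norm (\<psi> t) \<le> B" using admE[OF assms(2)] by blast
  have "norm (\<phi> t * \<psi> t) \<le> A * B" if "t \<in> I" for t
    unfolding norm_mult using A B that by (intro mult_mono) (auto intro: order_trans[OF norm_ge_zero])
  then show ?thesis using assms by (intro admI[of _ "A * B"]) (auto simp: adm_def)
qed

lemma adm_cnj: "adm \<phi> \<Longrightarrow> adm (\<lambda>t. cnj (\<phi> t))"
  by (auto simp: adm_def intro: borel_measurable_continuous_on[of cnj] continuous_intros)

lemma adm_diff: assumes "adm \<phi>" "adm \<psi>" shows "adm (\<lambda>t. \<phi> t - \<psi> t)"
proof -
  obtain A where A: "\<And>t. t \<in> I \<Longrightarrow> norm (\<phi> t) \<le> A" using admE[OF assms(1)] by blast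
  obtain B where B: "\<And>t. t \<in> I \<Longrightarrow> norm (\<psi> t) \<le> B" using admE[OF assms(2)] by blast
  have "norm (\<phi> t - \<psi> t) \<le> A + B" if "t \<in> I" for t
    using A[OF that] B[OF that] norm_triangle_ineq4[of "\<phi> t" "\<psi> t"] by linarith
  then show ?thesis using assms by (intro admI[of _ "A + B"]) (auto simp: adm_def)
qed

lemma adm_lim:
  assumes "\<And>n. adm (\<phi> n)" "\<And>n t. t \<in> I \<Longrightarrow> norm (\<phi> n t) \<le> B" "\<And>t. t \<in> I \<Longrightarrow> (\<lambda>n. \<phi> n t) \<longlonglongrightarrow> \<psi> t"
  shows "adm \<psi>"
proof (rule admI)
  show "\<psi> \<in> borel_measurable (restrict_space borel I)"
  proof (rule borel_measurable_LIMSEQ_metric[of \<phi>])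
    show "\<phi> n \<in> borel_measurable (restrict_space borel I)" for n
      using assms(1)[of n] by (simp add: adm_def)
    fix t assume "t \<in> space (restrict_space borel I)"
    then show "(\<lambda>n. \<phi> n t) \<longlonglongrightarrow> \<psi> t" by (intro assms(3)) (simp add: space_restrict_space)
  qed
  fix t assume t: "t \<in> I"
  show "norm (\<psi> t) \<le> B"
    by (rule LIMSEQ_le_const2[OF tendsto_norm[OF assms(3)[OF t]]]) (use assms(2)[OF t] in blast)
qed

lemma adm_poly: "adm (\<lambda>t. \<Sum>i<n. c i * of_real t ^ i)"
proof (rule admI)
  show "(\<lambda>t. \<Sum>i<n. c i * of_real t ^ i) \<in> borel_measurable (restrict_space borel I)"
    by (intro measurable_restrict_space1) measurable
  fix t assume "t \<in> I"
  then have "\<bar>t\<bar> \<le> m" by auto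
  then show "norm (\<Sum>i<n. c i * complex_of_real t ^ i) \<le> (\<Sum>i<n. norm (c i) * m ^ i)"
    by (intro sum_norm_le) (auto simp: norm_mult norm_power intro!: mult_left_mono power_mono)
qed

text \<open>
  \<open>fcalc \<phi> X\<close> means \<open>X = \<phi>(G)\<close>. Only the values of \<open>\<phi>\<close> on \<open>I\<close> matter.
\<close>

inductive fcalc :: "(real \<Rightarrow> complex) \<Rightarrow> ('h \<Rightarrow> 'h) \<Rightarrow> bool" where
  poly: "fcalc (\<lambda>t. \<Sum>i<n. c i * of_real t ^ i) (\<lambda>x. \<Sum>i<n. c i *\<^sub>C (G ^^ i) x)"
| lim: "(\<And>n. fcalc (\<phi> n) (X n)) \<Longrightarrow> (\<And>n t. t \<in> I \<Longrightarrow> norm (\<phi> n t) \<le> B) \<Longrightarrow>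
    (\<And>t. t \<in> I \<Longrightarrow> (\<lambda>n. \<phi> n t) \<longlonglongrightarrow> \<psi> t) \<Longrightarrow> (\<And>x. (\<lambda>n. X n x) \<longlonglongrightarrow> Y x) \<Longrightarrow> fcalc \<psi> Y"

lemma fcalc_adm: "fcalc \<phi> X \<Longrightarrow> adm \<phi>"
proof (induction rule: fcalc.induct)
  case (lim \<phi> X B \<psi> Y)
  show ?case by (rule adm_lim[OF lim.IH lim.hyps(2) lim.hyps(3)])
qed (rule adm_poly)

lemma integral_lim:
  assumes "\<And>n. adm (\<phi> n)" "\<And>n t. t \<in> I \<Longrightarrow> norm (\<phi> n t) \<le> B" "\<And>t. t \<in> I \<Longrightarrow> (\<lambda>n. \<phi> n t) \<longlonglongrightarrow> \<psi> t"
  shows "(\<lambda>n. \<integral>t. \<phi> n t \<partial>spectral_measure x) \<longlonglongrightarrow> (\<integral>t. \<psi> t \<partial>spectral_measure x)"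
proof (rule integral_dominated_convergence[where w = "\<lambda>_. B"])
  show "\<psi> \<in> borel_measurable (spectral_measure x)" "\<phi> n \<in> borel_measurable (spectral_measure x)" for n
    using assms(1)[of n] adm_lim[OF assms] by (simp_all add: adm_def measurable_spectral)
  show "integrable (spectral_measure x) (\<lambda>_. B)"
    by (rule finite_measure.integrable_const[OF finite_spectral_measure])
  show "AE t in spectral_measure x. (\<lambda>n. \<phi> n t) \<longlonglongrightarrow> \<psi> t"
    by (rule AE_I2) (simp only: space_spectral_measure assms(3))
  show "AE t in spectral_measure x. norm (\<phi> n t) \<le> B" for n
    by (rule AE_I2) (simp only: space_spectral_measure assms(2))
qed

lemma cinner_powers:
  "cinner ((G ^^ i) x) ((G ^^ j) x) = (\<integral>t. complex_of_real t ^ i * complex_of_real t ^ j \<partial>spectral_measure x)"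
proof -
  have "cinner ((G ^^ i) x) ((G ^^ j) x) = cinner ((G ^^ (j + i)) x) x"
    using hermitian_funpow[OF herm, of j "(G ^^ i) x" x] by (simp add: funpow_add)
  also have "\<dots> = of_real (inner ((G ^^ (j + i)) x) x)"
  proof -
    have "cinner ((G ^^ (j + i)) x) x = cnj (cinner ((G ^^ (j + i)) x) x)"
      using hermitian_funpow[OF herm, of "j + i" x x] cinner_commute by metis
    then show ?thesis by (simp add: inner_eq_Re_cinner complex_eq_iff)
  qed
  also have "\<dots> = (\<integral>t. complex_of_real (t ^ (j + i)) \<partial>spectral_measure x)"
    by (simp only: spectral_moment[symmetric] integral_complex_of_real)
  finally show ?thesis by (simp add: power_add mult.commute)
qed

text \<open>First half of a double induction: one factor stays polynomial while the other runs
  through the inductive closure, where dominated convergence handles the limits. Both vectors are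
  functions of \<open>G\<close> applied to the same \<open>x\<close>, so one measure describes their
  inner product.\<close>

lemma fcalc_cinner_poly:
  "fcalc \<phi> X \<Longrightarrow> cinner (X x) (\<Sum>j<k. d j *\<^sub>C (G ^^ j) x) =
    (\<integral>t. \<phi> t * cnj (\<Sum>j<k. d j * of_real t ^ j) \<partial>spectral_measure x)"
proof (induction rule: fcalc.induct)
  case (poly c n)
  have mono: "adm (\<lambda>t. complex_of_real t ^ i)" for i
    using adm_poly[where c = "\<lambda>j. if j = i then 1 else 0" and n = "Suc i"] by (simp add: sum.delta' if_distrib cong: if_cong)
  have "(\<integral>t. (\<Sum>i<n. c i * of_real t ^ i) * cnj (\<Sum>j<k. d j * of_real t ^ j) \<partial>spectral_measure x) =
     (\<integral>t. (\<Sum>i<n. \<Sum>j<k. c i * cnj (d j) * (of_real t ^ i * of_real t ^ j)) \<partial>spectral_measure x)"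
    by (simp add: sum_product mult_ac)
  also have "\<dots> = (\<Sum>i<n. \<Sum>j<k. c i * cnj (d j) * cinner ((G ^^ i) x) ((G ^^ j) x))"
    by (simp add: cinner_powers adm_integrable adm_mult mono)
  also have "\<dots> = cinner (\<Sum>i<n. c i *\<^sub>C (G ^^ i) x) (\<Sum>j<k. d j *\<^sub>C (G ^^ j) x)"
    unfolding cinner_sum_left cinner_scaleC_left
    by (simp only: cinner_sum_right cinner_scaleC_right sum_distrib_left mult.assoc)
  finally show ?case ..
next
  case (lim \<phi> X B \<psi> Y)
  let ?p = "\<lambda>t. cnj (\<Sum>j<k. d j * complex_of_real t ^ j)"
  obtain C where C: "\<And>t. t \<in> I \<Longrightarrow> norm (?p t) \<le> C" using admE[OF adm_cnj[OF adm_poly]] by blast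
  have "(\<lambda>n. \<integral>t. \<phi> n t * ?p t \<partial>spectral_measure x) \<longlonglongrightarrow> (\<integral>t. \<psi> t * ?p t \<partial>spectral_measure x)"
  proof (rule integral_lim)
    show "adm (\<lambda>t. \<phi> n t * ?p t)" for n using fcalc_adm[OF lim.hyps(1)] by (intro adm_mult adm_cnj adm_poly)
    show "norm (\<phi> n t * ?p t) \<le> B * C" if "t \<in> I" for n t
      unfolding norm_mult using lim.hyps(2)[OF that] C[OF that]
      by (intro mult_mono) (auto intro: order_trans[OF norm_ge_zero])
    show "(\<lambda>n. \<phi> n t * ?p t) \<longlonglongrightarrow> \<psi> t * ?p t" if "t \<in> I" for t
      using lim.hyps(3)[OF that] by (intro tendsto_intros)
  qed
  moreover have "(\<lambda>n. cinner (X n x) (\<Sum>j<k. d j *\<^sub>C (G ^^ j) x)) \<longlonglongrightarrow> cinner (Y x) (\<Sum>j<k. d j *\<^sub>C (G ^^ j) x)"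
    by (intro tendsto_cinner lim.hyps(4) tendsto_const)
  ultimately show ?case using lim.IH LIMSEQ_unique by simp
qed

lemma fcalc_cinner:
  assumes X: "fcalc \<phi> X"
  shows "fcalc \<psi> Y \<Longrightarrow> cinner (X x) (Y x) = (\<integral>t. \<phi> t * cnj (\<psi> t) \<partial>spectral_measure x)"
proof (induction rule: fcalc.induct)
  case (poly c n)
  then show ?case using fcalc_cinner_poly[OF X] by simp
next
  case (lim \<psi> Z B \<zeta> Y)
  obtain C where C: "\<And>t. t \<in> I \<Longrightarrow> norm (\<phi> t) \<le> C" using admE[OF fcalc_adm[OF X]] by blast
  have "(\<lambda>n. \<integral>t. \<phi> t * cnj (\<psi> n t) \<partial>spectral_measure x) \<longlonglongrightarrow> (\<integral>t. \<phi> t * cnj (\<zeta> t) \<partial>spectral_measure x)"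
  proof (rule integral_lim)
    show "adm (\<lambda>t. \<phi> t * cnj (\<psi> n t))" for n
      using fcalc_adm[OF X] fcalc_adm[OF lim.hyps(1)] by (intro adm_mult adm_cnj)
    show "norm (\<phi> t * cnj (\<psi> n t)) \<le> C * B" if "t \<in> I" for n t
      unfolding norm_mult complex_mod_cnj using lim.hyps(2)[OF that] C[OF that]
      by (intro mult_mono) (auto intro: order_trans[OF norm_ge_zero])
    show "(\<lambda>n. \<phi> t * cnj (\<psi> n t)) \<longlonglongrightarrow> \<phi> t * cnj (\<zeta> t)" if "t \<in> I" for t
      using lim.hyps(3)[OF that] by (intro tendsto_intros)
  qed
  moreover have "(\<lambda>n. cinner (X x) (Z n x)) \<longlonglongrightarrow> cinner (X x) (Y x)"
    by (intro tendsto_cinner lim.hyps(4) tendsto_const)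
  ultimately show ?case using lim.IH LIMSEQ_unique by simp
qed

text \<open>The map from a symbol to the vector \<open>X x\<close> is isometric into the L2 space of
  \<open>spectral_measure x\<close>. Uniqueness, the norm bound and convergence are read off from
  this.\<close>

lemma fcalc_norm_diff:
  assumes X: "fcalc \<phi> X" and Y: "fcalc \<psi> Y"
  shows "(norm (X x - Y x))\<^sup>2 = (\<integral>t. (norm (\<phi> t - \<psi> t))\<^sup>2 \<partial>spectral_measure x)"
proof -
  note a = fcalc_adm[OF X] fcalc_adm[OF Y]
  have i: "integrable (spectral_measure x) (\<lambda>t. f t * cnj (g t))" if "adm f" "adm g" for f g
    using that by (intro adm_integrable adm_mult adm_cnj)
  have "complex_of_real ((norm (X x - Y x))\<^sup>2) = cinner (X x - Y x) (X x - Y x)" by (simp add: cinner_self)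
  also have "\<dots> = (cinner (X x) (X x) - cinner (X x) (Y x)) - (cinner (Y x) (X x) - cinner (Y x) (Y x))"
    by (simp add: cinner_diff_left cinner_diff_right)
  also have "\<dots> = (\<integral>t. (\<phi> t * cnj (\<phi> t) - \<phi> t * cnj (\<psi> t)) - (\<psi> t * cnj (\<phi> t) - \<psi> t * cnj (\<psi> t)) \<partial>spectral_measure x)"
    using i a by (simp add: fcalc_cinner[OF X X] fcalc_cinner[OF X Y] fcalc_cinner[OF Y X] fcalc_cinner[OF Y Y])
  also have "\<dots> = (\<integral>t. complex_of_real ((norm (\<phi> t - \<psi> t))\<^sup>2) \<partial>spectral_measure x)"
    by (rule Bochner_Integration.integral_cong[OF refl]) (simp only: complex_norm_square complex_cnj_diff, simp add: algebra_simps)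
  also have "\<dots> = of_real (\<integral>t. (norm (\<phi> t - \<psi> t))\<^sup>2 \<partial>spectral_measure x)"
    by (rule integral_complex_of_real)
  finally show ?thesis by (simp only: of_real_eq_iff)
qed

lemma fcalc_zero: "fcalc (\<lambda>_. 0) (\<lambda>_. 0)"
  using poly[where n = 0] by simp

lemma fcalc_norm: "fcalc \<phi> X \<Longrightarrow> (norm (X x))\<^sup>2 = (\<integral>t. (norm (\<phi> t))\<^sup>2 \<partial>spectral_measure x)"
  using fcalc_norm_diff[OF _ fcalc_zero] by simp

lemma fcalc_unique:
  assumes "fcalc \<phi> X" "fcalc \<psi> Y" "\<And>t. t \<in> I \<Longrightarrow> \<phi> t = \<psi> t" shows "X = Y"
proof
  fix x
  have "(\<integral>t. (norm (\<phi> t - \<psi> t))\<^sup>2 \<partial>spectral_measure x) = (\<integral>t. 0 \<partial>spectral_measure x)"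
    using assms(3) by (intro Bochner_Integration.integral_cong) (auto simp: space_spectral_measure)
  with fcalc_norm_diff[OF assms(1,2), of x] show "X x = Y x" by simp
qed

lemma fcalc_norm_le:
  assumes "fcalc \<phi> X" and B: "\<And>t. t \<in> I \<Longrightarrow> norm (\<phi> t) \<le> B" "0 \<le> B"
  shows "norm (X x) \<le> B * norm x"
proof -
  interpret finite_measure "spectral_measure x" by (rule finite_spectral_measure)
  have le: "(norm (\<phi> t))\<^sup>2 \<le> B\<^sup>2" if "t \<in> I" for t using B(1)[OF that] by (simp add: power_mono)
  have "\<phi> \<in> borel_measurable (spectral_measure x)"
    using fcalc_adm[OF assms(1)] by (simp add: adm_def measurable_spectral)
  then have "integrable (spectral_measure x) (\<lambda>t. (norm (\<phi> t))\<^sup>2)"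
    by (intro integrable_const_bound[where B = "B\<^sup>2"] AE_I2) (simp_all add: space_spectral_measure le)
  then have "(norm (X x))\<^sup>2 \<le> (\<integral>t. B\<^sup>2 \<partial>spectral_measure x)"
    unfolding fcalc_norm[OF assms(1)]
    by (intro integral_mono integrable_const) (simp_all only: space_spectral_measure le)
  also have "\<dots> = (B * norm x)\<^sup>2"
    by (simp add: space_spectral_measure measure_spectral power_mult_distrib)
  finally show ?thesis by (rule power2_le_imp_le) (use B(2) in simp)
qed

lemma integral_sq_lim:
  assumes "\<And>n. adm (\<phi> n)" "\<And>n t. t \<in> I \<Longrightarrow> norm (\<phi> n t) \<le> B" "\<And>t. t \<in> I \<Longrightarrow> (\<lambda>n. \<phi> n t) \<longlonglongrightarrow> \<psi> t"
  shows "(\<lambda>n. \<integral>t. (norm (\<phi> n t - \<psi> t))\<^sup>2 \<partial>spectral_measure x) \<longlonglongrightarrow> 0"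
proof -
  have \<psi>: "adm \<psi>" by (rule adm_lim[OF assms])
  then obtain C where C: "\<And>t. t \<in> I \<Longrightarrow> norm (\<psi> t) \<le> C" using admE by blast
  have "(\<lambda>n. \<integral>t. (norm (\<phi> n t - \<psi> t))\<^sup>2 \<partial>spectral_measure x) \<longlonglongrightarrow> (\<integral>t. 0 \<partial>spectral_measure x)"
  proof (rule integral_dominated_convergence[where w = "\<lambda>_. (B + C)\<^sup>2"])
    show "AE t in spectral_measure x. (\<lambda>n. (norm (\<phi> n t - \<psi> t))\<^sup>2) \<longlonglongrightarrow> 0"
    proof (rule AE_I2)
      fix t assume "t \<in> space (spectral_measure x)"
      then have "(\<lambda>n. \<phi> n t) \<longlonglongrightarrow> \<psi> t" using assms(3) by (simp add: space_spectral_measure)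
      then have "(\<lambda>n. norm (\<phi> n t - \<psi> t)) \<longlonglongrightarrow> 0" by (simp add: LIM_zero_iff tendsto_norm_zero_iff)
      from tendsto_power[OF this, of 2] show "(\<lambda>n. (norm (\<phi> n t - \<psi> t))\<^sup>2) \<longlonglongrightarrow> 0" by simp
    qed
    show "AE t in spectral_measure x. norm ((norm (\<phi> n t - \<psi> t))\<^sup>2) \<le> (B + C)\<^sup>2" for n
    proof (rule AE_I2)
      fix t assume "t \<in> space (spectral_measure x)"
      then have "norm (\<phi> n t - \<psi> t) \<le> B + C"
        using assms(2)[of t n] C[of t] norm_triangle_ineq4[of "\<phi> n t" "\<psi> t"] by (simp add: space_spectral_measure)
      then show "norm ((norm (\<phi> n t - \<psi> t))\<^sup>2) \<le> (B + C)\<^sup>2" by (simp add: power_mono)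
    qed
    have "\<phi> n \<in> borel_measurable (spectral_measure x)" "\<psi> \<in> borel_measurable (spectral_measure x)" for n
      using assms(1)[of n] \<psi> by (simp_all add: adm_def measurable_spectral)
    then show "(\<lambda>t. (norm (\<phi> n t - \<psi> t))\<^sup>2) \<in> borel_measurable (spectral_measure x)" for n
      by measurable
  qed (simp_all add: finite_measure.integrable_const[OF finite_spectral_measure])
  then show ?thesis by simp
qed

lemma fcalc_tendsto:
  assumes X: "\<And>n. fcalc (\<phi> n) (X n)" and B: "\<And>n t. t \<in> I \<Longrightarrow> norm (\<phi> n t) \<le> B"
    and l: "\<And>t. t \<in> I \<Longrightarrow> (\<lambda>n. \<phi> n t) \<longlonglongrightarrow> \<psi> t" and Y: "fcalc \<psi> Y"
  shows "(\<lambda>n. X n x) \<longlonglongrightarrow> Y x"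
proof -
  have "(\<lambda>n. (norm (X n x - Y x))\<^sup>2) \<longlonglongrightarrow> 0"
    unfolding fcalc_norm_diff[OF X Y] by (rule integral_sq_lim[OF fcalc_adm[OF X] B l])
  from tendsto_real_sqrt[OF this] show ?thesis by (simp add: LIM_zero_iff tendsto_norm_zero_iff)
qed

text \<open>Bounded pointwise convergence of symbols is convergence in L2 of each spectral measure,
  so the vectors \<open>X n x\<close> are Cauchy and completeness supplies the limit
  operator.\<close>

lemma fcalc_lim_ex:
  assumes X: "\<And>n. fcalc (\<phi> n) (X n)" and B: "\<And>n t. t \<in> I \<Longrightarrow> norm (\<phi> n t) \<le> B"
    and l: "\<And>t. t \<in> I \<Longrightarrow> (\<lambda>n. \<phi> n t) \<longlonglongrightarrow> \<psi> t"
  obtains Y where "fcalc \<psi> Y"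
proof -
  have \<psi>: "adm \<psi>" by (rule adm_lim[OF fcalc_adm[OF X] B l])
  have "Cauchy (\<lambda>n. X n x)" for x
  proof -
    define L where "L n = (\<integral>t. (norm (\<phi> n t - \<psi> t))\<^sup>2 \<partial>spectral_measure x)" for n
    have L: "L \<longlonglongrightarrow> 0" unfolding L_def by (rule integral_sq_lim[OF fcalc_adm[OF X] B l])
    have int: "integrable (spectral_measure x) (\<lambda>t. (norm (f t))\<^sup>2)" if "adm f" for f
    proof -
      have "integrable (spectral_measure x) (\<lambda>t. norm (f t * f t))"
        by (intro integrable_norm adm_integrable adm_mult that)
      then show ?thesis by (simp add: norm_mult power2_eq_square)
    qed
    have le: "(norm (X i x - X j x))\<^sup>2 \<le> 2 * L i + 2 * L j" for i j
    proof -
      have sq: "(norm (a - b))\<^sup>2 \<le> 2 * (norm (a - c))\<^sup>2 + 2 * (norm (b - c))\<^sup>2" for a b c :: complex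
      proof -
        have "norm (a - b) \<le> norm (a - c) + norm (b - c)"
          using norm_triangle_ineq4[of "a - c" "b - c"] by simp
        then have "(norm (a - b))\<^sup>2 \<le> (norm (a - c) + norm (b - c))\<^sup>2" by (simp add: power_mono)
        moreover have "0 \<le> (norm (a - c) - norm (b - c))\<^sup>2" by simp
        ultimately show ?thesis by (simp add: power2_sum power2_diff)
      qed
      have "(norm (X i x - X j x))\<^sup>2 = (\<integral>t. (norm (\<phi> i t - \<phi> j t))\<^sup>2 \<partial>spectral_measure x)"
        by (rule fcalc_norm_diff[OF X X])
      also have "\<dots> \<le> (\<integral>t. 2 * (norm (\<phi> i t - \<psi> t))\<^sup>2 + 2 * (norm (\<phi> j t - \<psi> t))\<^sup>2 \<partial>spectral_measure x)"
        using fcalc_adm[OF X] \<psi>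
        by (intro integral_mono Bochner_Integration.integrable_add integrable_mult_right int adm_diff sq)
      also have "\<dots> = 2 * L i + 2 * L j"
        unfolding L_def using fcalc_adm[OF X] \<psi>
        by (subst Bochner_Integration.integral_add) (auto intro!: int adm_diff)
      finally show ?thesis .
    qed
    show ?thesis
    proof (rule CauchyI)
      fix e :: real assume e: "e > 0"
      then obtain N where N: "\<And>n. n \<ge> N \<Longrightarrow> norm (L n) < e\<^sup>2 / 4"
        using LIMSEQ_D[OF L, of "e\<^sup>2 / 4"] by auto
      have "norm (X i x - X j x) < e" if "i \<ge> N" "j \<ge> N" for i j
      proof (rule power_less_imp_less_base[of _ 2])
        show "(norm (X i x - X j x))\<^sup>2 < e\<^sup>2"
          using le[of i j] N[OF that(1)] N[OF that(2)] by simp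
      qed (use e in simp)
      then show "\<exists>M. \<forall>i\<ge>M. \<forall>j\<ge>M. norm (X i x - X j x) < e" by blast
    qed
  qed
  then have "\<exists>y. (\<lambda>n. X n x) \<longlonglongrightarrow> y" for x
    by (simp add: Cauchy_convergent_iff convergent_def)
  then obtain Y where "\<And>x. (\<lambda>n. X n x) \<longlonglongrightarrow> Y x" by metis
  from that[OF lim[OF X B l this]] show thesis .
qed

section \<open>Algebraic rules of the calculus\<close>

lemma fcalc_bounded_clinear: assumes X: "fcalc \<phi> X" shows "bounded_clinear X"
proof -
  have *: "X (x + y) = X x + X y \<and> X (c *\<^sub>C x) = c *\<^sub>C X x" for c x y
    using X
  proof (induction rule: fcalc.induct)
    case (poly d n)
    show ?case
      by (simp add: Gn_lin scaleC_add_right sum.distrib complex_vector.scale_sum_right scaleC_scaleC mult.commute)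
  next
    case (lim \<phi> X B \<psi> Y)
    have "(\<lambda>n. X n (x + y)) \<longlonglongrightarrow> Y x + Y y" using lim.IH lim.hyps(4) by (simp add: tendsto_add)
    moreover have "(\<lambda>n. X n (c *\<^sub>C x)) \<longlonglongrightarrow> c *\<^sub>C Y x" using lim.IH lim.hyps(4) by (simp add: tendsto_scaleC)
    ultimately show ?case using lim.hyps(4) LIMSEQ_unique by blast
  qed
  obtain B where B: "B > 0" "\<And>t. t \<in> I \<Longrightarrow> norm (\<phi> t) \<le> B" using admE[OF fcalc_adm[OF X]] by blast
  have "bounded_linear X"
  proof (rule bounded_linear_intro[of X B])
    show "norm (X x) \<le> norm x * B" for x
      using fcalc_norm_le[OF X B(2), of x] B(1) by (simp add: mult.commute)
  qed (simp_all add: * scaleR_scaleC)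
  with * show ?thesis by (simp add: bounded_clinear_def)
qed

lemma fcalc_commute:
  assumes "fcalc \<phi> X" and C: "bounded_clinear C" "\<And>x. C (G x) = G (C x)"
  shows "C (X x) = X (C x)"
  using assms(1)
proof (induction rule: fcalc.induct)
  case (poly c n)
  have "C (\<Sum>i<n. c i *\<^sub>C (G ^^ i) x) = (\<Sum>i<n. C (c i *\<^sub>C (G ^^ i) x))"
    using C(1) by (simp add: bounded_clinear_def linear_sum bounded_linear.linear)
  also have "\<dots> = (\<Sum>i<n. c i *\<^sub>C (G ^^ i) (C x))"
    using funpow_commute[of G C] C(2) by (simp add: bounded_clinearD(3)[OF C(1)])
  finally show ?case .
next
  case (lim \<phi> X B \<psi> Y)
  show ?case
    by (rule LIMSEQ_unique[OF bounded_clinear_tendsto[OF C(1) lim.hyps(4)]]) (simp add: lim.IH lim.hyps(4))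
qed

lemma fcalc_scale: assumes "fcalc \<phi> X" shows "fcalc (\<lambda>t. a * \<phi> t) (\<lambda>x. a *\<^sub>C X x)"
  using assms
proof (induction rule: fcalc.induct)
  case (poly c n)
  show ?case using fcalc.poly[where n = n and c = "\<lambda>i. a * c i"]
    by (simp add: sum_distrib_left complex_vector.scale_sum_right scaleC_scaleC mult_ac)
next
  case (lim \<phi> X B \<psi> Y)
  show ?case
  proof (rule fcalc.lim[OF lim.IH, where B = "norm a * B"])
    fix n t assume t: "t \<in> I"
    show "norm (a * \<phi> n t) \<le> norm a * B"
      unfolding norm_mult using lim.hyps(2)[OF t] by (rule mult_left_mono) simp
    show "(\<lambda>n. a * \<phi> n t) \<longlonglongrightarrow> a * \<psi> t" using lim.hyps(3)[OF t] by (rule tendsto_mult_left)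
  qed (intro tendsto_scaleC tendsto_const lim.hyps(4))
qed

lemma fcalc_G: assumes "fcalc \<phi> X" shows "fcalc (\<lambda>t. of_real t * \<phi> t) (\<lambda>x. G (X x))"
  using assms
proof (induction rule: fcalc.induct)
  case (poly c n)
  have "G (\<Sum>i<n. c i *\<^sub>C (G ^^ i) x) = (\<Sum>i<n. c i *\<^sub>C (G ^^ Suc i) x)" for x
    using hermitian_bounded_clinear[OF herm]
    by (simp add: bounded_clinear_def linear_sum bounded_linear.linear)
  then show ?case using fcalc.poly[where n = "Suc n" and c = "\<lambda>i. if i = 0 then 0 else c (i - 1)"]
    by (simp add: sum.lessThan_Suc_shift sum_distrib_left mult_ac del: sum.lessThan_Suc)
next
  case (lim \<phi> X B \<psi> Y)
  show ?case
  proof (rule fcalc.lim[OF lim.IH, where B = "m * B"])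
    fix n t assume t: "t \<in> I"
    have "\<bar>t\<bar> \<le> m" using t by auto
    then show "norm (complex_of_real t * \<phi> n t) \<le> m * B"
      unfolding norm_mult norm_of_real using lim.hyps(2)[OF t, of n] m by (intro mult_mono) simp_all
    show "(\<lambda>n. complex_of_real t * \<phi> n t) \<longlonglongrightarrow> complex_of_real t * \<psi> t"
      using lim.hyps(3)[OF t] by (rule tendsto_mult_left)
  qed (rule bounded_clinear_tendsto[OF hermitian_bounded_clinear[OF herm] lim.hyps(4)])
qed

lemma fcalc_add: assumes X: "fcalc \<phi> X" and Y: "fcalc \<psi> Y"
  shows "fcalc (\<lambda>t. \<phi> t + \<psi> t) (\<lambda>x. X x + Y x)"
  using X
proof (induction rule: fcalc.induct)
  case (poly c n)
  show ?case using Y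
  proof (induction rule: fcalc.induct)
    case (poly d k)
    let ?e = "\<lambda>i. (if i < n then c i else 0) + (if i < k then d i else 0)"
    have 1: "(\<Sum>i<max n k. ?e i * of_real t ^ i) = (\<Sum>i<n. c i * of_real t ^ i) + (\<Sum>i<k. d i * of_real t ^ i)" for t
    proof -
      have "(\<Sum>i<max n k. (if i < n then c i else 0) * of_real t ^ i) = (\<Sum>i<n. c i * of_real t ^ i)"
        by (rule sum.mono_neutral_cong_right) auto
      moreover have "(\<Sum>i<max n k. (if i < k then d i else 0) * of_real t ^ i) = (\<Sum>i<k. d i * of_real t ^ i)"
        by (rule sum.mono_neutral_cong_right) auto
      ultimately show ?thesis by (simp add: distrib_right sum.distrib)
    qed
    have 2: "(\<Sum>i<max n k. ?e i *\<^sub>C (G ^^ i) x) = (\<Sum>i<n. c i *\<^sub>C (G ^^ i) x) + (\<Sum>i<k. d i *\<^sub>C (G ^^ i) x)" for x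
    proof -
      have "(\<Sum>i<max n k. (if i < n then c i else 0) *\<^sub>C (G ^^ i) x) = (\<Sum>i<n. c i *\<^sub>C (G ^^ i) x)"
        by (rule sum.mono_neutral_cong_right) auto
      moreover have "(\<Sum>i<max n k. (if i < k then d i else 0) *\<^sub>C (G ^^ i) x) = (\<Sum>i<k. d i *\<^sub>C (G ^^ i) x)"
        by (rule sum.mono_neutral_cong_right) auto
      ultimately show ?thesis by (simp add: scaleC_add_left sum.distrib)
    qed
    show ?case using fcalc.poly[where n = "max n k" and c = ?e] by (simp only: 1 2)
  next
    case (lim \<phi> X B \<psi> Y)
    obtain C where C: "\<And>t. t \<in> I \<Longrightarrow> norm (\<Sum>i<n. c i * complex_of_real t ^ i) \<le> C" using admE[OF adm_poly] by blast
    show ?case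
      by (rule fcalc.lim[OF lim.IH, where B = "C + B"])
        (auto intro!: tendsto_intros lim.hyps(3) lim.hyps(4) norm_triangle_mono C lim.hyps(2))
  qed
next
  case (lim \<phi> X B \<psi>' Y')
  obtain C where C: "\<And>t. t \<in> I \<Longrightarrow> norm (\<psi> t) \<le> C" using admE[OF fcalc_adm[OF Y]] by blast
  show ?case
    by (rule fcalc.lim[OF lim.IH, where B = "B + C"])
      (auto intro!: tendsto_intros lim.hyps(3) lim.hyps(4) norm_triangle_mono C lim.hyps(2))
qed

lemma fcalc_mult: assumes X: "fcalc \<phi> X" and Y: "fcalc \<psi> Y"
  shows "fcalc (\<lambda>t. \<phi> t * \<psi> t) (\<lambda>x. X (Y x))"
  using X
proof (induction rule: fcalc.induct)
  case (poly c n)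
  show ?case
  proof (induction n)
    case 0
    then show ?case by (simp add: fcalc_zero)
  next
    case (Suc n)
    have "fcalc (\<lambda>t. of_real t ^ n * \<psi> t) (\<lambda>x. (G ^^ n) (Y x))"
      by (induction n) (auto simp: Y mult.assoc dest: fcalc_G)
    from fcalc_add[OF Suc fcalc_scale[OF this, of "c n"]] show ?case
      by (simp add: algebra_simps)
  qed
next
  case (lim \<phi> X B \<zeta> Z)
  obtain C where C: "\<And>t. t \<in> I \<Longrightarrow> norm (\<psi> t) \<le> C" using admE[OF fcalc_adm[OF Y]] by blast
  show ?case
  proof (rule fcalc.lim[OF lim.IH, where B = "B * C"])
    fix n t assume t: "t \<in> I"
    show "norm (\<phi> n t * \<psi> t) \<le> B * C"
      unfolding norm_mult using lim.hyps(2)[OF t, of n] C[OF t]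
      by (intro mult_mono) (auto intro: order_trans[OF norm_ge_zero])
  qed (auto intro!: tendsto_intros lim.hyps(3) lim.hyps(4))
qed

lemma fcalc_adjoint:
  assumes "fcalc \<phi> X"
  shows "\<exists>Y. fcalc (\<lambda>t. cnj (\<phi> t)) Y \<and> (\<forall>x y. cinner (X x) y = cinner x (Y y))"
  using assms
proof (induction rule: fcalc.induct)
  case (poly c n)
  have "cinner (\<Sum>i<n. c i *\<^sub>C (G ^^ i) x) y = cinner x (\<Sum>i<n. cnj (c i) *\<^sub>C (G ^^ i) y)" for x y
    by (simp add: cinner_sum_left cinner_sum_right cinner_scaleC_left cinner_scaleC_right hermitian_funpow[OF herm])
  then show ?case using fcalc.poly[where n = n and c = "\<lambda>i. cnj (c i)"] by (intro exI conjI) auto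
next
  case (lim \<phi> X B \<psi> Z)
  then obtain Y where Y: "\<And>n. fcalc (\<lambda>t. cnj (\<phi> n t)) (Y n)" "\<And>n x y. cinner (X n x) y = cinner x (Y n y)"
    by metis
  have B: "norm (cnj (\<phi> n t)) \<le> B" if "t \<in> I" for n t using lim.hyps(2)[OF that] by simp
  have l: "(\<lambda>n. cnj (\<phi> n t)) \<longlonglongrightarrow> cnj (\<psi> t)" if "t \<in> I" for t using lim.hyps(3)[OF that] by (rule tendsto_cnj)
  \<comment> \<open>Strong convergence of operators does not in general pass to their adjoints. Here
    it does, because the conjugate symbols again converge boundedly.\<close>
  obtain W where W: "fcalc (\<lambda>t. cnj (\<psi> t)) W" using fcalc_lim_ex[OF Y(1) B l] by blast
  have "cinner (Z x) y = cinner x (W y)" for x y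
  proof (rule LIMSEQ_unique)
    show "(\<lambda>n. cinner (X n x) y) \<longlonglongrightarrow> cinner (Z x) y" by (intro tendsto_cinner lim.hyps(4) tendsto_const)
    show "(\<lambda>n. cinner (X n x) y) \<longlonglongrightarrow> cinner x (W y)"
      unfolding Y(2) by (intro tendsto_cinner tendsto_const fcalc_tendsto[OF Y(1) B l W])
  qed
  with W show ?case by blast
qed

lemma fcalc_hermitian:
  assumes X: "fcalc \<phi> X" and "\<And>t. t \<in> I \<Longrightarrow> \<phi> t \<in> \<real>" shows "hermitian X"
proof -
  obtain Y where Y: "fcalc (\<lambda>t. cnj (\<phi> t)) Y" "\<forall>x y. cinner (X x) y = cinner x (Y y)"
    using fcalc_adjoint[OF X] by blast
  have "X = Y" using assms(2) by (intro fcalc_unique[OF X Y(1)]) (auto simp: Reals_cnj_iff)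
  with Y(2) show ?thesis by (simp add: hermitian_def)
qed

lemma fcalc_id: "fcalc (\<lambda>_. 1) (\<lambda>x. x)"
  using poly[where n = 1 and c = "\<lambda>_. 1"] by (simp add: scaleC_one)

lemma fcalc_self: "fcalc of_real G"
  using fcalc_G[OF fcalc_id] by simp

lemma fcalc_nonneg:
  assumes X: "fcalc (\<lambda>t. of_real (f t)) X" and "\<And>t. t \<in> I \<Longrightarrow> 0 \<le> f t"
  shows "0 \<le> inner (X x) x"
proof -
  have "cinner (X x) x = of_real (\<integral>t. f t \<partial>spectral_measure x)"
    using fcalc_cinner[OF X fcalc_id, of x] by (simp add: integral_complex_of_real)
  moreover have "0 \<le> (\<integral>t. f t \<partial>spectral_measure x)"
    using assms(2) by (intro integral_nonneg_AE AE_I2) (simp add: space_spectral_measure)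
  ultimately show ?thesis by (simp add: inner_eq_Re_cinner)
qed

section \<open>Continuous symbols and limits along a real parameter\<close>

lemma fcalc_continuous_real:
  assumes "continuous_on I f" obtains X where "fcalc (\<lambda>t. of_real (f t)) X"
proof -
  have "\<exists>g. real_polynomial_function g \<and> (\<forall>t\<in>I. \<bar>f t - g t\<bar> < 1 / real (Suc n))" for n
  proof -
    obtain g where "real_polynomial_function g" "\<And>t. t \<in> I \<Longrightarrow> \<bar>f t - g t\<bar> < 1 / real (Suc n)"
      by (rule Stone_Weierstrass_real_polynomial_function[OF compact_Icc assms, of "1 / real (Suc n)"], simp, rule that)
    then show ?thesis by blast
  qed
  then obtain g where g: "\<And>n. real_polynomial_function (g n)"
    "\<And>n t. t \<in> I \<Longrightarrow> \<bar>f t - g n t\<bar> < 1 / real (Suc n)" by metis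
  have "\<exists>X. fcalc (\<lambda>t. of_real (g n t)) X" for n
  proof -
    obtain a k where "g n = (\<lambda>x. \<Sum>i\<le>k. a i * x ^ i)" using g(1) real_polynomial_function_iff_sum by blast
    then have "fcalc (\<lambda>t. of_real (g n t)) (\<lambda>x. \<Sum>i<Suc k. complex_of_real (a i) *\<^sub>C (G ^^ i) x)"
      using poly[where n = "Suc k" and c = "\<lambda>i. of_real (a i)"] by (simp only: lessThan_Suc_atMost of_real_sum of_real_mult of_real_power)
    then show ?thesis by blast
  qed
  then obtain X where X: "\<And>n. fcalc (\<lambda>t. of_real (g n t)) (X n)" by metis
  obtain C where C: "\<And>t. t \<in> I \<Longrightarrow> \<bar>f t\<bar> \<le> C"
    using compact_imp_bounded[OF compact_continuous_image[OF assms compact_Icc]]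
    unfolding bounded_iff by (metis imageI real_norm_def)
  show thesis
  proof (rule fcalc_lim_ex[OF X, where \<psi> = "\<lambda>t. of_real (f t)" and B = "C + 1"])
    fix n t assume t: "t \<in> I"
    have "1 / real (Suc n) \<le> 1" by simp
    with g(2)[OF t, of n] have "\<bar>f t - g n t\<bar> < 1" by (rule less_le_trans)
    then show "norm (complex_of_real (g n t)) \<le> C + 1"
      using C[OF t] by simp
  next
    fix t assume t: "t \<in> I"
    have "(\<lambda>n. g n t - f t) \<longlonglongrightarrow> 0"
    proof (rule Lim_null_comparison)
      show "\<forall>\<^sub>F n in sequentially. norm (g n t - f t) \<le> 1 / real (Suc n)"
        using g(2)[OF t] by (intro always_eventually allI) (simp add: less_imp_le abs_minus_commute)
      show "(\<lambda>n. 1 / real (Suc n)) \<longlonglongrightarrow> 0"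
        using LIMSEQ_inverse_real_of_nat by (simp add: inverse_eq_divide)
    qed
    then show "(\<lambda>n. complex_of_real (g n t)) \<longlonglongrightarrow> complex_of_real (f t)"
      by (intro tendsto_of_real) (rule LIM_zero_cancel)
  qed (rule that)
qed

lemma fcalc_continuous:
  assumes "continuous_on I f" obtains X where "fcalc f X"
proof -
  obtain X where X: "fcalc (\<lambda>t. of_real (Re (f t))) X"
    using fcalc_continuous_real[OF continuous_on_Re[OF assms]] by blast
  obtain Y where Y: "fcalc (\<lambda>t. of_real (Im (f t))) Y"
    using fcalc_continuous_real[OF continuous_on_Im[OF assms]] by blast
  have "(\<lambda>t. of_real (Re (f t)) + \<i> * of_real (Im (f t))) = f"
    by (rule ext) (simp only: complex_eq[symmetric])
  with fcalc_add[OF X fcalc_scale[OF Y, of \<i>]] that show thesis by simp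
qed

text \<open>The relation \<open>fcalc\<close> is closed under limits of sequences only. One fixed
  sequence constructs \<open>Y\<close>, and every other sequence leads to the same \<open>Y\<close>
  because the limit symbol is the same.\<close>

lemma fcalc_tendsto_at_right:
  assumes X: "\<And>i. 0 < i \<Longrightarrow> i < d \<Longrightarrow> fcalc (\<phi> i) (X i)"
    and B: "\<And>i t. 0 < i \<Longrightarrow> i < d \<Longrightarrow> t \<in> I \<Longrightarrow> norm (\<phi> i t) \<le> B"
    and l: "\<And>t. t \<in> I \<Longrightarrow> ((\<lambda>i. \<phi> i t) \<longlongrightarrow> \<psi> t) (at_right 0)" and d: "(0::real) < d"
  obtains Y where "fcalc \<psi> Y" "\<And>x. ((\<lambda>i. X i x) \<longlongrightarrow> Y x) (at_right 0)"
proof -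
  have seq: "(\<lambda>n. \<phi> (S n) t) \<longlonglongrightarrow> \<psi> t" if "\<And>n. 0 < S n" "S \<longlonglongrightarrow> 0" "t \<in> I" for S :: "nat \<Rightarrow> real" and t
  proof (rule filterlim_compose[OF l[OF that(3)]])
    have "S n \<in> {0<..} \<and> S n \<noteq> 0" for n using that(1)[of n] by simp
    then show "filterlim S (at_right 0) sequentially"
      using that(2) by (simp add: filterlim_at)
  qed
  define S0 where "S0 n = d / 2 / real (Suc n)" for n
  have S0: "0 < S0 n" "S0 n < d" for n 
    using d by (auto simp: S0_def divide_simps intro: less_le_trans[of _ "2 * d"])
  have S0l: "S0 \<longlonglongrightarrow> 0"
    unfolding S0_def using tendsto_mult[OF tendsto_const LIMSEQ_inverse_real_of_nat, of "d / 2"]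
    by (simp add: inverse_eq_divide)
  obtain Y where Y: "fcalc \<psi> Y"
    by (rule fcalc_lim_ex[of "\<lambda>n. \<phi> (S0 n)" "\<lambda>n. X (S0 n)" B \<psi>]) (use X B S0 S0l seq in auto)
  have "((\<lambda>i. X i x) \<longlongrightarrow> Y x) (at_right 0)" for x
  proof (rule tendsto_at_right_sequentially[OF d])
    fix S :: "nat \<Rightarrow> real" assume S: "\<And>n. 0 < S n" "\<And>n. S n < d" "S \<longlonglongrightarrow> 0"
    show "(\<lambda>n. X (S n) x) \<longlonglongrightarrow> Y x"
      by (rule fcalc_tendsto[of "\<lambda>n. \<phi> (S n)" "\<lambda>n. X (S n)" B \<psi>]) (use X B S seq Y in auto)
  qed
  with Y show thesis by (rule that)
qed

lemma fcalc_tendsto_at_top: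
  assumes X: "\<And>i. fcalc (\<phi> i) (X i)"
    and B: "\<And>i t. t \<in> I \<Longrightarrow> norm (\<phi> i t) \<le> B"
    and l: "\<And>t. t \<in> I \<Longrightarrow> ((\<lambda>i. \<phi> i t) \<longlongrightarrow> \<psi> t) (at_top :: real filter)"
  obtains Y where "fcalc \<psi> Y" "\<And>x. ((\<lambda>i. X i x) \<longlongrightarrow> Y x) at_top"
proof -
  obtain Y where Y: "fcalc \<psi> Y"
    by (rule fcalc_lim_ex[of "\<lambda>n. \<phi> (real n)" "\<lambda>n. X (real n)" B \<psi>])
      (use X B filterlim_compose[OF l filterlim_real_sequentially] in auto)
  have "((\<lambda>i. X i x) \<longlongrightarrow> Y x) at_top" for x
  proof (rule tendsto_at_topI_sequentially)
    fix S :: "nat \<Rightarrow> real" assume S: "filterlim S at_top sequentially"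
    show "(\<lambda>n. X (S n) x) \<longlonglongrightarrow> Y x"
      by (rule fcalc_tendsto[of "\<lambda>n. \<phi> (S n)" "\<lambda>n. X (S n)" B \<psi>])
        (use X B Y filterlim_compose[OF l S] in auto)
  qed
  with Y show thesis by (rule that)
qed

end

section \<open>Positive square roots\<close>

definition positive :: "('h::chilbert_space \<Rightarrow> 'h) \<Rightarrow> bool"
  where "positive X \<longleftrightarrow> hermitian X \<and> (\<forall>x. 0 \<le> inner (X x) x)"

lemma hermitian_bound_ex:
  assumes "hermitian G" obtains m where "hermitian_bound G m"
  using bounded_clinear_bound[OF hermitian_bounded_clinear[OF assms]] assms
  by (metis hermitian_bound.intro)

text \<open>The interval \<open>I\<close> reaches into the negative numbers, so the root is taken of
  \<open>max 0 t\<close>, and its square is \<open>P\<close> only once the negative part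
  \<open>N\<close> of \<open>P\<close> is known to vanish. Positivity of \<open>P\<close> tested on
  the vectors \<open>N x\<close> shows this.\<close>

lemma positive_sqrt:
  assumes P: "positive P"
  obtains Z where "positive Z" "\<And>x. Z (Z x) = P x"
    "\<And>C x. bounded_clinear C \<Longrightarrow> (\<And>x. C (P x) = P (C x)) \<Longrightarrow> C (Z x) = Z (C x)"
proof -
  obtain m where "hermitian_bound P m" using hermitian_bound_ex P by (auto simp: positive_def)
  then interpret hermitian_bound P m .
  obtain Z where Z: "fcalc (\<lambda>t. of_real (sqrt (max 0 t))) Z"
    by (rule fcalc_continuous_real[of "\<lambda>t. sqrt (max 0 t)"]) (intro continuous_intros, rule that)
  obtain N where N: "fcalc (\<lambda>t. of_real (max 0 (- t))) N"
    by (rule fcalc_continuous_real[of "\<lambda>t. max 0 (- t)"]) (intro continuous_intros, rule that)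
  have "N x = 0" for x
  proof -
    have PN: "fcalc (\<lambda>t. of_real t * of_real (max 0 (- t))) (\<lambda>x. P (N x))" by (rule fcalc_G[OF N])
    \<comment> \<open>Where the negative part is non-zero, \<open>t\<close> is minus that part,
      which produces the cube with a minus sign.\<close>
    have "cinner (P (N x)) (N x) = (\<integral>t. complex_of_real (- ((max 0 (- t)) ^ 3)) \<partial>spectral_measure x)"
      unfolding fcalc_cinner[OF PN N]
      by (rule Bochner_Integration.integral_cong[OF refl]) (auto simp: max_def power3_eq_cube)
    then have "cinner (P (N x)) (N x) = of_real (- (\<integral>t. (max 0 (- t)) ^ 3 \<partial>spectral_measure x))"
      by (simp only: integral_complex_of_real Bochner_Integration.integral_minus)
    moreover have "0 \<le> Re (cinner (P (N x)) (N x))"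
      using P by (simp add: positive_def inner_eq_Re_cinner)
    moreover have "0 \<le> (\<integral>t. (max 0 (- t)) ^ 3 \<partial>spectral_measure x)" by (intro integral_nonneg_AE AE_I2) simp
    ultimately have "(\<integral>t. (max 0 (- t)) ^ 3 \<partial>spectral_measure x) = 0" by simp
    moreover have "integrable (spectral_measure x) (\<lambda>t. (max 0 (- t)) ^ 3)"
    proof (rule finite_measure.integrable_const_bound[OF finite_spectral_measure, where B = "m ^ 3"])
      show "(\<lambda>t. (max 0 (- t)) ^ 3) \<in> borel_measurable (spectral_measure x)"
        unfolding measurable_spectral by (intro measurable_restrict_space1) measurable
      show "AE t in spectral_measure x. norm ((max 0 (- t)) ^ 3) \<le> m ^ 3"
        by (rule AE_I2) (auto simp: space_spectral_measure norm_power intro!: power_mono)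
    qed
    ultimately have "AE t in spectral_measure x. (max 0 (- t)) ^ 3 = 0"
      by (subst (asm) integral_nonneg_eq_0_iff_AE) simp_all
    then have "AE t in spectral_measure x. (norm (complex_of_real (max 0 (- t))))\<^sup>2 = 0"
      by (rule AE_mp) (auto intro!: AE_I2)
    then have "(\<integral>t. (norm (complex_of_real (max 0 (- t))))\<^sup>2 \<partial>spectral_measure x) = 0"
      by (rule integral_eq_zero_AE)
    then show ?thesis using fcalc_norm[OF N, of x] by simp
  qed
  then have N0: "N = (\<lambda>_. 0)" by auto
  have "fcalc (\<lambda>t. of_real (sqrt (max 0 t)) * of_real (sqrt (max 0 t)) + (-1) * of_real (max 0 (- t)))
      (\<lambda>x. Z (Z x) + (-1) *\<^sub>C N x)"
    by (rule fcalc_add[OF fcalc_mult[OF Z Z] fcalc_scale[OF N]])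
  then have ZZ: "(\<lambda>x. Z (Z x) + (-1) *\<^sub>C N x) = P"
    by (rule fcalc_unique[OF _ fcalc_self]) (auto simp: max_def simp flip: of_real_mult)
  have "Z (Z x) = P x" for x using fun_cong[OF ZZ, of x] by (simp add: N0)
  moreover have "hermitian Z" by (rule fcalc_hermitian[OF Z]) simp
  then have "positive Z" using fcalc_nonneg[OF Z] by (simp add: positive_def)
  moreover have "C (Z x) = Z (C x)" if "bounded_clinear C" "\<And>x. C (P x) = P (C x)" for C x
    by (rule fcalc_commute[OF Z that])
  ultimately show thesis using that by blast
qed

lemma positive_sqrt_ex:
  assumes "positive P"
  shows "\<exists>Z. positive Z \<and> (\<forall>x. Z (Z x) = P x) \<and>
    (\<forall>C. bounded_clinear C \<longrightarrow> (\<forall>x. C (P x) = P (C x)) \<longrightarrow> (\<forall>x. C (Z x) = Z (C x)))"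
proof (rule positive_sqrt[OF assms])
  fix Z assume "positive Z" "\<And>x. Z (Z x) = P x"
    "\<And>C x. bounded_clinear C \<Longrightarrow> (\<And>x. C (P x) = P (C x)) \<Longrightarrow> C (Z x) = Z (C x)"
  then show ?thesis by blast
qed

text \<open>With \<open>V\<close> a positive root of \<open>Z\<close>, the hypothesis says that
  \<open>V y\<close> has norm zero.\<close>

lemma positive_eq_0:
  assumes Z: "positive Z" and "inner (Z y) y = 0" shows "Z y = 0"
proof -
  obtain V where V: "positive V" "\<And>x. V (V x) = Z x" by (rule positive_sqrt[OF Z], rule that)
  have h: "hermitian V" using V(1) by (simp add: positive_def)
  have "cinner (V (V y)) y = cinner (V y) (V y)" by (rule hermitianD[OF h])
  then have "inner (V y) (V y) = 0" using assms(2) by (simp add: V(2) inner_eq_Re_cinner)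
  then show ?thesis using V(2)[of y] bounded_clinearD(4)[OF hermitian_bounded_clinear[OF h]] by simp
qed

text \<open>Both roots are compared with the constructed root \<open>W\<close>, which commutes with
  every bounded operator that commutes with the square, in particular with any other root
  \<open>V\<close>. Then \<open>(V + W) (V - W) = 0\<close>, and positivity makes \<open>V\<close>
  and \<open>W\<close> vanish separately on the vector \<open>V x - W x\<close>.\<close>

lemma positive_sqrt_unique:
  assumes Z: "positive Z" and Y: "positive Y" and eq: "\<And>x. Z (Z x) = Y (Y x)"
  shows "Z = Y"
proof -
  have P: "positive (\<lambda>x. Y (Y x))"
    using Y by (simp add: positive_def hermitian_def inner_eq_Re_cinner cinner_self)
  obtain W where W: "positive W" "\<And>x. W (W x) = Y (Y x)"
    "\<And>C x. bounded_clinear C \<Longrightarrow> (\<And>x. C (Y (Y x)) = Y (Y (C x))) \<Longrightarrow> C (W x) = W (C x)"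
    using positive_sqrt[OF P] by blast
  have "V = W" if V: "positive V" "\<And>x. V (V x) = Y (Y x)" for V
  proof
    fix x
    have hV: "hermitian V" "hermitian W" using V(1) W(1) by (auto simp: positive_def)
    note lin = bounded_clinearD[OF hermitian_bounded_clinear[OF hV(1)]]
      bounded_clinearD[OF hermitian_bounded_clinear[OF hV(2)]]
    have "V (Y (Y x)) = Y (Y (V x))" for x by (simp only: V(2)[symmetric])
    then have comm: "V (W x) = W (V x)" for x by (intro W(3) hermitian_bounded_clinear hV)
    define y where "y = V x - W x"
    have "V y + W y = 0" by (simp add: y_def lin comm V(2) W(2))
    then have "inner (V y) y + inner (W y) y = 0" by (simp add: inner_add_left[symmetric])
    moreover have "0 \<le> inner (V y) y" "0 \<le> inner (W y) y" using V(1) W(1) by (auto simp: positive_def)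
    ultimately have "inner (V y) y = 0" "inner (W y) y = 0" by linarith+
    then have "V y = 0" "W y = 0" using positive_eq_0 V(1) W(1) by blast+
    then have "cinner y y = 0"
      unfolding y_def using hermitianD[OF hV(1)] hermitianD[OF hV(2)]
      by (simp add: cinner_diff_left lin)
    then show "V x = W x" by (simp add: cinner_self y_def)
  qed
  from this[OF Z eq] this[OF Y refl] show ?thesis by simp
qed

section \<open>Krein spaces in coordinates\<close>

lemma bounded_clinear_inj_iff:
  assumes "bounded_clinear S" shows "inj S \<longleftrightarrow> (\<forall>x. S x = 0 \<longrightarrow> x = 0)"
proof
  assume "inj S"
  then show "\<forall>x. S x = 0 \<longrightarrow> x = 0" by (metis assms bounded_clinearD(4) injD)
next
  assume *: "\<forall>x. S x = 0 \<longrightarrow> x = 0"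
  show "inj S"
  proof (rule injI)
    fix x y assume "S x = S y"
    then have "S (x - y) = 0" by (simp add: bounded_clinearD(2)[OF assms])
    with * have "x - y = 0" by blast
    then show "x = y" by simp
  qed
qed

lemma fundamental_decomposition_facts:
  assumes q: "sesquilinear_on K q" "symmetric_on K q" and fd: "fundamental_decomposition K q Kp Km"
  shows "Kp \<subseteq> K" "Km \<subseteq> K" "hilbert_space_on Kp q" "hilbert_space_on Km (\<lambda>x y. - q x y)"
    "\<And>p n. p \<in> Kp \<Longrightarrow> n \<in> Km \<Longrightarrow> q p n = 0 \<and> q n p = 0"
    "\<And>x. x \<in> K \<Longrightarrow> \<exists>p\<in>Kp. \<exists>n\<in>Km. x = p + n"
    "\<And>p n. p \<in> Kp \<Longrightarrow> n \<in> Km \<Longrightarrow> projection_along Kp Km (p + n) = p"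
    "\<And>p n. p \<in> Kp \<Longrightarrow> n \<in> Km \<Longrightarrow> projection_along Km Kp (p + n) = n"
proof -
  have K: "K = {x + y |x y. x \<in> Kp \<and> y \<in> Km}" and int: "Kp \<inter> Km = {0}"
    and orth: "\<forall>x\<in>Kp. \<forall>y\<in>Km. q x y = 0"
    and H: "hilbert_space_on Kp q" "hilbert_space_on Km (\<lambda>x y. - q x y)"
    using fd by (simp_all add: fundamental_decomposition_def)
  show "hilbert_space_on Kp q" "hilbert_space_on Km (\<lambda>x y. - q x y)" by fact+
  interpret P: prehilbert_on Kp q using H(1) by (simp add: hilbert_space_on_iff)
  interpret N: prehilbert_on Km "\<lambda>x y. - q x y" using H(2) by (simp add: hilbert_space_on_iff)
  show sub: "Kp \<subseteq> K" "Km \<subseteq> K"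
    unfolding K using P.K_0 N.K_0 by (force, force)
  show "q p n = 0 \<and> q n p = 0" if "p \<in> Kp" "n \<in> Km" for p n
  proof -
    have "q n p = cnj (q p n)" using q(2) that sub unfolding symmetric_on_def by blast
    then show ?thesis using orth that by simp
  qed
  show "\<exists>p\<in>Kp. \<exists>n\<in>Km. x = p + n" if "x \<in> K" for x using that unfolding K by blast
  have unique: "p = p' \<and> n = n'" if "p \<in> Kp" "n \<in> Km" "p' \<in> Kp" "n' \<in> Km" "p + n = p' + n'" for p n p' n'
  proof -
    have "p - p' = (p + n) - n - p'" by simp
    also have "\<dots> = n' - n" unfolding that(5) by simp
    finally have e: "p - p' = n' - n" .
    have "p - p' \<in> Kp" "n' - n \<in> Km" using that P.K_diff N.K_diff by blast+
    then have "p - p' \<in> Kp \<inter> Km" by (simp add: e)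
    then have "p - p' = 0" by (simp add: int)
    with e show ?thesis by simp
  qed
  show "projection_along Kp Km (p + n) = p" if "p \<in> Kp" "n \<in> Km" for p n
    unfolding projection_along_def
  proof (rule the_equality)
    fix y assume "y \<in> Kp \<and> p + n - y \<in> Km"
    then have "y \<in> Kp" "p + n - y \<in> Km" "y + (p + n - y) = p + n" by simp_all
    then show "y = p" using unique that by blast
  qed (use that in simp)
  show "projection_along Km Kp (p + n) = n" if "p \<in> Kp" "n \<in> Km" for p n
    unfolding projection_along_def
  proof (rule the_equality)
    fix y assume "y \<in> Km \<and> p + n - y \<in> Kp"
    then have "y \<in> Km" "p + n - y \<in> Kp" "(p + n - y) + y = p + n" by simp_all
    then show "y = n" using unique that by blast
  qed (use that in simp)
qed

text \<open>The decomposition chosen inside \<open>fundamental_symmetry\<close> is unpacked here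
  once. Later arguments use only these six facts, so they do not depend on the choice.\<close>

lemma krein_facts:
  assumes "krein_space K q"
  defines "F \<equiv> fundamental_symmetry K q" and "h \<equiv> krein_ip K q"
  shows "\<And>x. x \<in> K \<Longrightarrow> F x \<in> K" "\<And>x. x \<in> K \<Longrightarrow> F (F x) = x"
    "\<And>x y. x \<in> K \<Longrightarrow> y \<in> K \<Longrightarrow> F (x + y) = F x + F y"
    "\<And>c x. x \<in> K \<Longrightarrow> F (c *\<^sub>C x) = c *\<^sub>C F x"
    "\<And>x y. x \<in> K \<Longrightarrow> y \<in> K \<Longrightarrow> h x y = q (F x) y"
    "hilbert_space_on K h"
proof -
  have q: "sesquilinear_on K q" "symmetric_on K q"
    and ex: "\<exists>D. fundamental_decomposition K q (fst D) (snd D)"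
    using assms(1) by (auto simp: krein_space_def)
  define D where "D = (SOME (Kp, Km). fundamental_decomposition K q Kp Km)"
  obtain Kp Km where DD: "D = (Kp, Km)" by (cases D)
  have "case D of (Kp, Km) \<Rightarrow> fundamental_decomposition K q Kp Km"
    unfolding D_def using ex by (intro someI_ex[of "\<lambda>D. case D of (Kp, Km) \<Rightarrow> fundamental_decomposition K q Kp Km"]) 
      (simp add: case_prod_unfold)
  then have fd: "fundamental_decomposition K q Kp Km" by (simp add: DD)
  note f = fundamental_decomposition_facts[OF q fd]
  have F_def': "F x = projection_along Kp Km x - projection_along Km Kp x" for x
    unfolding F_def fundamental_symmetry_def D_def[symmetric] DD by simp
  have F: "F (p + n) = p - n" if "p \<in> Kp" "n \<in> Km" for p n
    using f(7,8)[OF that] by (simp add: F_def')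
  interpret P: prehilbert_on Kp q using f(3) by (simp add: hilbert_space_on_iff)
  interpret N: prehilbert_on Km "\<lambda>x y. - q x y" using f(4) by (simp add: hilbert_space_on_iff)
  have subsp: "csubspace K" using q by (simp add: sesquilinear_on_def)
  note K_add = complex_vector.subspace_add[OF subsp] and K_diff = complex_vector.subspace_diff[OF subsp]
    and K_scale = complex_vector.subspace_scale[OF subsp]
  have inK: "p \<in> K" "n \<in> K" if "p \<in> Kp" "n \<in> Km" for p n using f(1,2) that by blast+
  have minus: "- n \<in> Km" if "n \<in> Km" for n using N.K_diff[OF N.K_0 that] by simp
  have Fd: "\<exists>p n. p \<in> Kp \<and> n \<in> Km \<and> x = p + n \<and> F x = p - n" if "x \<in> K" for x
    using f(6)[OF that] F by blast
  show FK: "F x \<in> K" if "x \<in> K" for x using Fd[OF that] inK by (metis K_diff)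
  show FF: "F (F x) = x" if x: "x \<in> K" for x
  proof -
    obtain p n where pn: "p \<in> Kp" "n \<in> Km" "x = p + n" "F x = p - n" using Fd[OF x] by blast
    have "F (p + - n) = p - - n" using pn minus by (intro F)
    then show ?thesis using pn by simp
  qed
  show F_add: "F (x + y) = F x + F y" if x: "x \<in> K" and y: "y \<in> K" for x y
  proof -
    obtain p n where 1: "p \<in> Kp" "n \<in> Km" "x = p + n" "F x = p - n" using Fd[OF x] by blast
    obtain p' n' where 2: "p' \<in> Kp" "n' \<in> Km" "y = p' + n'" "F y = p' - n'" using Fd[OF y] by blast
    have "F ((p + p') + (n + n')) = (p + p') - (n + n')" using 1 2 by (intro F P.K_add N.K_add)
    moreover have "x + y = (p + p') + (n + n')" by (simp add: 1(3) 2(3) add_ac)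
    ultimately have "F (x + y) = (p + p') - (n + n')" by (simp only:)
    then show ?thesis by (simp add: 1(4) 2(4))
  qed
  show F_scale: "F (c *\<^sub>C x) = c *\<^sub>C F x" if x: "x \<in> K" for c x
  proof -
    obtain p n where 1: "p \<in> Kp" "n \<in> Km" "x = p + n" "F x = p - n" using Fd[OF x] by blast
    have "F (c *\<^sub>C p + c *\<^sub>C n) = c *\<^sub>C p - c *\<^sub>C n" using 1 by (intro F P.K_scale N.K_scale)
    then show ?thesis using 1 by (simp add: scaleC_add_right complex_vector.scale_right_diff_distrib)
  qed
  show h: "h x y = q (F x) y" for x y by (simp add: h_def F_def krein_ip_def)
  have q_add: "q (x + y) z = q x z + q y z" "q z (x + y) = q z x + q z y" if "x \<in> K" "y \<in> K" "z \<in> K" for x y z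
    using q(1) that by (simp_all add: sesquilinear_on_def)
  have q_scale: "q (c *\<^sub>C x) y = c * q x y" "q x (c *\<^sub>C y) = cnj c * q x y" if "x \<in> K" "y \<in> K" for x y c
    using q(1) that by (simp_all add: sesquilinear_on_def)
  have h_eq: "h (p + n) (p' + n') = q p p' + - q n n'"
    if "p \<in> Kp" "n \<in> Km" "p' \<in> Kp" "n' \<in> Km" for p n p' n'
  proof -
    have "q (p + (-1) *\<^sub>C n) (p' + n') = q p p' + - q n n'"
      using that inK f(5) by (simp add: q_add q_scale K_add K_scale del: complex_vector.scale_minus_left)
    then show ?thesis using that by (simp add: h F)
  qed
  have pre: "prehilbert_on K h"
  proof
    show "sesquilinear_on K h"
      unfolding sesquilinear_on_def h using subsp FK by (simp add: F_add F_scale q_add q_scale K_add K_scale)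
    show "symmetric_on K h"
      unfolding symmetric_on_def
    proof (intro ballI)
      fix x y assume x: "x \<in> K" and y: "y \<in> K"
      obtain p n where 1: "p \<in> Kp" "n \<in> Km" "x = p + n" using f(6)[OF x] by blast
      obtain p' n' where 2: "p' \<in> Kp" "n' \<in> Km" "y = p' + n'" using f(6)[OF y] by blast
      show "h x y = cnj (h y x)"
        using P.commute[of p p'] N.commute[of n n'] 1 2 by (simp add: h_eq)
    qed
    fix x assume x: "x \<in> K"
    obtain p n where 1: "p \<in> Kp" "n \<in> Km" "x = p + n" using f(6)[OF x] by blast
    have nn: "q p p \<in> \<real>\<^sub>\<ge>\<^sub>0" "- q n n \<in> \<real>\<^sub>\<ge>\<^sub>0" using P.nonneg[OF 1(1)] N.nonneg[OF 1(2)] .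
    then show "h x x \<in> \<real>\<^sub>\<ge>\<^sub>0" unfolding 1(3) h_eq[OF 1(1,2) 1(1,2)] by (rule nonneg_Reals_add_I)
    assume "h x x = 0"
    then have "q p p + - q n n = 0" using 1 by (simp add: h_eq)
    moreover obtain a where a: "q p p = of_real a" "0 \<le> a" using nn(1) by (rule nonneg_Reals_cases)
    moreover obtain b where b: "- q n n = of_real b" "0 \<le> b" using nn(2) by (rule nonneg_Reals_cases)
    ultimately have "complex_of_real (a + b) = 0" by simp
    then have "a + b = 0" by (simp only: of_real_eq_0_iff)
    with a(2) b(2) have "a = 0" "b = 0" by linarith+
    with a(1) b(1) have "q p p = 0" "- q n n = 0" by simp_all
    then have "p = 0" "n = 0" using P.definite[OF 1(1)] N.definite[OF 1(2)] by blast+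
    then show "x = 0" using 1(3) by simp
  qed
  interpret Kh: prehilbert_on K h by (rule pre)
  let ?N = "ip_norm (\<lambda>x y. - q x y)"
  \<comment> \<open>By Pythagoras a Cauchy sequence in \<open>K\<close> splits into Cauchy sequences
    of its two components, and completeness is inherited from the two Hilbert spaces.\<close>
  have nsq: "(ip_norm h (p + n))\<^sup>2 = (ip_norm q p)\<^sup>2 + (?N n)\<^sup>2" if "p \<in> Kp" "n \<in> Km" for p n
    using that inK by (simp add: Kh.norm_square P.norm_square N.norm_square h_eq K_add)
  have le: "ip_norm q p \<le> ip_norm h (p + n)" "?N n \<le> ip_norm h (p + n)"
    "ip_norm h (p + n) \<le> ip_norm q p + ?N n" if "p \<in> Kp" "n \<in> Km" for p n
  proof -
    have pK: "p + n \<in> K" using that inK K_add by blast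
    note nn = Kh.ip_norm_nonneg[OF pK] P.ip_norm_nonneg[OF that(1)] N.ip_norm_nonneg[OF that(2)]
    show "ip_norm q p \<le> ip_norm h (p + n)" "?N n \<le> ip_norm h (p + n)"
      by (rule power2_le_imp_le[OF _ nn(1)], simp add: nsq[OF that])+
    have "(ip_norm h (p + n))\<^sup>2 \<le> (ip_norm q p + ?N n)\<^sup>2"
      unfolding nsq[OF that] power2_sum using mult_nonneg_nonneg[OF nn(2,3)] by linarith
    then show "ip_norm h (p + n) \<le> ip_norm q p + ?N n"
      by (rule power2_le_imp_le) (use nn in linarith)
  qed
  have "Kh.mcomplete"
    unfolding Kh.mcomplete_iff
  proof (intro allI impI, elim conjE)
    fix \<sigma> :: "nat \<Rightarrow> 'a"
    assume \<sigma>: "range \<sigma> \<subseteq> K" and cau: "\<forall>e>0. \<exists>N. \<forall>m\<ge>N. \<forall>n\<ge>N. ip_norm h (\<sigma> m - \<sigma> n) < e"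
    have "\<exists>p n. p \<in> Kp \<and> n \<in> Km \<and> \<sigma> k = p + n" for k using f(6)[of "\<sigma> k"] \<sigma> by blast
    then obtain p n where pn: "\<And>k. p k \<in> Kp" "\<And>k. n k \<in> Km" "\<And>k. \<sigma> k = p k + n k" by metis

    have s: "\<sigma> i - \<sigma> j = (p i - p j) + (n i - n j)" for i j by (simp add: pn(3))
    have d: "p i - p j \<in> Kp" "n i - n j \<in> Km" for i j using P.K_diff[OF pn(1) pn(1)] N.K_diff[OF pn(2) pn(2)] .
    have "ip_norm q (p i - p j) \<le> ip_norm h (\<sigma> i - \<sigma> j)" "?N (n i - n j) \<le> ip_norm h (\<sigma> i - \<sigma> j)" for i j
      unfolding s using le d by blast+
    then have "\<forall>e>0. \<exists>N. \<forall>i\<ge>N. \<forall>j\<ge>N. ip_norm q (p i - p j) < e" "\<forall>e>0. \<exists>N. \<forall>i\<ge>N. \<forall>j\<ge>N. ?N (n i - n j) < e"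
      using cau by (meson le_less_trans)+
    moreover have "P.mcomplete" "N.mcomplete" using f(3,4) by (simp_all add: hilbert_space_on_iff)
    moreover have "range p \<subseteq> Kp" "range n \<subseteq> Km" using pn(1,2) by blast+
    ultimately obtain w v where w: "w \<in> Kp" "(\<lambda>i. ip_norm q (p i - w)) \<longlonglongrightarrow> 0"
      and v: "v \<in> Km" "(\<lambda>i. ?N (n i - v)) \<longlonglongrightarrow> 0"
      unfolding P.mcomplete_iff N.mcomplete_iff by metis
    have "(\<lambda>i. ip_norm h (\<sigma> i - (w + v))) \<longlonglongrightarrow> 0"
    proof (rule Lim_null_comparison)
      show "\<forall>\<^sub>F i in sequentially. norm (ip_norm h (\<sigma> i - (w + v))) \<le> ip_norm q (p i - w) + ?N (n i - v)"
      proof (rule always_eventually, rule allI)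
        fix i
        have e: "\<sigma> i - (w + v) = (p i - w) + (n i - v)" by (simp add: pn(3))
        have "p i - w \<in> Kp" "n i - v \<in> Km" using P.K_diff[OF pn(1) w(1)] N.K_diff[OF pn(2) v(1)] .
        then show "norm (ip_norm h (\<sigma> i - (w + v))) \<le> ip_norm q (p i - w) + ?N (n i - v)"
          unfolding e using le(3)[of "p i - w" "n i - v"] Kh.ip_norm_nonneg[of "(p i - w) + (n i - v)"] inK[of "p i - w" "n i - v"] K_add
          by simp
      qed
      show "(\<lambda>i. ip_norm q (p i - w) + ?N (n i - v)) \<longlonglongrightarrow> 0"
        using tendsto_add[OF w(2) v(2)] by simp
    qed
    moreover have "w + v \<in> K" using w v inK K_add by blast
    ultimately show "\<exists>w\<in>K. (\<lambda>i. ip_norm h (\<sigma> i - w)) \<longlonglongrightarrow> 0" by blast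
  qed
  with pre show "hilbert_space_on K h" by (simp add: hilbert_space_on_iff)
qed

text \<open>Continuity at \<open>0\<close> gives a radius \<open>r\<close> whose ball goes into the
  unit ball; rescaling \<open>x\<close> to norm \<open>r / 2\<close> turns this into a linear
  estimate.\<close>

lemma embedded_bound:
  assumes "krein_space K q" "continuously_embedded K q"
  obtains c where "c > 0" "\<And>x. x \<in> K \<Longrightarrow> norm x \<le> c * ip_norm (krein_ip K q) x"
proof -
  let ?h = "krein_ip K q"
  interpret prehilbert_on K ?h using krein_facts(6)[OF assms(1)] by (simp add: hilbert_space_on_iff)
  have "continuous_map mtopology euclidean (\<lambda>x. x)"
    using assms(2) by (simp add: continuously_embedded_def krein_topology_def ip_topology_eq)
  then have "\<exists>r>0. \<forall>x. x \<in> K \<and> ip_dist K ?h 0 x < r \<longrightarrow> x \<in> ball 0 1"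
    unfolding continuous_map_from_metric using K_0 by (auto dest!: bspec[of _ _ 0] spec[of _ "ball 0 1"])
  then obtain r where r: "r > 0" "\<And>x. x \<in> K \<Longrightarrow> ip_dist K ?h 0 x < r \<Longrightarrow> norm x < 1" by auto
  have "norm x \<le> 2 / r * ip_norm ?h x" if x: "x \<in> K" for x
  proof (cases "x = 0")
    case False
    define n where "n = ip_norm ?h x"
    have n: "n > 0" using ip_norm_nonneg[OF x] ip_norm_eq_0[OF x] False by (simp add: n_def)
    define y where "y = complex_of_real (r / (2 * n)) *\<^sub>C x"
    have y: "y \<in> K" using x K_scale by (simp add: y_def)
    have "ip_norm ?h y = r / 2" using n r(1) x by (simp add: y_def ip_norm_scale n_def[symmetric] norm_divide)
    then have "ip_dist K ?h 0 y < r"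
      using r(1) y K_0 ip_norm_minus[OF y K_0] by (simp add: ip_dist_def)
    then have "norm y < 1" using r(2) y by blast
    then have "r / (2 * n) * norm x < 1" using r(1) n by (simp add: y_def norm_scaleC norm_divide)
    then show ?thesis using r(1) n by (simp add: n_def[symmetric] field_simps)
  next
    case True
    then show ?thesis using ip_norm_nonneg[OF x] r(1) by simp
  qed
  then show thesis using r(1) by (intro that[of "2 / r"]) auto
qed

text \<open>Transports limits and closures in \<open>K\<close> to the norm topology of
  \<open>H\<close>, so that topological questions about \<open>K\<close> are settled in
  coordinates.\<close>

lemma homeomorphic_chart:
  assumes S: "bounded_clinear S" "inj S" "range S = K" and pre: "prehilbert_on K h"
    and up: "\<And>x. ip_norm h (S x) \<le> a * norm x" and low: "\<And>x. norm x \<le> b * ip_norm h (S x)"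
  shows "homeomorphic_maps euclidean (ip_topology K h) S (inv S)"
proof -
  interpret prehilbert_on K h by (rule pre)
  have SK: "S x \<in> K" for x using S(3) by blast
  have dist: "ip_dist K h (S x) (S y) = ip_norm h (S (x - y))" for x y
    by (simp add: ip_dist_def SK bounded_clinearD(2)[OF S(1)])
  have nn: "0 \<le> ip_norm h (S x)" for x by (rule ip_norm_nonneg[OF SK])
  have 1: "continuous_map euclidean mtopology S"
  proof -
    have "\<exists>\<delta>>0. \<forall>y. dist x y < \<delta> \<longrightarrow> ip_dist K h (S x) (S y) < \<epsilon>" if "\<epsilon> > 0" for x \<epsilon>
    proof (intro exI conjI allI impI)
      show "0 < \<epsilon> / (\<bar>a\<bar> + 1)" using that by simp
      fix y assume *: "dist x y < \<epsilon> / (\<bar>a\<bar> + 1)"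
      have "ip_norm h (S (x - y)) \<le> a * norm (x - y)" by (rule up)
      also have "\<dots> \<le> (\<bar>a\<bar> + 1) * norm (x - y)" by (intro mult_right_mono) auto
      also have "\<dots> < \<epsilon>" using * by (simp add: dist_norm field_simps)
      finally show "ip_dist K h (S x) (S y) < \<epsilon>" by (simp add: dist)
    qed
    then have "continuous_map Met_TC.mtopology mtopology S"
      unfolding Met_TC.metric_continuous_map[OF Metric_space_axioms] using SK by auto
    then show ?thesis by simp
  qed
  have inv: "inv S (S x) = x" for x using S(2) by simp
  have 2: "continuous_map mtopology euclidean (inv S)"
  proof -
    have "\<exists>\<delta>>0. \<forall>y. y \<in> K \<and> ip_dist K h x y < \<delta> \<longrightarrow> dist (inv S x) (inv S y) < \<epsilon>"
      if e: "\<epsilon> > 0" and x: "x \<in> K" for x \<epsilon>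
    proof (intro exI conjI allI impI)
      show "0 < \<epsilon> / (\<bar>b\<bar> + 1)" using e by simp
      fix y assume *: "y \<in> K \<and> ip_dist K h x y < \<epsilon> / (\<bar>b\<bar> + 1)"
      obtain u v where uv: "x = S u" "y = S v" using S(3) x * by blast
      have "norm (u - v) \<le> b * ip_norm h (S (u - v))" by (rule low)
      also have "\<dots> \<le> (\<bar>b\<bar> + 1) * ip_norm h (S (u - v))" by (intro mult_right_mono nn) auto
      also have "\<dots> < \<epsilon>" using * by (simp add: uv dist field_simps)
      finally show "dist (inv S x) (inv S y) < \<epsilon>" by (simp add: dist_norm uv inv)
    qed
    then have "continuous_map mtopology Met_TC.mtopology (inv S)"
      unfolding metric_continuous_map[OF Met_TC.Metric_space_axioms] by auto
    then show ?thesis by simp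
  qed
  have "S (inv S y) = y" if "y \<in> K" for y using that S(3) by (auto simp: f_inv_into_f)
  then show ?thesis unfolding homeomorphic_maps_def ip_topology_eq using 1 2 inv by simp
qed

text \<open>
  Every densely and continuously embedded Krein space is \<open>range S\<close> with inner product
  \<open>(J S\<^sup>-\<^sup>1 \<cdot>, S\<^sup>-\<^sup>1 \<cdot>)\<close>; here \<open>S\<^sup>2\<close> is the operator representing \<open>(\<cdot>, \<cdot>)\<close> in the Hilbert space \<open>(K, krein_ip K q)\<close>.
\<close>

lemma krein_chart:
  fixes K :: "'h::chilbert_space set"
  assumes kr: "krein_space K q" and emb: "continuously_embedded K q" and dense: "closure K = UNIV"
  obtains S J where "positive S" "inj S" "range S = K" "hermitian J" "\<And>x. J (J x) = x"
    "\<And>x y. q (S x) (S y) = cinner (J x) y" "\<And>x y. krein_ip K q (S x) (S y) = cinner x y"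
    "\<And>x. fundamental_symmetry K q (S x) = S (J x)"
    "homeomorphic_maps euclidean (krein_topology K q) S (inv S)"
proof -
  define h where "h = krein_ip K q"
  define F where "F = fundamental_symmetry K q"
  note kf = krein_facts[OF kr, folded h_def F_def]
  have q: "sesquilinear_on K q" "symmetric_on K q" using kr by (auto simp: krein_space_def)
  interpret prehilbert_on K h using kf(6) by (simp add: hilbert_space_on_iff)
  obtain c where c: "c > 0" "\<And>x. x \<in> K \<Longrightarrow> norm x \<le> c * ip_norm h x"
    using embedded_bound[OF kr emb] unfolding h_def by blast
  \<comment> \<open>The resulting map \<open>C\<close> is the adjoint of the embedding of
    \<open>K\<close> into \<open>H\<close>. Regarded as an operator in \<open>H\<close> it is
    positive, and \<open>S\<close> will be its square root.\<close>
  have "\<exists>w\<in>K. \<forall>x\<in>K. cinner x g = h x w" for g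
  proof (rule riesz_on[OF kf(6) subsp subset_refl, of "\<lambda>x. cinner x g" "c * norm g"])
    fix x assume x: "x \<in> K"
    show "norm (cinner x g) \<le> c * norm g * ip_norm h x"
      using norm_cinner_le[of x g] mult_right_mono[OF c(2)[OF x] norm_ge_zero[of g]] by (simp add: mult_ac)
  qed (auto simp: cinner_add_left cinner_scaleC_left)
  then obtain C where CK: "\<And>g. C g \<in> K" and C: "\<And>x g. x \<in> K \<Longrightarrow> cinner x g = h x (C g)" by metis
  have C': "cinner g x = h (C g) x" if "x \<in> K" for g x
    using C[OF that, of g] commute[OF CK that] by (metis cinner_commute)
  have hermC: "hermitian C" unfolding hermitian_def using C[OF CK] C'[OF CK] by metis
  have "0 \<le> inner (C g) g" for g
    using C[OF CK, of g g] norm_square[OF CK[of g]] by (metis inner_eq_Re_cinner zero_le_power2)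
  with hermC have "positive C" by (simp add: positive_def)
  then obtain S where S: "positive S" "\<And>x. S (S x) = C x" by (rule positive_sqrt) (rule that)
  have hS: "hermitian S" using S(1) by (simp add: positive_def)
  note bS = hermitian_bounded_clinear[OF hS]
  \<comment> \<open>A vector killed by \<open>S\<close> is killed by \<open>C\<close>, hence
    orthogonal to the dense set \<open>K\<close>.\<close>
  have injS: "inj S"
    unfolding bounded_clinear_inj_iff[OF bS]
  proof (intro allI impI)
    fix y assume "S y = 0"
    then have "C y = 0" using S(2)[of y] bounded_clinearD(4)[OF bS] by simp
    then have "cinner y x = cinner 0 x" if "x \<in> K" for x
      using C'[OF that, of y] C'[OF that, of 0] bounded_clinearD(4)[OF hermitian_bounded_clinear[OF hermC]] by simp
    then show "y = 0" by (rule eq_if_cinner_eq[OF dense])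
  qed
  have denseS: "closure (range S) = UNIV" by (rule hermitian_dense_range[OF hS injS])
  have inv: "inv S (S x) = x" for x using injS by simp
  have normC: "ip_norm h (C g) = norm (S g)" for g
  proof -
    have "h (C g) (C g) = cinner (S g) (S g)" using C[OF CK, of g g] hermitianD[OF hS, of "S g" g] S(2) by simp
    then show ?thesis by (simp add: ip_norm_def cinner_self)
  qed
  \<comment> \<open>Since \<open>C g\<close> has \<open>h\<close>-norm equal to the norm of
    \<open>S g\<close>, the functional \<open>S g\<close> to \<open>cinner g x\<close> is bounded by
    the \<open>h\<close>-norm of \<open>x\<close>. Its Riesz vector \<open>y\<close> is the
    coordinate of \<open>x\<close> and inherits the bound.\<close>
  have pre: "\<exists>y. S y = x \<and> norm y \<le> ip_norm h x" if x: "x \<in> K" for x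
  proof -
    have bound: "norm (cinner g x) \<le> ip_norm h x * norm (S g)" for g
      using norm_le[OF CK x, of g] by (simp add: C'[OF x] normC mult.commute)
    obtain y where y: "\<And>v. v \<in> range S \<Longrightarrow> cinner (inv S v) x = cinner v y"
    proof (rule riesz_on[OF hilbert_UNIV csubspace_range[OF bS], of "\<lambda>v. cinner (inv S v) x" "ip_norm h x"])
      fix u v assume "u \<in> range S" "v \<in> range S"
      then show "cinner (inv S (u + v)) x = cinner (inv S u) x + cinner (inv S v) x"
        by (auto simp: bounded_clinearD(1)[OF bS, symmetric] inv cinner_add_left)
    next
      fix d u assume "u \<in> range S"
      then show "cinner (inv S (d *\<^sub>C u)) x = d * cinner (inv S u) x"
        by (auto simp: bounded_clinearD(3)[OF bS, symmetric] inv cinner_scaleC_left)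
    next
      fix v assume "v \<in> range S"
      then show "norm (cinner (inv S v) x) \<le> ip_norm h x * ip_norm cinner v" using bound by (auto simp: inv)
    qed auto
    have Sy: "cinner (S g) y = cinner g x" for g using y[of "S g"] by (simp add: inv)
    have "S y = x" by (rule cinner_right_cancel) (metis Sy hermitianD[OF hS])
    moreover have "norm y \<le> ip_norm h x"
    proof -
      have "y \<in> closure (range S)" using denseS by simp
      then obtain s where s: "\<And>n. s n \<in> range S" "s \<longlonglongrightarrow> y" unfolding closure_sequential by blast
      have "norm (cinner y y) \<le> ip_norm h x * norm y"
      proof (rule LIMSEQ_le)
        show "(\<lambda>n. norm (cinner (s n) y)) \<longlonglongrightarrow> norm (cinner y y)"
          by (intro tendsto_norm tendsto_cinner tendsto_const s)
        show "(\<lambda>n. ip_norm h x * norm (s n)) \<longlonglongrightarrow> ip_norm h x * norm y"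
          by (intro tendsto_mult tendsto_const tendsto_norm s)
        have "norm (cinner (s n) y) \<le> ip_norm h x * norm (s n)" for n
        proof -
          obtain g where "s n = S g" using s(1)[of n] by auto
          then show ?thesis using bound[of g] Sy by simp
        qed
        then show "\<exists>N. \<forall>n\<ge>N. norm (cinner (s n) y) \<le> ip_norm h x * norm (s n)" by blast
      qed
      then show ?thesis using ip_norm_nonneg[OF x]
        by (cases "y = 0") (simp_all add: cinner_self power2_eq_square norm_mult)
    qed
    ultimately show ?thesis by blast
  qed
  then have sub: "K \<subseteq> range S" by blast
  have invK: "S (inv S x) = x" "norm (inv S x) \<le> ip_norm h x" if x: "x \<in> K" for x
    using pre[OF x] inv by auto
  \<comment> \<open>The converse inclusion: the functional \<open>x\<close> to
    \<open>cinner (inv S x) y\<close> is bounded on \<open>K\<close>, and its Riesz vector in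
    \<open>K\<close> turns out to be \<open>S y\<close>. The same identity makes \<open>S\<close>
    unitary from \<open>H\<close> onto \<open>K\<close>.\<close>
  have range: "S y \<in> K \<and> (\<forall>x\<in>K. cinner (inv S x) y = h x (S y))" for y
  proof (rule riesz_on[OF kf(6) subsp subset_refl, of "\<lambda>x. cinner (inv S x) y" "norm y"])
    fix u v assume uv: "u \<in> K" "v \<in> K"
    have "S (inv S (u + v)) = S (inv S u + inv S v)"
      using uv by (simp add: invK K_add bounded_clinearD(1)[OF bS])
    then have "inv S (u + v) = inv S u + inv S v" using injS by (simp add: inj_eq)
    then show "cinner (inv S (u + v)) y = cinner (inv S u) y + cinner (inv S v) y" by (simp add: cinner_add_left)
  next
    fix d u assume u: "u \<in> K"
    have "S (inv S (d *\<^sub>C u)) = S (d *\<^sub>C inv S u)"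
      using u by (simp add: invK K_scale bounded_clinearD(3)[OF bS])
    then have "inv S (d *\<^sub>C u) = d *\<^sub>C inv S u" using injS by (simp add: inj_eq)
    then show "cinner (inv S (d *\<^sub>C u)) y = d * cinner (inv S u) y" by (simp add: cinner_scaleC_left)
  next
    fix x assume x: "x \<in> K"
    show "norm (cinner (inv S x) y) \<le> norm y * ip_norm h x"
      using norm_cinner_le[of "inv S x" y] mult_right_mono[OF invK(2)[OF x] norm_ge_zero[of y]] by (simp add: mult_ac)
  next
    fix w assume w: "w \<in> K" "\<And>x. x \<in> K \<Longrightarrow> cinner (inv S x) y = h x w"
    have "S y = w"
    proof (rule cinner_right_cancel)
      fix g
      have "cinner (S g) y = h (C g) w" using w(2)[OF CK, of g] by (simp add: S(2)[symmetric] inv)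
      also have "\<dots> = cinner g w" by (rule C'[OF w(1), symmetric])
      finally show "cinner g (S y) = cinner g w" by (simp add: hermitianD[OF hS])
    qed
    with w show ?thesis by simp
  qed
  then have rangeS: "range S = K" using sub by blast
  have SK: "S x \<in> K" for x using range by blast
  have hS': "h (S x) (S y) = cinner x y" for x y using range[of y] SK[of x] by (metis inv)
  define J where "J y = inv S (F (S y))" for y
  have SJ: "S (J y) = F (S y)" for y unfolding J_def by (rule invK(1)[OF kf(1)[OF SK]])
  have qJ: "q (S x) (S y) = cinner (J x) y" for x y
  proof -
    have "q (S x) (S y) = q (F (F (S x))) (S y)" by (simp add: kf(2) SK)
    also have "\<dots> = h (S (J x)) (S y)" by (simp add: kf(5)[OF kf(1)] SK SJ)
    finally show ?thesis by (simp add: hS')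
  qed
  have "J (J x) = x" for x
  proof -
    have "S (J (J x)) = S x" by (simp add: SJ kf(2) SK)
    then show ?thesis using injS by (simp add: inj_eq)
  qed
  moreover have "hermitian J"
    unfolding hermitian_def
  proof (intro allI)
    fix x y
    have "q (S x) (S y) = cnj (q (S y) (S x))" using q(2) SK unfolding symmetric_on_def by blast
    then show "cinner (J x) y = cinner x (J y)" by (metis qJ cinner_commute)
  qed
  moreover have "homeomorphic_maps euclidean (krein_topology K q) S (inv S)"
    unfolding krein_topology_def h_def[symmetric]
    by (rule homeomorphic_chart[OF bS injS rangeS prehilbert_on_axioms, of 1 1])
      (simp_all add: ip_norm_def hS' cinner_self)
  ultimately show thesis
    using that[of S J] S(1) injS rangeS qJ hS' SJ by (simp add: h_def F_def)
qed

lemma hilbert_space_on_image: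
  fixes S :: "'h::chilbert_space \<Rightarrow> 'h"
  assumes S: "bounded_clinear S" "inj S" and M: "csubspace M" "closed M"
    and q: "\<And>x y. x \<in> M \<Longrightarrow> y \<in> M \<Longrightarrow> q (S x) (S y) = cinner x y"
  shows "hilbert_space_on (S ` M) q"
proof -
  note lin = bounded_clinearD[OF S(1)]
  note M_sub = complex_vector.subspace_add[OF M(1)] complex_vector.subspace_scale[OF M(1)]
    complex_vector.subspace_0[OF M(1)] complex_vector.subspace_diff[OF M(1)]
  have qadd: "q (S x + S y) (S z) = q (S x) (S z) + q (S y) (S z) \<and> q (S z) (S x + S y) = q (S z) (S x) + q (S z) (S y)"
    if "x \<in> M" "y \<in> M" "z \<in> M" for x y z
    using that M_sub by (simp add: lin(1)[symmetric] q cinner_add_left cinner_add_right)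
  have qscale: "q (c *\<^sub>C S x) (S y) = c * q (S x) (S y) \<and> q (S x) (c *\<^sub>C S y) = cnj c * q (S x) (S y)"
    if "x \<in> M" "y \<in> M" for x y c
    using that M_sub by (simp add: lin(3)[symmetric] q cinner_scaleC_left cinner_scaleC_right)
  have sub: "csubspace (S ` M)"
    by (rule complex_vector.subspaceI)
      (use lin(4) M_sub(3) in force, auto simp: lin(1,3)[symmetric] intro!: imageI M_sub)
  interpret prehilbert_on "S ` M" q
  proof
    show "sesquilinear_on (S ` M) q"
      unfolding sesquilinear_on_def using sub qadd qscale by blast
    show "symmetric_on (S ` M) q"
      unfolding symmetric_on_def by (auto simp: q intro: cinner_commute)
  qed (auto simp: q cinner_self lin(4))
  have "mcomplete"
    unfolding mcomplete_iff
  proof (intro allI impI, elim conjE)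
    fix \<sigma> :: "nat \<Rightarrow> 'h"
    assume "range \<sigma> \<subseteq> S ` M" and cau: "\<forall>e>0. \<exists>N. \<forall>m\<ge>N. \<forall>n\<ge>N. ip_norm q (\<sigma> m - \<sigma> n) < e"
    then have "\<exists>a\<in>M. \<sigma> n = S a" for n by blast
    then obtain a where a: "\<And>n. a n \<in> M" "\<And>n. \<sigma> n = S (a n)" by metis
    have nrm: "ip_norm q (S x - S y) = norm (x - y)" if "x \<in> M" "y \<in> M" for x y
      using that M_sub by (simp add: lin(2)[symmetric] ip_norm_def q cinner_self)
    have "Cauchy a" using cau by (simp add: a nrm Cauchy_def dist_norm)
    then obtain b where b: "a \<longlonglongrightarrow> b" by (auto simp: Cauchy_convergent_iff convergent_def)
    then have bM: "b \<in> M" using M(2) a(1) closed_sequentially by blast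
    have "(\<lambda>n. ip_norm q (\<sigma> n - S b)) \<longlonglongrightarrow> 0"
      using b by (simp add: a nrm bM LIM_zero_iff tendsto_norm_zero_iff)
    then show "\<exists>w\<in>S ` M. (\<lambda>n. ip_norm q (\<sigma> n - w)) \<longlonglongrightarrow> 0" using bM by blast
  qed
  then show ?thesis by (simp add: hilbert_space_on_iff prehilbert_on_axioms)
qed

text \<open>The converse of \<open>krein_chart\<close>: the eigenspaces of \<open>J\<close> for
  \<open>1\<close> and \<open>-1\<close> give a fundamental decomposition. However,
  \<open>fundamental_symmetry\<close> may choose another one, so the norm of \<open>krein_ip\<close>
  is only equivalent to the norm transported by \<open>S\<close>, and both bounds have to be
  established.\<close>

lemma krein_space_chart:
  fixes S :: "'h::chilbert_space \<Rightarrow> 'h"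
  assumes S: "bounded_clinear S" "inj S" and J: "hermitian J" "\<And>x. J (J x) = x"
    and q: "\<And>x y. q (S x) (S y) = cinner (J x) y" and z: "zero_outside (range S) q"
  shows "krein_space (range S) q" "continuously_embedded (range S) q"
    "homeomorphic_maps euclidean (krein_topology (range S) q) S (inv S)"
proof -
  note lin = bounded_clinearD[OF S(1)] and bJ = hermitian_bounded_clinear[OF J(1)]
  note Jlin = bounded_clinearD[OF bJ]
  define Mp where "Mp = {x. J x = x}"
  define Mm where "Mm = {x. J x = - x}"
  have cl: "closed Mp" "closed Mm"
    unfolding Mp_def Mm_def
    by (intro closed_Collect_eq continuous_on_minus continuous_on_id bounded_clinear_continuous bJ)+
  have sub: "csubspace Mp" "csubspace Mm"
    by (auto intro!: complex_vector.subspaceI simp: Mp_def Mm_def Jlin)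
  have sesq: "sesquilinear_on (range S) q"
  proof -
    have "q (S x + S y) (S w) = q (S x) (S w) + q (S y) (S w) \<and> q (S w) (S x + S y) = q (S w) (S x) + q (S w) (S y)" for x y w
      by (simp add: lin(1)[symmetric] q Jlin cinner_add_left cinner_add_right)
    moreover have "q (c *\<^sub>C S x) (S y) = c * q (S x) (S y) \<and> q (S x) (c *\<^sub>C S y) = cnj c * q (S x) (S y)" for x y c
      by (simp add: lin(3)[symmetric] q Jlin cinner_scaleC_left cinner_scaleC_right)
    ultimately show ?thesis unfolding sesquilinear_on_def using csubspace_range[OF S(1)] by blast
  qed
  have sym: "symmetric_on (range S) q"
    unfolding symmetric_on_def by (auto simp: q) (metis hermitianD[OF J(1)] cinner_commute)
  have Hp: "hilbert_space_on (S ` Mp) q"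
    by (rule hilbert_space_on_image[OF S sub(1) cl(1)]) (simp add: q Mp_def)
  have Hm: "hilbert_space_on (S ` Mm) (\<lambda>x y. - q x y)"
    by (rule hilbert_space_on_image[OF S sub(2) cl(2)]) (simp add: q Mm_def cinner_minus_left)
  have "fundamental_decomposition (range S) q (S ` Mp) (S ` Mm)"
    unfolding fundamental_decomposition_def
  proof (intro conjI Hp Hm ballI)
    show "range S = {x + y |x y. x \<in> S ` Mp \<and> y \<in> S ` Mm}"
    proof (intro equalityI subsetI)
      fix v assume "v \<in> range S"
      then obtain x where v: "v = S x" by blast
      let ?p = "(1/2) *\<^sub>R (x + J x)" and ?n = "(1/2) *\<^sub>R (x - J x)"
      have "?p \<in> Mp" "?n \<in> Mm" by (simp_all add: Mp_def Mm_def Jlin J(2) algebra_simps)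
      moreover have "v = S ?p + S ?n" by (simp add: v lin(1)[symmetric] scaleR_add_right[symmetric] scaleR_2[symmetric])
      ultimately show "v \<in> {x + y |x y. x \<in> S ` Mp \<and> y \<in> S ` Mm}" by blast
    next
      fix v assume "v \<in> {x + y |x y. x \<in> S ` Mp \<and> y \<in> S ` Mm}"
      then show "v \<in> range S" by (auto simp: lin(1)[symmetric])
    qed
    show "S ` Mp \<inter> S ` Mm = {0}"
    proof (intro equalityI subsetI)
      fix v assume "v \<in> S ` Mp \<inter> S ` Mm"
      then obtain x y where "v = S x" "v = S y" "x \<in> Mp" "y \<in> Mm" by blast
      then have "x = y" "J x = x" "J y = - y" using S(2) by (auto simp: inj_eq Mp_def Mm_def)
      then have "x + x = 0" by (metis add.right_inverse)
      then have "x = 0" by (simp add: scaleR_2[symmetric])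
      then show "v \<in> {0}" using \<open>v = S x\<close> lin(4) by simp
    next
      fix v :: 'h assume "v \<in> {0}"
      then have "v = S 0" "(0::'h) \<in> Mp" "(0::'h) \<in> Mm" by (auto simp: lin(4) Mp_def Mm_def Jlin)
      then show "v \<in> S ` Mp \<inter> S ` Mm" by blast
    qed
    fix u v assume "u \<in> S ` Mp" "v \<in> S ` Mm"
    then obtain x y where xy: "u = S x" "v = S y" "J x = x" "J y = - y" by (auto simp: Mp_def Mm_def)
    have "cinner x y = cinner x (- y)" using hermitianD[OF J(1), of x y] xy by simp
    then have "cinner x y = 0" by (simp add: cinner_minus_right)
    then show "q u v = 0" using xy by (simp add: q)
  qed
  then show kr: "krein_space (range S) q" using sesq sym z by (auto simp: krein_space_def)
  define h where "h = krein_ip (range S) q"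
  define F where "F = fundamental_symmetry (range S) q"
  note kf = krein_facts[OF kr, folded h_def F_def]
  interpret prehilbert_on "range S" h using kf(6) by (simp add: hilbert_space_on_iff)
  \<comment> \<open>The chosen fundamental symmetry in the coordinates of \<open>S\<close>; it need
    not be \<open>J\<close>. The Gram operator of \<open>krein_ip\<close> in these coordinates is
    \<open>J L\<close>.\<close>
  define L where "L y = inv S (F (S y))" for y
  have SL: "S (L y) = F (S y)" for y
    unfolding L_def using kf(1)[of "S y"] by (simp add: f_inv_into_f)
  have LL: "L (L y) = y" for y
  proof -
    have "S (L (L y)) = S y" by (simp add: SL kf(2))
    then show ?thesis using S(2) by (simp add: inj_eq)
  qed
  have hB: "h (S x) (S y) = cinner (J (L x)) y" for x y
    by (simp add: kf(5) SL[symmetric] q)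
  have hermB: "hermitian (\<lambda>x. J (L x))"
    unfolding hermitian_def using commute hB by (metis cinner_commute rangeI)
  have "positive (\<lambda>x. J (L x))"
    unfolding positive_def using hermB norm_square[of "S _"] hB by (metis inner_eq_Re_cinner rangeI zero_le_power2)
  then obtain Z where Z: "positive Z" "\<And>x. Z (Z x) = J (L x)" by (rule positive_sqrt) (rule that)
  have hZ: "hermitian Z" using Z(1) by (simp add: positive_def)
  have nZ: "ip_norm h (S x) = norm (Z x)" for x
  proof -
    have "h (S x) (S x) = cinner (Z x) (Z x)" using hermitianD[OF hZ, of "Z x" x] by (simp add: hB Z(2))
    then show ?thesis by (simp add: ip_norm_def cinner_self)
  qed
  obtain \<zeta> where \<zeta>: "\<zeta> > 0" "\<And>x. norm (Z x) \<le> \<zeta> * norm x"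
    using bounded_clinear_bound[OF hermitian_bounded_clinear[OF hZ]] by blast
  \<comment> \<open>The operator is \<open>L J\<close>, the inverse of the Gram operator
    \<open>J L\<close>. It is written as \<open>J (J L) J\<close> because \<open>J L\<close> and
    \<open>J\<close> are already known to be bounded.\<close>
  obtain \<beta> where \<beta>: "\<beta> > 0" "\<And>x. norm (J (J (L (J x)))) \<le> \<beta> * norm x"
    using bounded_clinear_bound[OF bounded_clinear_compose[OF bJ
        bounded_clinear_compose[OF hermitian_bounded_clinear[OF hermB] bJ]]] by blast
  have low: "norm x \<le> (\<beta> * \<zeta>) * ip_norm h (S x)" for x
  proof -
    have "norm x = norm (L (J (J (L x))))" by (simp add: J(2) LL)
    also have "\<dots> \<le> \<beta> * norm (J (L x))" using \<beta>(2)[of "J (L x)"] by (simp add: J(2))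
    also have "\<dots> = \<beta> * norm (Z (Z x))" by (simp add: Z(2))
    also have "\<dots> \<le> \<beta> * (\<zeta> * norm (Z x))" using \<beta>(1) \<zeta>(2) by (intro mult_left_mono) auto
    finally show ?thesis by (simp add: nZ mult.assoc)
  qed
  show hom: "homeomorphic_maps euclidean (krein_topology (range S) q) S (inv S)"
    unfolding krein_topology_def h_def[symmetric]
    by (rule homeomorphic_chart[OF S refl prehilbert_on_axioms _ low, of \<zeta>]) (simp add: nZ \<zeta>(2))
  have "continuous_map (krein_topology (range S) q) euclidean (S \<circ> inv S)"
    using hom bounded_clinear_continuous[OF S(1)]
    by (intro continuous_map_compose[of _ euclidean]) (auto simp: homeomorphic_maps_def)
  moreover have "topspace (krein_topology (range S) q) = range S"
    by (simp add: krein_topology_def h_def[symmetric] ip_topology_eq)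
  ultimately show "continuously_embedded (range S) q"
    unfolding continuously_embedded_def
    by (elim continuous_map_eq) (auto simp: f_inv_into_f)
qed

lemma topspace_krein_topology: "krein_space K q \<Longrightarrow> topspace (krein_topology K q) = K"
proof -
  assume "krein_space K q"
  from krein_facts(6)[OF this] interpret prehilbert_on K "krein_ip K q" by (simp add: hilbert_space_on_iff)
  show ?thesis by (simp add: krein_topology_def ip_topology_eq)
qed

lemma Hausdorff_krein_topology: "krein_space K q \<Longrightarrow> Hausdorff_space (krein_topology K q)"
proof -
  assume "krein_space K q"
  from krein_facts(6)[OF this] interpret prehilbert_on K "krein_ip K q" by (simp add: hilbert_space_on_iff)
  show ?thesis by (simp add: krein_topology_def ip_topology_eq Hausdorff_space_mtopology)
qed

lemma chart_limitin:
  assumes "homeomorphic_maps euclidean X S (inv S)" "inj S"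
  shows "limitin X (\<lambda>i. S (f i)) (S l) F \<longleftrightarrow> (f \<longlongrightarrow> l) F"
proof
  assume "limitin X (\<lambda>i. S (f i)) (S l) F"
  moreover have "continuous_map X euclidean (inv S)" using assms(1) by (simp add: homeomorphic_maps_def)
  ultimately have "limitin euclidean (inv S \<circ> (\<lambda>i. S (f i))) (inv S (S l)) F" by (intro continuous_map_limit)
  then show "(f \<longlongrightarrow> l) F" using assms(2) by (simp add: o_def)
next
  assume "(f \<longlongrightarrow> l) F"
  then have "limitin euclidean f l F" by simp
  moreover have "continuous_map euclidean X S" using assms(1) by (simp add: homeomorphic_maps_def)
  ultimately have "limitin X (S \<circ> f) (S l) F" by (intro continuous_map_limit)
  then show "limitin X (\<lambda>i. S (f i)) (S l) F" by (simp add: o_def)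
qed

lemma chart_closure_of:
  assumes "homeomorphic_maps euclidean X S (inv S)"
  shows "X closure_of (S ` D) = S ` closure D"
proof -
  have "homeomorphic_map euclidean X S" using assms homeomorphic_map_maps by blast
  from homeomorphic_map_closure_of[OF this, of D] show ?thesis by simp
qed

section \<open>Inverses of bounded hermitian operators\<close>

definition inv_map :: "('h::chilbert_space \<Rightarrow> 'h) \<Rightarrow> ('h \<rightharpoonup> 'h)"
  where "inv_map P = (\<lambda>u. if u \<in> range P then Some (inv P u) else None)"

lemma dom_inv_map: "dom (inv_map P) = range P"
  by (auto simp: inv_map_def dom_def split: if_splits)

lemma inv_map_apply: "inj P \<Longrightarrow> inv_map P (P x) = Some x"
  by (simp add: inv_map_def)

lemma inv_map_eq_Some: "inj P \<Longrightarrow> inv_map P u = Some x \<longleftrightarrow> u = P x"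
  by (auto simp: inv_map_def f_inv_into_f)

lemma map_eq_inv_mapI:
  assumes "inj P" "\<And>x. R (P x) = Some x" "\<And>u. u \<in> dom R \<Longrightarrow> u \<in> range P"
  shows "R = inv_map P"
proof
  fix u
  show "R u = inv_map P u"
  proof (cases "u \<in> range P")
    case True
    then show ?thesis using assms(1,2) by (auto simp: inv_map_apply)
  next
    case False
    then have "R u = None" using assms(3) by blast
    with False show ?thesis by (simp add: inv_map_def)
  qed
qed

lemma inv_map_comp: "inj P \<Longrightarrow> inv_map P \<circ>\<^sub>m inv_map P = inv_map (\<lambda>x. P (P x))"
  by (rule map_eq_inv_mapI)
    (auto simp: inj_def map_comp_def inv_map_apply inv_map_eq_Some split: option.splits)

lemma ip_topology_cinner: "ip_topology UNIV (cinner :: 'h::chilbert_space \<Rightarrow> 'h \<Rightarrow> complex) = euclidean"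
proof -
  have "ip_dist UNIV (cinner :: 'h \<Rightarrow> 'h \<Rightarrow> complex) = dist"
    by (intro ext) (simp add: ip_dist_def dist_norm)
  then show ?thesis by (simp add: ip_topology_def)
qed

lemma op_adjoint_eq_SomeI:
  fixes q :: "'h::chilbert_space \<Rightarrow> 'h \<Rightarrow> complex"
  assumes "v \<in> K" "w \<in> K" "\<And>u. u \<in> dom S \<Longrightarrow> q (the (S u)) v = q u w"
    and "\<And>w'. w' \<in> K \<Longrightarrow> (\<And>u. u \<in> dom S \<Longrightarrow> q u w' = q u w) \<Longrightarrow> w' = w"
  shows "op_adjoint K q S v = Some w"
proof -
  have "(THE w. w \<in> K \<and> (\<forall>u\<in>dom S. q (the (S u)) v = q u w)) = w"
    using assms by (intro the_equality) auto
  then show ?thesis using assms unfolding op_adjoint_def by auto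
qed

lemma self_adjoint_cinnerI:
  fixes S :: "'h::chilbert_space \<rightharpoonup> 'h"
  assumes "linear_operator UNIV S" "closure (dom S) = UNIV"
    and sym: "\<And>u v. u \<in> dom S \<Longrightarrow> v \<in> dom S \<Longrightarrow> cinner (the (S u)) v = cinner u (the (S v))"
    and max: "\<And>v w. (\<And>u. u \<in> dom S \<Longrightarrow> cinner (the (S u)) v = cinner u w) \<Longrightarrow> v \<in> dom S"
  shows "self_adjoint UNIV cinner S"
proof -
  have "op_adjoint UNIV cinner S v = S v" for v
  proof (cases "v \<in> dom S")
    case True
    have "op_adjoint UNIV cinner S v = Some (the (S v))"
    proof (rule op_adjoint_eq_SomeI)
      fix w' assume "\<And>u. u \<in> dom S \<Longrightarrow> cinner u w' = cinner u (the (S v))"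
      then show "w' = the (S v)"
        by (intro eq_if_cinner_eq[OF assms(2)]) (metis cinner_commute)
    qed (use True sym in auto)
    then show ?thesis using True by auto
  next
    case False
    then have "\<not> (\<exists>w\<in>UNIV. \<forall>u\<in>dom S. cinner (the (S u)) v = cinner u w)" using max[of v] by blast
    then have "op_adjoint UNIV cinner S v = None" by (simp add: op_adjoint_def)
    then show ?thesis using False by (simp add: domIff)
  qed
  then show ?thesis using assms(1,2)
    by (auto simp: self_adjoint_def densely_defined_def ip_topology_cinner)
qed

lemma self_adjoint_cinnerD:
  fixes T :: "'h::chilbert_space \<rightharpoonup> 'h"
  assumes "self_adjoint UNIV cinner T"
  shows "linear_operator UNIV T" "closure (dom T) = UNIV"
    "\<And>u v. u \<in> dom T \<Longrightarrow> v \<in> dom T \<Longrightarrow> cinner (the (T u)) v = cinner u (the (T v))"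
    "\<And>v w. (\<And>u. u \<in> dom T \<Longrightarrow> cinner (the (T u)) v = cinner u w) \<Longrightarrow> T v = Some w"
proof -
  show 1: "linear_operator UNIV T" and 2: "closure (dom T) = UNIV"
    using assms by (simp_all add: self_adjoint_def densely_defined_def ip_topology_cinner)
  have adj: "op_adjoint UNIV cinner T = T" using assms by (simp add: self_adjoint_def)
  show 4: "T v = Some w" if "\<And>u. u \<in> dom T \<Longrightarrow> cinner (the (T u)) v = cinner u w" for v w
  proof -
    have "op_adjoint UNIV cinner T v = Some w"
    proof (rule op_adjoint_eq_SomeI)
      fix w' assume "\<And>u. u \<in> dom T \<Longrightarrow> cinner u w' = cinner u w"
      then show "w' = w" by (intro eq_if_cinner_eq[OF 2]) (metis cinner_commute)
    qed (use that in auto)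
    then show ?thesis by (simp add: adj)
  qed
  show "cinner (the (T u)) v = cinner u (the (T v))" if "u \<in> dom T" "v \<in> dom T" for u v
  proof -
    have "op_adjoint UNIV cinner T v \<noteq> None" using that(2) adj by auto
    then obtain w where w: "\<forall>u\<in>dom T. cinner (the (T u)) v = cinner u w"
      unfolding op_adjoint_def by (auto split: if_splits)
    then have "T v = Some w" by (intro 4) auto
    then show ?thesis using w that(1) by simp
  qed
qed

lemma self_adjoint_inv_map:
  assumes P: "hermitian P" "inj P" shows "self_adjoint UNIV cinner (inv_map P)"
proof (rule self_adjoint_cinnerI)
  note lin = bounded_clinearD[OF hermitian_bounded_clinear[OF P(1)]]
  have [simp]: "the (inv_map P (P x)) = x" for x by (simp add: inv_map_apply P)
  show "linear_operator UNIV (inv_map P)"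
    unfolding linear_operator_def dom_inv_map
    using csubspace_range[OF hermitian_bounded_clinear[OF P(1)]]
    by (auto simp: lin(1,3)[symmetric])
  show "closure (dom (inv_map P)) = UNIV" by (simp add: dom_inv_map hermitian_dense_range P)
  show "cinner (the (inv_map P u)) v = cinner u (the (inv_map P v))"
    if "u \<in> dom (inv_map P)" "v \<in> dom (inv_map P)" for u v
    using that hermitianD[OF P(1)] by (auto simp: dom_inv_map)
  fix v w assume *: "\<And>u. u \<in> dom (inv_map P) \<Longrightarrow> cinner (the (inv_map P u)) v = cinner u w"
  have "cinner x v = cinner x (P w)" for x
    using *[of "P x"] by (simp add: dom_inv_map hermitianD[OF P(1)])
  then have "v = P w" by (rule cinner_right_cancel)
  then show "v \<in> dom (inv_map P)" by (simp add: dom_inv_map)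
qed

text \<open>The inverse inherits symmetry from \<open>T\<close>; being everywhere defined, it is
  then a bounded operator.\<close>

lemma self_adjoint_bij_inverse:
  fixes T :: "'h::chilbert_space \<rightharpoonup> 'h"
  assumes T: "self_adjoint UNIV cinner T" and bij: "bij_betw (\<lambda>u. the (T u)) (dom T) UNIV"
  obtains G where "hermitian G" "inj G" "T = inv_map G"
proof -
  define G where "G = inv_into (dom T) (\<lambda>u. the (T u))"
  have G: "G x \<in> dom T" "the (T (G x)) = x" for x
  proof -
    have "x \<in> (\<lambda>u. the (T u)) ` dom T" using bij by (simp add: bij_betw_def)
    from inv_into_into[OF this] f_inv_into_f[OF this] show "G x \<in> dom T" "the (T (G x)) = x"
      unfolding G_def .
  qed
  have GT: "G (the (T u)) = u" if "u \<in> dom T" for u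
    unfolding G_def by (rule inv_into_f_f[where f = "\<lambda>u. the (T u)"]) (use bij that in \<open>simp_all add: bij_betw_def\<close>)
  have inj: "inj G" by (metis G(2) injI)
  have "hermitian G" unfolding hermitian_def using self_adjoint_cinnerD(3)[OF T G(1) G(1)] G(2) by simp
  moreover have "T = inv_map G"
  proof (rule map_eq_inv_mapI[OF inj])
    show "T (G x) = Some x" for x using G[of x] by auto
    show "u \<in> range G" if "u \<in> dom T" for u using GT[OF that] by (metis rangeI)
  qed
  ultimately show thesis using inj that by blast
qed

text \<open>The definite description requires uniqueness among unbounded roots. A root
  \<open>R\<close> of an invertible operator is a bijection from its domain onto \<open>H\<close>,
  hence the inverse of a bounded positive \<open>X\<close> with \<open>X X = P\<close>, and
  uniqueness of bounded positive roots applies to \<open>X\<close>.\<close>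

lemma op_sqrt_inv_map:
  fixes P Q :: "'h::chilbert_space \<Rightarrow> 'h"
  assumes P: "inj P" and Q: "positive Q" "\<And>x. Q (Q x) = P x"
  shows "op_sqrt (inv_map P) = inv_map Q"
proof -
  have hQ: "hermitian Q" using Q(1) by (simp add: positive_def)
  have injQ: "inj Q" using P Q(2) by (metis injD injI)
  have nonneg: "non_negative cinner (inv_map Q)"
  proof -
    have "cinner y (Q y) \<in> \<real>\<^sub>\<ge>\<^sub>0" for y
    proof -
      have "cinner y (Q y) = cnj (cinner y (Q y))" by (metis hermitianD[OF hQ] cinner_commute)
      then have "Im (cinner y (Q y)) = 0" by (simp add: complex_eq_iff)
      moreover have "0 \<le> Re (cinner y (Q y))"
        using Q(1) by (metis positive_def inner_eq_Re_cinner hermitianD)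
      ultimately show ?thesis by (simp add: complex_nonneg_Reals_iff)
    qed
    then show ?thesis unfolding non_negative_def dom_inv_map by (auto simp: inv_map_apply injQ)
  qed
  have comp: "inv_map Q \<circ>\<^sub>m inv_map Q = inv_map P"
    using inv_map_comp[OF injQ] Q(2) by simp
  show ?thesis unfolding op_sqrt_def
  proof (rule the_equality)
    show "self_adjoint UNIV cinner (inv_map Q) \<and> non_negative cinner (inv_map Q) \<and> inv_map Q \<circ>\<^sub>m inv_map Q = inv_map P"
      using self_adjoint_inv_map[OF hQ injQ] nonneg comp by blast
    fix R assume R: "self_adjoint UNIV cinner R \<and> non_negative cinner R \<and> R \<circ>\<^sub>m R = inv_map P"
    then have Rsa: "self_adjoint UNIV cinner R" and Rnn: "non_negative cinner R"
      and RR: "\<And>u. (R \<circ>\<^sub>m R) u = inv_map P u" by auto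
    note sa = self_adjoint_cinnerD[OF Rsa]
    have R_diff: "the (R (u - v)) = the (R u) - the (R v)" "u - v \<in> dom R" if "u \<in> dom R" "v \<in> dom R" for u v
    proof -
      have sub: "csubspace (dom R)" using sa(1) by (simp add: linear_operator_def)
      show "u - v \<in> dom R" using complex_vector.subspace_diff[OF sub] that by blast
      have v: "(-1) *\<^sub>C v \<in> dom R" by (rule complex_vector.subspace_scale[OF sub that(2)])
      have "the (R (u + (-1) *\<^sub>C v)) = the (R u) + the (R ((-1) *\<^sub>C v))"
        using sa(1) that(1) v unfolding linear_operator_def by blast
      also have "the (R ((-1) *\<^sub>C v)) = (-1) *\<^sub>C the (R v)"
        using sa(1) that(2) unfolding linear_operator_def by blast
      finally show "the (R (u - v)) = the (R u) - the (R v)" by simp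
    qed
    have R0: "R 0 = Some 0"
    proof -
      obtain u where u: "u \<in> dom R" using sa(2) by fastforce
      show ?thesis using R_diff[OF u u] by auto
    qed
    have "bij_betw (\<lambda>u. the (R u)) (dom R) UNIV"
      unfolding bij_betw_def
    proof
      show "inj_on (\<lambda>u. the (R u)) (dom R)"
      proof (rule inj_onI)
        fix u v assume uv: "u \<in> dom R" "v \<in> dom R" "the (R u) = the (R v)"
        then have "R (u - v) = Some 0" using R_diff[OF uv(1,2)] by auto
        then have "inv_map P (u - v) = Some 0" using RR[of "u - v"] R0 by simp
        moreover have "inv_map P 0 = Some 0" using RR[of 0] R0 by simp
        ultimately show "u = v" by (simp add: inv_map_eq_Some P)
      qed
      have "y \<in> (\<lambda>u. the (R u)) ` dom R" for y
      proof -
        have "(R \<circ>\<^sub>m R) (P y) = Some y" by (simp add: RR inv_map_apply P)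
        then obtain u where "R u = Some y" by (auto simp: map_comp_Some_iff)
        then show ?thesis by (intro image_eqI[of _ _ u]) auto
      qed
      then show "(\<lambda>u. the (R u)) ` dom R = UNIV" by auto
    qed
    then obtain X where X: "hermitian X" "inj X" "R = inv_map X"
      by (rule self_adjoint_bij_inverse[OF Rsa])
    have "0 \<le> inner (X x) x" for x
    proof -
      have "cinner x (X x) \<in> \<real>\<^sub>\<ge>\<^sub>0" using Rnn unfolding X(3) non_negative_def dom_inv_map
        using inv_map_apply[OF X(2), of x] by (metis option.sel rangeI)
      then show ?thesis by (simp add: complex_nonneg_Reals_iff hermitianD[OF X(1), symmetric] inner_eq_Re_cinner)
    qed
    then have "positive X" using X(1) by (simp add: positive_def)
    moreover have "X (X x) = Q (Q x)" for x
    proof -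
      have "inv_map (\<lambda>x. X (X x)) = inv_map P" using RR by (simp add: X(3) inv_map_comp[OF X(2)] fun_eq_iff)
      then have "inv_map (\<lambda>x. X (X x)) (P x) = Some x" by (simp add: inv_map_apply P)
      moreover have "inj (\<lambda>x. X (X x))" using X(2) by (simp add: inj_def)
      ultimately show ?thesis by (simp add: inv_map_eq_Some Q(2))
    qed
    ultimately have "X = Q" by (rule positive_sqrt_unique[OF _ Q(1)])
    then show "R = inv_map Q" by (simp add: X(3))
  qed
qed

lemma op_abs_inv_map:
  fixes G A :: "'h::chilbert_space \<Rightarrow> 'h"
  assumes G: "hermitian G" "inj G" and A: "positive A" "\<And>x. A (A x) = G (G x)"
  shows "op_abs (inv_map G) = inv_map A"
proof -
  have "op_adjoint UNIV cinner (inv_map G) = inv_map G"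
    using self_adjoint_inv_map[OF G] by (simp add: self_adjoint_def)
  then have "op_abs (inv_map G) = op_sqrt (inv_map (\<lambda>x. G (G x)))"
    by (simp add: op_abs_def inv_map_comp G)
  also have "\<dots> = inv_map A"
    using G(2) by (intro op_sqrt_inv_map A) (simp add: inj_def)
  finally show ?thesis .
qed

section \<open>Krein space completions\<close>

text \<open>The identity is tested on those coordinates \<open>z\<close> with \<open>S z\<close> in
  the range of \<open>R\<close>, a dense set because the chart is a homeomorphism. For a completion
  \<open>M\<close> is the identity; for a closure with gap point \<open>gamma\<close> it is
  \<open>1 - gamma G\<close>.\<close>

lemma chart_dense_identity:
  fixes K :: "'h::chilbert_space set"
  assumes S: "hermitian S" "inj S" "range S = K" and J: "\<And>x. J (J x) = x"
    and q: "\<And>x y. q (S x) (S y) = cinner (J x) y"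
    and hom: "homeomorphic_maps euclidean (krein_topology K q) S (inv S)"
    and R: "range R \<subseteq> K" "krein_topology K q closure_of range R = K"
    and M: "\<And>x y. q (R x) (R y) = cinner (M x) (R y)"
  shows "R x = S (J (S (M x)))"
proof -
  define A where "A = {z. S z \<in> range R}"
  have R': "R y \<in> range S" for y using R(1) S(3) by (simp add: image_subset_iff)
  have "S ` A = range R"
  proof (intro equalityI subsetI)
    fix v assume "v \<in> range R"
    then show "v \<in> S ` A" using R' unfolding A_def by (metis (mono_tags) imageE image_eqI mem_Collect_eq)
  qed (auto simp: A_def)
  then have "S ` closure A = range S" using chart_closure_of[OF hom, of A] R(2) S(3) by simp
  then have dense: "closure A = UNIV" using S(2) by (simp add: inj_image_eq_iff)
  obtain a where a: "R x = S a" using R'[of x] by (rule rangeE)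
  have "J a = S (M x)"
  proof (rule eq_if_cinner_eq[OF dense])
    fix z assume "z \<in> A"
    then obtain y where y: "S z = R y" by (auto simp: A_def)
    have "cinner (J a) z = q (R x) (R y)" by (simp add: q[symmetric] a y)
    also have "\<dots> = cinner (S (M x)) z" unfolding M unfolding y[symmetric] by (simp add: hermitianD[OF S(1)])
    finally show "cinner (J a) z = cinner (S (M x)) z" .
  qed
  then have "a = J (S (M x))" using J by metis
  then show ?thesis by (simp add: a)
qed

locale inverse_operator =
  fixes G :: "'h::chilbert_space \<Rightarrow> 'h" and T :: "'h \<rightharpoonup> 'h"
  assumes hG: "hermitian G" and injG: "inj G" and T: "T = inv_map G"
begin

lemmas bG = hermitian_bounded_clinear[OF hG]
lemmas G_lin = bounded_clinearD[OF bG]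

lemma dom_T: "dom T = range G" by (simp add: T dom_inv_map)

lemma T_G: "T (G x) = Some x" by (simp add: T inv_map_apply injG)

lemma self_adjoint_T: "self_adjoint UNIV cinner T"
  unfolding T by (rule self_adjoint_inv_map[OF hG injG])

lemma operator_form_T: "form_dom (operator_form T) = range G"
  "form_val (operator_form T) (G x) (G y) = cinner x (G y)"
  using dom_T T_G by (auto simp: operator_form_def)

lemma dense_G: "closure (range G) = UNIV" by (rule hermitian_dense_range[OF hG injG])

section \<open>Completions as factorizations of the inverse operator\<close>

lemma embedded_completion_dense:
  assumes "range G \<subseteq> K" shows "closure K = UNIV"
  using closure_mono[OF assms] dense_G by auto

lemma completion_chart:
  assumes "embedded_completion T K q"
  obtains S J where "positive S" "inj S" "range S = K" "hermitian J" "\<And>x. J (J x) = x"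
    "\<And>x y. q (S x) (S y) = cinner (J x) y" "\<And>x y. krein_ip K q (S x) (S y) = cinner x y"
    "\<And>x. fundamental_symmetry K q (S x) = S (J x)"
    "homeomorphic_maps euclidean (krein_topology K q) S (inv S)"
    "\<And>x. G x = S (J (S x))"
proof -
  have kr: "krein_space K q" and sub: "range G \<subseteq> K"
    and cl: "krein_topology K q closure_of range G = K"
    and eq: "\<And>x y. q (G x) (G y) = cinner x (G y)" and emb: "continuously_embedded K q"
    using assms operator_form_T by (auto simp: embedded_completion_def krein_completion_def)
  obtain S J where SJ: "positive S" "inj S" "range S = K" "hermitian J" "\<And>x. J (J x) = x"
    "\<And>x y. q (S x) (S y) = cinner (J x) y" "\<And>x y. krein_ip K q (S x) (S y) = cinner x y"
    "\<And>x. fundamental_symmetry K q (S x) = S (J x)"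
    "homeomorphic_maps euclidean (krein_topology K q) S (inv S)"
    by (rule krein_chart[OF kr emb embedded_completion_dense[OF sub]], rule that)
  have "hermitian S" using SJ(1) by (simp add: positive_def)
  note chart_dense_identity[OF this SJ(2,3,5,6,9) sub cl, of "\<lambda>x. x", OF eq]
  from that[OF SJ this] show thesis .
qed

text \<open>The factor \<open>S\<close> carries a separate adjoint \<open>Sa\<close> because in
  \<open>form_closure_completion\<close> it is a product of two hermitian operators. Density of the
  domain of \<open>T\<close> in the completion reduces to injectivity of \<open>S\<close>.\<close>

lemma embedded_completionI:
  assumes S: "bounded_clinear S" "inj S" "\<And>x y. cinner (S x) y = cinner x (Sa y)"
    and J: "hermitian J" "\<And>x. J (J x) = x"
    and q: "\<And>x y. q (S x) (S y) = cinner (J x) y" "zero_outside (range S) q"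
    and G: "\<And>x. G x = S (J (Sa x))"
  shows "embedded_completion T (range S) q"
proof -
  note kc = krein_space_chart[OF S(1,2) J q]
  have bSa: "bounded_clinear Sa"
  proof (rule bounded_clinear_if_dense_adjoint[of UNIV])
    show "\<exists>w. \<forall>y. cinner (Sa y) z = cinner y w" for z
      using S(3) by (metis cinner_commute)
  qed simp
  have b: "bounded_clinear (\<lambda>x. J (Sa x))"
    by (rule bounded_clinear_compose[OF hermitian_bounded_clinear[OF J(1)] bSa])
  have dense: "closure (range (\<lambda>x. J (Sa x))) = UNIV"
  proof (rule dense_if_orthogonal_zero[OF csubspace_range[OF b]])
    fix z assume *: "\<And>d. d \<in> range (\<lambda>x. J (Sa x)) \<Longrightarrow> cinner d z = 0"
    have "cinner x (S (J z)) = cinner x 0" for x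
    proof -
      have "cinner (Sa x) (J z) = 0" using *[of "J (Sa x)"] hermitianD[OF J(1), of "Sa x" z] by simp
      then show ?thesis using S(3)[of "J z" x] by (metis cinner_commute cinner_zero(2) complex_cnj_zero)
    qed
    then have "S (J z) = 0" by (rule cinner_right_cancel)
    then have "J z = 0" using S(1,2) bounded_clinear_inj_iff by blast
    then show "z = 0" using J(2)[of z] bounded_clinearD(4)[OF hermitian_bounded_clinear[OF J(1)]] by simp
  qed
  have rangeG: "range G = S ` range (\<lambda>x. J (Sa x))" by (auto simp: G)
  have "krein_topology (range S) q closure_of range G = range S"
    unfolding rangeG chart_closure_of[OF kc(3)] dense ..
  moreover have "q (G x) (G y) = cinner x (G y)" for x y
    by (simp add: G q J(2)) (metis S(3) cinner_commute)
  moreover have "csubspace (range G)" by (rule csubspace_range[OF bG])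
  moreover have "range G \<subseteq> range S" by (auto simp: G)
  ultimately show ?thesis
    using kc(1,2) operator_form_T by (auto simp: embedded_completion_def krein_completion_def)
qed

lemma completion_inclusion_unique:
  assumes c1: "embedded_completion T K1 q1" and c2: "embedded_completion T K2 q2" and sub: "K1 \<subseteq> K2"
  shows "K1 = K2 \<and> q1 = q2"
proof -
  obtain S1 J1 where 1: "positive S1" "inj S1" "range S1 = K1" "hermitian J1" "\<And>x. J1 (J1 x) = x"
    "\<And>x y. q1 (S1 x) (S1 y) = cinner (J1 x) y" "\<And>x. G x = S1 (J1 (S1 x))"
    by (rule completion_chart[OF c1], rule that)
  obtain S2 J2 where 2: "positive S2" "inj S2" "range S2 = K2" "hermitian J2" "\<And>x. J2 (J2 x) = x"
    "\<And>x y. q2 (S2 x) (S2 y) = cinner (J2 x) y" "\<And>x. G x = S2 (J2 (S2 x))"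
    by (rule completion_chart[OF c2], rule that)
  have h: "hermitian S1" "hermitian S2" using 1(1) 2(1) by (auto simp: positive_def)
  have dense: "closure (range S2) = UNIV" by (rule hermitian_dense_range[OF h(2) 2(2)])
  \<comment> \<open>Formally \<open>S2^-1 S1\<close>. Its adjoint is explicit on the dense range of
    \<open>S2\<close>, which makes it bounded.\<close>
  define X where "X y = inv S2 (S1 y)" for y
  have SX: "S2 (X y) = S1 y" for y
    unfolding X_def using sub 1(3) 2(3) by (intro f_inv_into_f) auto
  have adj: "cinner (X y) (S2 z) = cinner y (S1 z)" for y z
    by (metis SX hermitianD[OF h(1)] hermitianD[OF h(2)])
  have "bounded_clinear X"
    by (rule bounded_clinear_if_dense_adjoint[OF dense]) (use adj in blast)
  then obtain Xa where Xa: "\<And>x y. cinner (X x) y = cinner x (Xa y)" using bounded_adjoint_ex by blast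
  have XaS: "Xa (S2 z) = S1 z" for z
    by (rule cinner_right_cancel) (metis Xa adj)
  \<comment> \<open>Both factorizations equal \<open>G\<close>, so
    \<open>S2 X J1 Xa S2 = S2 J2 S2\<close>. The left factor is cancelled by injectivity of
    \<open>S2\<close>, the right one by density of its range.\<close>
  have XJ: "X (J1 (Xa z)) = J2 z" for z
  proof (rule eq_if_cinner_eq[OF dense])
    fix w assume "w \<in> range S2"
    then obtain y where w: "w = S2 y" by blast
    have "S2 (X (J1 (Xa w))) = S2 (J2 w)" using 1(7)[of y] 2(7)[of y] by (simp add: SX XaS w)
    then have e: "X (J1 (Xa w)) = J2 w" using 2(2) by (simp add: inj_eq)
    have "cinner (X (J1 (Xa z))) w = cinner (J1 (Xa z)) (Xa w)" by (rule Xa)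
    also have "\<dots> = cinner (Xa z) (J1 (Xa w))" by (rule hermitianD[OF 1(4)])
    also have "\<dots> = cinner z (X (J1 (Xa w)))" by (metis Xa cinner_commute)
    finally show "cinner (X (J1 (Xa z))) w = cinner (J2 z) w" by (simp add: e hermitianD[OF 2(4)])
  qed
  \<comment> \<open>As \<open>J2\<close> is an involution, \<open>X\<close> has the right inverse
    \<open>J1 Xa J2\<close>; hence every \<open>S2 z\<close> is of the form
    \<open>S1 y\<close>.\<close>
  have "K2 \<subseteq> K1"
  proof
    fix v assume "v \<in> K2"
    then obtain z where "v = S2 z" using 2(3) by blast
    moreover have "S2 z = S1 (J1 (Xa (J2 z)))" by (simp add: SX[symmetric] XJ 2(5))
    ultimately show "v \<in> K1" using 1(3) by auto
  qed
  with sub have K: "K1 = K2" by simp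
  \<comment> \<open>Now \<open>X\<close> is bijective, and inverting \<open>X J1 Xa = J2\<close>
    gives the transformation rule under which the inner products coincide.\<close>
  have XaJX: "Xa (J2 (X y)) = J1 y" for y
  proof -
    have "X (J1 (Xa (J2 (X y)))) = X y" by (simp add: XJ 2(5))
    then have "S1 (J1 (Xa (J2 (X y)))) = S1 y" by (metis SX)
    then have "J1 (Xa (J2 (X y))) = y" using 1(2) by (simp add: inj_eq)
    then show ?thesis using 1(5) by metis
  qed
  have "q1 u v = q2 u v" for u v
  proof (cases "u \<in> K1 \<and> v \<in> K1")
    case True
    then obtain y z where yz: "u = S1 y" "v = S1 z" using 1(3) by blast
    have "q2 u v = cinner (J2 (X y)) (X z)" by (simp add: yz SX[symmetric] 2(6))
    also have "\<dots> = cinner (Xa (J2 (X y))) z" by (metis Xa cinner_commute)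
    also have "\<dots> = q1 u v" by (simp add: XaJX yz 1(6))
    finally show ?thesis ..
  next
    case False
    moreover have "zero_outside K1 q1" "zero_outside K2 q2"
      using c1 c2 by (auto simp: embedded_completion_def krein_completion_def krein_space_def)
    ultimately show ?thesis using K unfolding zero_outside_def by metis
  qed
  then show ?thesis using K by blast
qed

section \<open>Closures of the form and completions correspond\<close>

lemma hermitian_inv:
  assumes "hermitian Z" "bij Z" shows "hermitian (inv Z)"
  unfolding hermitian_def using assms by (metis bij_inv_eq_iff hermitianD)

text \<open>
  In the coordinates of a gap point \<open>\<gamma>\<close> the form is represented by \<open>W = J + \<gamma> S\<^sup>2\<close>, which
  \<open>J - \<gamma> J S (1 - \<gamma> G) S J\<close> inverts. Absorbing \<open>\<bar>W\<bar>\<^sup>1\<^sup>/\<^sup>2\<close> into \<open>S\<close> turns it into a symmetry.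
\<close>

lemma form_closure_completion:
  assumes "t \<in> \<M> T"
  shows "embedded_completion T (form_dom t) (form_val t)"
proof -
  have "form_closure_of (operator_form T) t" using assms by (simp add: form_closures_def)
  then obtain \<gamma> where isf: "is_form t" and sub: "range G \<subseteq> form_dom t"
    and val: "\<And>x y. form_val t (G x) (G y) = cinner x (G y)"
    and gap: "gap_point t \<gamma>"
    and cl: "krein_topology (form_dom t) (form_shift t \<gamma>) closure_of range G = form_dom t"
    using operator_form_T by (auto simp: form_closure_of_def closed_form_def)
  obtain S J where SJ: "positive S" "inj S" "range S = form_dom t" "hermitian J" "\<And>x. J (J x) = x"
    "\<And>x y. form_shift t \<gamma> (S x) (S y) = cinner (J x) y"
    "homeomorphic_maps euclidean (krein_topology (form_dom t) (form_shift t \<gamma>)) S (inv S)"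
    using krein_chart[of "form_dom t" "form_shift t \<gamma>"] gap isf unfolding gap_point_def is_form_def by metis
  have hS: "hermitian S" using SJ(1) by (simp add: positive_def)
  note S_lin = bounded_clinearD[OF hermitian_bounded_clinear[OF hS]]
    and J_lin = bounded_clinearD[OF hermitian_bounded_clinear[OF SJ(4)]]
  define g where "g = complex_of_real \<gamma>"
  have shift: "form_shift t \<gamma> (G x) (G y) = cinner (x - g *\<^sub>C G x) (G y)" for x y
    using sub val by (auto simp: form_shift_def g_def cinner_diff_left cinner_scaleC_left)
  have G: "G x = S (J (S (x - g *\<^sub>C G x)))" for x
    by (rule chart_dense_identity[OF hS SJ(2,3,5,6,7) sub cl shift])
  \<comment> \<open>The coordinate of \<open>G x\<close>, that is \<open>S a = G\<close>. The
    operator \<open>W\<close> below maps it to \<open>S x\<close>, which yields both surjectivity of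
    \<open>W\<close> and the final factorization.\<close>
  define a where "a x = J (S (x - g *\<^sub>C G x))" for x
  have Ga: "G x = S (a x)" for x unfolding a_def by (rule G)
  define W where "W x = J x + g *\<^sub>C S (S x)" for x
  have hW: "hermitian W"
    unfolding hermitian_def W_def g_def
    by (simp add: cinner_add_left cinner_add_right cinner_scaleC_left cinner_scaleC_right
        hermitianD[OF hS] hermitianD[OF SJ(4)])
  note W_lin = bounded_clinearD[OF hermitian_bounded_clinear[OF hW]]
  have Wa: "W (a x) = S x" for x
  proof -
    have "J (a x) = S x - g *\<^sub>C S (G x)" by (simp add: a_def SJ(5) S_lin)
    then show ?thesis by (simp add: W_def Ga[symmetric])
  qed
  have Wsurj: "W (J y - g *\<^sub>C a (S (J y))) = y" for y
    unfolding W_lin Wa by (simp add: W_def SJ(5))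
  have Winj: "inj W"
    unfolding bounded_clinear_inj_iff[OF hermitian_bounded_clinear[OF hW]]
  proof (intro allI impI)
    fix x assume "W x = 0"
    then have "cinner x (W y) = 0" for y using hermitianD[OF hW, of x y] by simp
    then have "cinner x y = cinner 0 y" for y using Wsurj[of y] by (metis cinner_zero(1))
    then show "x = 0" by (rule cinner_left_cancel)
  qed
  have val_W: "form_val t (S x) (S y) = cinner (W x) y" for x y
  proof -
    have "S x \<in> form_dom t" "S y \<in> form_dom t" using SJ(3) by auto
    then have "form_val t (S x) (S y) = cinner (J x) y + g * cinner (S x) (S y)"
      using SJ(6)[of x y] by (simp add: form_shift_def g_def algebra_simps)
    then show ?thesis by (simp add: W_def cinner_add_left cinner_scaleC_left hermitianD[OF hS])
  qed
  \<comment> \<open>Two successive roots of \<open>W^2\<close> give \<open>P\<close>, the modulus of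
    \<open>W\<close>, and its square root \<open>Z\<close>. Both commute with
    \<open>W\<close>.\<close>
  have pos: "positive (\<lambda>x. W (W x))"
    using hW by (simp add: positive_def hermitian_def inner_eq_Re_cinner cinner_self)
  obtain P where P: "positive P" "\<And>x. P (P x) = W (W x)"
    "\<forall>C. bounded_clinear C \<longrightarrow> (\<forall>x. C (W (W x)) = W (W (C x))) \<longrightarrow> (\<forall>x. C (P x) = P (C x))"
    using positive_sqrt_ex[OF pos] by blast
  obtain Z where Z: "positive Z" "\<And>x. Z (Z x) = P x"
    "\<forall>C. bounded_clinear C \<longrightarrow> (\<forall>x. C (P x) = P (C x)) \<longrightarrow> (\<forall>x. C (Z x) = Z (C x))"
    using positive_sqrt_ex[OF P(1)] by blast
  have hZ: "hermitian Z" using Z(1) by (simp add: positive_def)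
  have bW: "bounded_clinear W" by (rule hermitian_bounded_clinear[OF hW])
  have "W (P x) = P (W x)" for x using P(3) bW by blast
  then have WZ: "W (Z x) = Z (W x)" for x using Z(3) bW by blast
  have Z4: "Z (Z (Z (Z x))) = W (W x)" for x by (simp add: Z(2) P(2))
  \<comment> \<open>Since \<open>Z^4 = W^2\<close>, bijectivity passes from \<open>W\<close> to
    \<open>Z\<close>.\<close>
  have bijZ: "bij Z"
  proof (rule bijI)
    show "inj Z" using Winj Z4 by (metis injD injI)
    show "surj Z"
    proof (rule surjI)
      fix y
      have "W (W (J (J y - g *\<^sub>C a (S (J y))) - g *\<^sub>C a (S (J (J y - g *\<^sub>C a (S (J y))))))) = y"
        by (simp only: Wsurj)
      then show "Z (Z (Z (Z (J (J y - g *\<^sub>C a (S (J y))) - g *\<^sub>C a (S (J (J y - g *\<^sub>C a (S (J y))))))))) = y"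
        by (simp only: Z4)
    qed
  qed
  define Y where "Y = inv Z"
  have ZY: "Z (Y x) = x" "Y (Z x) = x" for x
    using bijZ by (simp_all add: Y_def bij_is_surj surj_f_inv_f bij_is_inj)
  have hY: "hermitian Y" unfolding Y_def by (rule hermitian_inv[OF hZ bijZ])
  have WY: "W (Y x) = Y (W x)" for x by (metis WZ ZY)
  have WWY: "W (W (Y (Y (Y (Y x))))) = x" for x by (simp add: Z4[symmetric] ZY)
  have bY: "bounded_clinear Y" by (rule hermitian_bounded_clinear[OF hY])
  \<comment> \<open>The operator \<open>Z^-1 W Z^-1\<close> is the sign of \<open>W\<close>, a
    hermitian symmetry.\<close>
  define J' where "J' x = Y (W (Y x))" for x
  have "embedded_completion T (range (\<lambda>x. S (Y x))) (form_val t)"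
  proof (rule embedded_completionI[where Sa = "\<lambda>x. Y (S x)" and J = J'])
    show "bounded_clinear (\<lambda>x. S (Y x))"
      by (rule bounded_clinear_compose[OF hermitian_bounded_clinear[OF hS] bY])
    show "inj (\<lambda>x. S (Y x))" using SJ(2) ZY by (metis injD injI)
    show "cinner (S (Y x)) y = cinner x (Y (S y))" for x y
      by (simp add: hermitianD[OF hS] hermitianD[OF hY])
    show "hermitian J'" unfolding hermitian_def J'_def
      by (simp add: hermitianD[OF hY] hermitianD[OF hW])
    show "J' (J' x) = x" for x by (simp add: J'_def WY[symmetric] WWY)
    show "form_val t (S (Y x)) (S (Y y)) = cinner (J' x) y" for x y
      by (simp add: val_W J'_def hermitianD[OF hY])
    have "range (\<lambda>x. S (Y x)) = form_dom t"
      using SJ(3) ZY(2) by (metis (no_types, lifting) image_cong range_composition surj_def)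
    then show "zero_outside (range (\<lambda>x. S (Y x))) (form_val t)" using isf by (simp add: is_form_def)
    show "G x = S (Y (J' (Y (S x))))" for x
    proof -
      have "W (Y (J' (Y (S x)))) = W (a x)" by (simp add: J'_def WY[symmetric] WWY Wa)
      then have "Y (J' (Y (S x))) = a x" using Winj by (simp add: inj_eq)
      then show ?thesis by (simp add: Ga)
    qed
  qed
  moreover have "range (\<lambda>x. S (Y x)) = form_dom t"
    using SJ(3) ZY(2) by (metis (no_types, lifting) image_cong range_composition surj_def)
  ultimately show ?thesis by simp
qed

text \<open>The first representation identity with \<open>v\<close> ranging over all of
  \<open>K\<close> and not only over the domain of \<open>T\<close>. It identifies \<open>T\<close>
  as the operator of the form.\<close>

lemma completion_identity:
  assumes "embedded_completion T K q" "v \<in> K"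
  shows "q (G x) v = cinner x v"
proof -
  obtain S J where SJ: "positive S" "inj S" "range S = K" "hermitian J" "\<And>x. J (J x) = x"
    "\<And>x y. q (S x) (S y) = cinner (J x) y" "\<And>x. G x = S (J (S x))"
    by (rule completion_chart[OF assms(1)], rule that)
  obtain z where "v = S z" using assms(2) SJ(3) by blast
  moreover have "hermitian S" using SJ(1) by (simp add: positive_def)
  ultimately show ?thesis by (simp add: SJ(5-7) hermitianD)
qed

text \<open>Let \<open>R\<close> be another self-adjoint operator representing the form. Comparing
  form values shows that \<open>R\<close> and \<open>T\<close> are adjoint to each other, so
  maximality of \<open>T\<close> gives one inclusion and maximality of \<open>R\<close> the
  other.\<close>

lemma form_operator_closure:
  assumes "t \<in> \<M> T" shows "form_operator t = T"
proof -
  note c = form_closure_completion[OF assms]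
  have isf: "is_form t" using assms by (simp add: form_closures_def form_closure_of_def closed_form_def)
  have sub: "range G \<subseteq> form_dom t"
    using c operator_form_T by (simp add: embedded_completion_def krein_completion_def)
  show ?thesis unfolding form_operator_def
  proof (rule the_equality)
    show "self_adjoint UNIV cinner T \<and> dom T \<subseteq> form_dom t \<and>
      (\<forall>u\<in>dom T. \<forall>v\<in>form_dom t. form_val t u v = cinner (the (T u)) v)"
      using self_adjoint_T sub by (auto simp: dom_T T_G completion_identity[OF c])
    fix R assume R: "self_adjoint UNIV cinner R \<and> dom R \<subseteq> form_dom t \<and>
      (\<forall>u\<in>dom R. \<forall>v\<in>form_dom t. form_val t u v = cinner (the (R u)) v)"
    have RT: "T u = Some (the (R u))" if u: "u \<in> dom R" for u
    proof (rule self_adjoint_cinnerD(4)[OF self_adjoint_T])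
      fix v assume "v \<in> dom T"
      then obtain x where x: "v = G x" by (auto simp: dom_T)
      have "form_val t u (G x) = cnj (form_val t (G x) u)"
        using isf u R sub unfolding is_form_def symmetric_on_def by blast
      also have "\<dots> = cnj (cinner x u)" using completion_identity[OF c, of u x] u R by auto
      finally have "cinner (the (R u)) (G x) = cinner u x"
        using R u sub by (metis cinner_commute rangeI subsetD)
      then show "cinner (the (T v)) u = cinner v (the (R u))" by (simp add: x T_G) (metis cinner_commute)
    qed
    have TR: "R v = Some (the (T v))" if "v \<in> dom T" for v
    proof (rule self_adjoint_cinnerD(4)[of R])
      show "self_adjoint UNIV cinner R" using R by blast
      fix u assume "u \<in> dom R"
      then have "T u = Some (the (R u))" by (rule RT)
      then show "cinner (the (R u)) v = cinner u (the (T v))"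
        using self_adjoint_cinnerD(3)[OF self_adjoint_T, of u v] that by (metis domI option.sel)
    qed
    show "R = T"
    proof
      fix u
      show "R u = T u"
      proof (cases "u \<in> dom T")
        case True
        then show ?thesis using TR by force
      next
        case False
        then have "u \<notin> dom R" using RT by blast
        with False show ?thesis by (metis domIff)
      qed
    qed
  qed
qed

text \<open>With gap point \<open>0\<close> the shifted form is \<open>q\<close> itself, so the
  completion supplies all the data of a closure.\<close>

lemma completion_form_closure:
  assumes c: "embedded_completion T K q" shows "(K, q) \<in> \<M> T"
proof -
  have kr: "krein_space K q" and emb: "continuously_embedded K q"
    using c by (auto simp: embedded_completion_def krein_completion_def)
  have sub: "range G \<subseteq> K" using c operator_form_T by (simp add: embedded_completion_def krein_completion_def)
  have shift: "form_shift (K, q) 0 = q"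
    using kr by (intro ext) (auto simp: form_shift_def krein_space_def zero_outside_def)
  have gap: "gap_point (K, q) 0" using kr emb by (simp add: gap_point_def shift)
  have "is_form (K, q)"
    using kr embedded_completion_dense[OF sub] by (simp add: is_form_def krein_space_def)
  then have "closed_form (K, q)" using gap by (auto simp: closed_form_def)
  moreover have "krein_topology K (form_shift (K, q) 0) closure_of range G = K"
    using c operator_form_T by (simp add: embedded_completion_def krein_completion_def shift)
  ultimately show ?thesis
    using gap c sub operator_form_T
    by (auto simp: form_closures_def form_closure_of_def embedded_completion_def krein_completion_def intro!: exI[of _ 0])
qed

section \<open>The range restriction in a completion\<close>

abbreviation restr :: "'h set \<Rightarrow> ('h \<rightharpoonup> 'h)"
  where "restr K \<equiv> T |` {u \<in> dom T. the (T u) \<in> K}"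

lemma dom_restr: "dom (restr K) = G ` K"
  by (auto simp: dom_T T_G)

lemma restr_G: "k \<in> K \<Longrightarrow> restr K (G k) = Some k"
  by (auto simp: restrict_map_def dom_T T_G)

lemma form_triple_closure: "t \<in> \<M> T \<Longrightarrow> \<Phi> t = (form_dom t, form_val t, restr (form_dom t))"
  by (simp add: form_triple_def range_restriction_def form_operator_closure)

text \<open>In the coordinates of the chart the restriction is the inverse of \<open>J S^2\<close>,
  and the fundamental symmetry times it is the inverse of the positive operator
  \<open>J S^2 J\<close>. All three properties are read off from these inverses.\<close>

lemma completion_operator_properties:
  assumes c: "embedded_completion T K q"
  shows "J_self_adjoint K q (restr K)" "J_non_negative K q (restr K)"
    "boundedly_invertible K (krein_ip K q) (restr K)"
proof -
  let ?h = "krein_ip K q" and ?F = "fundamental_symmetry K q"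
  obtain S J where SJ: "positive S" "inj S" "range S = K" "hermitian J" "\<And>x. J (J x) = x"
    "\<And>x y. q (S x) (S y) = cinner (J x) y" "\<And>x y. ?h (S x) (S y) = cinner x y"
    "\<And>x. ?F (S x) = S (J x)"
    "homeomorphic_maps euclidean (krein_topology K q) S (inv S)"
    "\<And>x. G x = S (J (S x))"
    by (rule completion_chart[OF c], rule that)
  have hS: "hermitian S" using SJ(1) by (simp add: positive_def)
  note bS = hermitian_bounded_clinear[OF hS] and bJ = hermitian_bounded_clinear[OF SJ(4)]
  note S_lin = bounded_clinearD[OF bS] and J_lin = bounded_clinearD[OF bJ]
  have SK: "S x \<in> K" for x using SJ(3) by blast
  have J_eq: "J x = J y \<longleftrightarrow> x = y" for x y by (metis SJ(5))
  have S_eq: "S x = S y \<longleftrightarrow> x = y" for x y using SJ(2) by (simp add: inj_eq)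
  define B where "B = map_option ?F \<circ> restr K"
  have B: "B (G (S x)) = Some (S (J x))" for x by (simp add: B_def restr_G[OF SK] SJ(8))
  have domB: "dom B = range (\<lambda>x. G (S x))"
  proof -
    have "dom B = dom (restr K)" unfolding B_def by (simp add: dom_def)
    also have "\<dots> = G ` range S" by (simp only: dom_restr SJ(3))
    finally show ?thesis by (simp add: image_image)
  qed
  have ranB: "ran B \<subseteq> K"
  proof
    fix y assume "y \<in> ran B"
    then obtain u where u: "B u = Some y" by (auto simp: ran_def)
    then obtain x where "u = G (S x)" using domB by blast
    then show "y \<in> K" using u B SK by auto
  qed
  have bGS: "bounded_clinear (\<lambda>x. G (S x))" by (rule bounded_clinear_compose[OF bG bS])
  have lin: "linear_operator K B"
    unfolding linear_operator_def domB
  proof (intro conjI ranB csubspace_range bGS ballI allI)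
    show "range (\<lambda>x. G (S x)) \<subseteq> K" using SK by (auto simp: SJ(10))
    show "the (B (u + v)) = the (B u) + the (B v)"
      if "u \<in> range (\<lambda>x. G (S x))" "v \<in> range (\<lambda>x. G (S x))" for u v
      using that by (auto simp: G_lin(1)[symmetric] S_lin(1)[symmetric] B) (simp add: S_lin J_lin)
    show "the (B (d *\<^sub>C u)) = d *\<^sub>C the (B u)" if "u \<in> range (\<lambda>x. G (S x))" for u d
      using that by (auto simp: G_lin(3)[symmetric] S_lin(3)[symmetric] B) (simp add: S_lin J_lin)
  qed
  have "closure (range (\<lambda>x. J (S (S x)))) = UNIV"
  proof (rule dense_if_orthogonal_zero)
    show "csubspace (range (\<lambda>x. J (S (S x))))"
      by (intro csubspace_range bounded_clinear_compose[OF bJ bounded_clinear_compose[OF bS bS]])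
    fix z assume *: "\<And>d. d \<in> range (\<lambda>x. J (S (S x))) \<Longrightarrow> cinner d z = 0"
    have "cinner x (S (S (J z))) = cinner x 0" for x
      using * by (simp add: hermitianD[OF SJ(4), symmetric] hermitianD[OF hS, symmetric])
    then have "S (S (J z)) = 0" by (rule cinner_right_cancel)
    then show "z = 0" by (metis S_eq S_lin(4) J_eq J_lin(4))
  qed
  then have dense: "densely_defined K ?h B"
    using chart_closure_of[OF SJ(9), of "range (\<lambda>x. J (S (S x)))"]
    by (simp add: densely_defined_def domB SJ(10) image_image krein_topology_def SJ(3))
  have key: "?h (the (B (G (S x)))) (S z) = ?h (G (S x)) (S y) \<longleftrightarrow> cinner x (J z) = cinner x (S (S (J y)))" for x y z
    unfolding B option.sel by (simp add: SJ(7,10) hermitianD[OF SJ(4)] hermitianD[OF hS])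
  have "op_adjoint K ?h B v = B v" for v
  proof (cases "v \<in> dom B")
    case True
    then obtain y where v: "v = G (S y)" by (auto simp: domB)
    have "op_adjoint K ?h B v = Some (S (J y))"
    proof (rule op_adjoint_eq_SomeI)
      show "v \<in> K" "S (J y) \<in> K" using SK by (auto simp: v SJ(10))
      show "?h (the (B u)) v = ?h u (S (J y))" if u: "u \<in> dom B" for u
      proof -
        from u[unfolded domB] obtain x where x: "u = G (S x)" by blast
        show ?thesis
          using key[of x "J (S (S y))" "J y"] unfolding x v SJ(10)[of "S y"] by (simp only: SJ(5))
      qed
      fix w assume w: "w \<in> K" "\<And>u. u \<in> dom B \<Longrightarrow> ?h u w = ?h u (S (J y))"
      then obtain z where z: "w = S z" using SJ(3) by blast
      have "cinner x (S (S (J z))) = cinner x (S (S y))" for x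
        using w(2)[of "G (S x)"] by (simp add: domB z SJ(5,7,10) hermitianD[OF SJ(4)] hermitianD[OF hS])
      then have "S (S (J z)) = S (S y)" by (rule cinner_right_cancel)
      then have "z = J y" by (metis S_eq SJ(5))
      then show "w = S (J y)" by (simp add: z)
    qed
    then show ?thesis by (simp add: v B)
  next
    case False
    have "\<not> (v \<in> K \<and> (\<exists>w\<in>K. \<forall>u\<in>dom B. ?h (the (B u)) v = ?h u w))"
    proof
      assume "v \<in> K \<and> (\<exists>w\<in>K. \<forall>u\<in>dom B. ?h (the (B u)) v = ?h u w)"
      then obtain z y where zy: "v = S z" "\<forall>u\<in>dom B. ?h (the (B u)) (S z) = ?h u (S y)"
        using SJ(3) by blast
      have "cinner x (J z) = cinner x (S (S (J y)))" for x
        using zy(2) key by (auto simp: domB)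
      then have "J z = S (S (J y))" by (rule cinner_right_cancel)
      then have "v = G (S (J y))" by (simp add: zy SJ(10)) (metis SJ(5))
      then show False using False by (auto simp: domB)
    qed
    then have "op_adjoint K ?h B v = None" unfolding op_adjoint_def by simp
    then show ?thesis using False by (simp add: domIff)
  qed
  then show "J_self_adjoint K q (restr K)"
    unfolding J_self_adjoint_def self_adjoint_def B_def[symmetric] using lin dense by blast
  show "J_non_negative K q (restr K)"
    unfolding J_non_negative_def non_negative_def B_def[symmetric]
  proof
    fix u assume "u \<in> dom B"
    from this[unfolded domB] obtain x where u: "u = G (S x)" by blast
    have "?h (the (B u)) u = cinner (S x) (S x)"
      unfolding u B option.sel by (simp add: SJ(5,7,10) hermitianD[OF SJ(4)] hermitianD[OF hS])
    then show "?h (the (B u)) u \<in> \<real>\<^sub>\<ge>\<^sub>0" by (simp add: cinner_self)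
  qed
  show "boundedly_invertible K ?h (restr K)"
    unfolding boundedly_invertible_def dom_restr
  proof
    show "bij_betw (\<lambda>u. the (restr K u)) (G ` K) K"
      by (rule bij_betw_byWitness[where f' = G]) (auto simp: restr_G)
    obtain C where C: "C > 0" "\<And>x. norm (J (S (S x))) \<le> C * norm x"
      using bounded_clinear_bound[OF bounded_clinear_compose[OF bJ bounded_clinear_compose[OF bS bS]]] by blast
    have nrm: "ip_norm ?h (S x) = norm x" for x by (simp add: ip_norm_def SJ(7) cinner_self)
    show "\<exists>C. \<forall>u\<in>G ` K. ip_norm ?h u \<le> C * ip_norm ?h (the (restr K u))"
    proof (intro exI[of _ C] ballI)
      fix u assume "u \<in> G ` K"
      then obtain k where k: "k \<in> K" "u = G k" by blast
      from k(1) have "k \<in> range S" by (simp only: SJ(3))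
      then obtain x where "u = G (S x)" using k(2) by blast
      then show "ip_norm ?h u \<le> C * ip_norm ?h (the (restr K u))"
        by (simp add: restr_G[OF SK] nrm C(2)) (simp add: SJ(10) nrm C(2))
    qed
  qed
qed

end

section \<open>The eigenspectral function\<close>

instance bcontfun :: (metric_space, banach) banach ..

text \<open>The symbol of \<open>(1 - mu G)^-1\<close>. Since \<open>T\<close> is the inverse of
  \<open>G\<close>, its resolvent is \<open>G\<close> times this operator; the factor
  \<open>G\<close> is kept apart because it carries convergence from \<open>H\<close> into
  \<open>K\<close>.\<close>

definition rsym :: "complex \<Rightarrow> real \<Rightarrow> complex"
  where "rsym \<mu> t = 1 / (1 - \<mu> * of_real t)"

text \<open>The imaginary part of the denominator is \<open>- t Im mu\<close>; after multiplication
  by \<open>cnj mu\<close> it becomes \<open>- Im mu\<close>, independent of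
  \<open>t\<close>.\<close>

lemma rsym_denominator:
  assumes "Im \<mu> \<noteq> 0"
  shows "\<bar>Im \<mu>\<bar> * \<bar>t\<bar> \<le> norm (1 - \<mu> * of_real t)" "\<bar>Im \<mu>\<bar> \<le> norm \<mu> * norm (1 - \<mu> * of_real t)"
    "1 - \<mu> * of_real t \<noteq> 0"
proof -
  show 1: "\<bar>Im \<mu>\<bar> * \<bar>t\<bar> \<le> norm (1 - \<mu> * of_real t)"
    using abs_Im_le_cmod[of "1 - \<mu> * of_real t"] by (simp add: abs_mult)
  have "\<bar>Im (cnj \<mu> * (1 - \<mu> * of_real t))\<bar> = \<bar>Im \<mu>\<bar>"
    by (simp add: algebra_simps)
  then show 2: "\<bar>Im \<mu>\<bar> \<le> norm \<mu> * norm (1 - \<mu> * of_real t)"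
    using abs_Im_le_cmod[of "cnj \<mu> * (1 - \<mu> * of_real t)"] by (simp add: norm_mult)
  show "1 - \<mu> * of_real t \<noteq> 0"
  proof
    assume "1 - \<mu> * of_real t = 0"
    with 2 assms show False by simp
  qed
qed

lemma rsym_continuous: "Im \<mu> \<noteq> 0 \<Longrightarrow> continuous_on A (rsym \<mu>)"
  unfolding rsym_def using rsym_denominator(3) by (intro continuous_intros) auto

lemma norm_rsym_le:
  assumes "Im \<mu> \<noteq> 0" shows "norm (rsym \<mu> t) \<le> norm \<mu> / \<bar>Im \<mu>\<bar>" "norm (rsym \<mu> t) * \<bar>t\<bar> \<le> 1 / \<bar>Im \<mu>\<bar>"
  using rsym_denominator[OF assms, of t] assms
  by (auto simp: rsym_def norm_divide field_simps)

lemma norm_rsym_diff: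
  assumes "Im \<mu> \<noteq> 0" "Im \<nu> \<noteq> 0"
  shows "norm (rsym \<mu> t - rsym \<nu> t) \<le> norm (\<mu> - \<nu>) * (1 / \<bar>Im \<mu>\<bar> * (norm \<nu> / \<bar>Im \<nu>\<bar>))"
proof -
  \<comment> \<open>The resolvent identity for symbols. The factor \<open>t\<close> is paired with
    one of the quotients, where it stays bounded.\<close>
  have "rsym \<mu> t - rsym \<nu> t = (\<mu> - \<nu>) * ((rsym \<mu> t * of_real t) * rsym \<nu> t)"
    using rsym_denominator(3)[OF assms(1), of t] rsym_denominator(3)[OF assms(2), of t]
    by (simp add: rsym_def field_simps)
  then have "norm (rsym \<mu> t - rsym \<nu> t) = norm (\<mu> - \<nu>) * ((norm (rsym \<mu> t) * \<bar>t\<bar>) * norm (rsym \<nu> t))"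
    by (simp add: norm_mult)
  also have "\<dots> \<le> norm (\<mu> - \<nu>) * (1 / \<bar>Im \<mu>\<bar> * (norm \<nu> / \<bar>Im \<nu>\<bar>))"
    using norm_rsym_le[OF assms(1), of t] norm_rsym_le[OF assms(2), of t]
    by (intro mult_left_mono mult_mono) auto
  finally show ?thesis .
qed

text \<open>The integral of \<open>1 / (1 - mu t)\<close> over \<open>mu\<close> along the segment
  from \<open>a\<close> to \<open>b\<close>; at \<open>t = 0\<close> the integrand is 1.\<close>

definition seg_sym :: "complex \<Rightarrow> complex \<Rightarrow> real \<Rightarrow> complex"
  where "seg_sym a b t = (if t = 0 then b - a else (Ln (1 - a * of_real t) - Ln (1 - b * of_real t)) / of_real t)"

lemma Im_linepath: "Im (linepath a b s) = (1 - s) * Im a + s * Im b"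
  by (simp add: linepath_def)

lemma Im_linepath_ge:
  assumes "Im a * Im b > 0" "s \<in> {0..1}"
  shows "min \<bar>Im a\<bar> \<bar>Im b\<bar> \<le> \<bar>Im (linepath a b s)\<bar>" "Im (linepath a b s) \<noteq> 0"
proof -
  let ?m = "min \<bar>Im a\<bar> \<bar>Im b\<bar>"
  have m: "?m > 0" using assms(1) by (auto simp: zero_less_mult_iff)
  have e: "?m = (1 - s) * ?m + s * ?m" by (simp add: algebra_simps)
  have le: "(1 - s) * ?m + s * ?m \<le> (1 - s) * \<bar>Im a\<bar> + s * \<bar>Im b\<bar>"
    using assms(2) by (intro add_mono mult_left_mono) auto
  have "\<bar>Im (linepath a b s)\<bar> = (1 - s) * \<bar>Im a\<bar> + s * \<bar>Im b\<bar>"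
  proof -
    from assms(1) consider "Im a > 0" "Im b > 0" | "Im a < 0" "Im b < 0" by (auto simp: zero_less_mult_iff)
    then show ?thesis
    proof cases
      case 1
      then show ?thesis using assms(2) by (simp add: Im_linepath)
    next
      case 2
      then have "(1 - s) * Im a + s * Im b \<le> 0"
        using assms(2) by (intro add_nonpos_nonpos mult_nonneg_nonpos) auto
      then show ?thesis using 2 by (simp add: Im_linepath)
    qed
  qed
  with e le show "?m \<le> \<bar>Im (linepath a b s)\<bar>" by linarith
  with m show "Im (linepath a b s) \<noteq> 0" by auto
qed

lemma seg_sym_integral:
  assumes "Im a * Im b > 0"
  shows "((\<lambda>s. (b - a) * rsym (linepath a b s) t) has_integral seg_sym a b t) {0..1}"
proof (cases "t = 0")
  case True
  then show ?thesis using has_integral_const_real[of "b - a" 0 1] by (simp add: rsym_def seg_sym_def)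
next
  case False
  define F where "F s = - (Ln (1 - linepath a b s * of_real t) / of_real t)" for s
  have "((\<lambda>s. (b - a) * rsym (linepath a b s) t) has_integral F 1 - F 0) {0..1}"
  proof (rule fundamental_theorem_of_calculus)
    fix s :: real assume s: "s \<in> {0..1}"
    let ?z = "1 - linepath a b s * of_real t"
    \<comment> \<open>The segment stays in an open half plane, so the argument of \<open>Ln\<close>
      never meets the branch cut and \<open>F\<close> is an antiderivative.\<close>
    have "Im ?z \<noteq> 0" using Im_linepath_ge(2)[OF assms s] False by simp
    then have z: "?z \<notin> \<real>\<^sub>\<le>\<^sub>0" by (auto simp: complex_nonpos_Reals_iff)
    have z0: "?z \<noteq> 0" by (rule rsym_denominator(3)[OF Im_linepath_ge(2)[OF assms s]])
    have "((\<lambda>s. 1 - linepath a b s * of_real t) has_vector_derivative - ((b - a) * of_real t)) (at s within {0..1})"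
      unfolding linepath_def
      by (auto intro!: derivative_eq_intros simp: algebra_simps scaleR_conv_of_real)
    note field_vector_diff_chain_within[OF this, where g = Ln and g' = "inverse ?z",
        OF has_field_derivative_at_within[OF has_field_derivative_Ln[OF z]]]
    then have "((\<lambda>s. Ln (1 - linepath a b s * of_real t)) has_vector_derivative
        (- ((b - a) * of_real t) * inverse ?z)) (at s within {0..1})"
      by (simp only: o_def)
    then have "(F has_vector_derivative - ((- ((b - a) * of_real t) * inverse ?z) / of_real t)) (at s within {0..1})"
      unfolding F_def by (intro derivative_intros has_vector_derivative_divide)
    also have "- ((- ((b - a) * of_real t) * inverse ?z) / of_real t) = (b - a) * rsym (linepath a b s) t"
      using False z0 by (simp add: rsym_def field_simps)
    finally show "(F has_vector_derivative (b - a) * rsym (linepath a b s) t) (at s within {0..1})" .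
  qed simp
  moreover have "F 1 - F 0 = seg_sym a b t"
    using False by (simp add: F_def seg_sym_def linepath_def diff_divide_distrib)
  ultimately show ?thesis by simp
qed

section \<open>Operator integrals along a segment\<close>

context hermitian_bound
begin

definition op :: "(real \<Rightarrow> complex) \<Rightarrow> 'h \<Rightarrow> 'h"
  where "op \<phi> = (THE X. fcalc \<phi> X)"

lemma op_eq: "fcalc \<phi> X \<Longrightarrow> op \<phi> = X"
  unfolding op_def by (rule the_equality) (auto intro: fcalc_unique)

lemma fcalc_op: "fcalc \<phi> X \<Longrightarrow> fcalc \<phi> (op \<phi>)"
  using op_eq by blast

lemma fcalc_op_continuous: "continuous_on I \<phi> \<Longrightarrow> fcalc \<phi> (op \<phi>)"
  by (metis fcalc_continuous fcalc_op)

lemma fcalc_op_rsym: "Im \<mu> \<noteq> 0 \<Longrightarrow> fcalc (rsym \<mu>) (op (rsym \<mu>))"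
  by (intro fcalc_op_continuous rsym_continuous)

lemma op_rsym_inverse:
  assumes "Im \<mu> \<noteq> 0"
  shows "op (rsym \<mu>) x - \<mu> *\<^sub>C G (op (rsym \<mu>) x) = x" "op (rsym \<mu>) (x - \<mu> *\<^sub>C G x) = x"
proof -
  note R = fcalc_op_rsym[OF assms]
  have e: "rsym \<mu> t - \<mu> * (of_real t * rsym \<mu> t) = 1" for t
    using rsym_denominator(3)[OF assms, of t] by (simp add: rsym_def field_simps)
  have "fcalc (\<lambda>t. rsym \<mu> t + (- \<mu>) * (of_real t * rsym \<mu> t)) (\<lambda>x. op (rsym \<mu>) x + (- \<mu>) *\<^sub>C G (op (rsym \<mu>) x))"
    by (intro fcalc_add[OF R fcalc_scale[OF fcalc_G[OF R]]])
  then have "(\<lambda>x. op (rsym \<mu>) x + (- \<mu>) *\<^sub>C G (op (rsym \<mu>) x)) = (\<lambda>x. x)"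
    by (rule fcalc_unique[OF _ fcalc_id]) (simp add: e)
  from fun_cong[OF this] show 1: "op (rsym \<mu>) x - \<mu> *\<^sub>C G (op (rsym \<mu>) x) = x" for x by simp
  note lin = bounded_clinearD[OF fcalc_bounded_clinear[OF R]]
  have "op (rsym \<mu>) (G x) = G (op (rsym \<mu>) x)"
    by (rule fcalc_commute[OF R hermitian_bounded_clinear[OF herm], symmetric]) simp
  then show "op (rsym \<mu>) (x - \<mu> *\<^sub>C G x) = x" using 1[of x] by (simp add: lin)
qed

text \<open>
  Bounded continuous functions form a Banach space on which both the evaluations and
  \<open>v \<mapsto> op v f\<close> are bounded, so operator integrals are computed pointwise on symbols.
\<close>

lemma segment_fcalc:
  assumes ab: "Im a * Im b > 0"
  shows "fcalc (seg_sym a b) (op (seg_sym a b))"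
    "((\<lambda>s. (b - a) *\<^sub>C op (rsym (linepath a b s)) f) has_integral op (seg_sym a b) f) {0..1}"
proof -
  define d where "d = min \<bar>Im a\<bar> \<bar>Im b\<bar>"
  have d: "d > 0" using ab by (auto simp: d_def zero_less_mult_iff)
  define B where "B = norm a + norm b"
  have B: "B \<ge> 0" by (simp add: B_def)
  let ?l = "linepath a b"
  have Iml: "d \<le> \<bar>Im (?l s)\<bar>" "Im (?l s) \<noteq> 0" if "s \<in> {0..1}" for s
    using Im_linepath_ge[OF ab that] by (simp_all add: d_def)
  have nl: "norm (?l s) \<le> B" if "s \<in> {0..1}" for s
  proof -
    have "norm (?l s) \<le> \<bar>1 - s\<bar> * norm a + \<bar>s\<bar> * norm b"
      unfolding linepath_def by (rule norm_triangle_mono) auto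
    also have "\<dots> \<le> 1 * norm a + 1 * norm b" using that by (intro add_mono mult_right_mono) auto
    finally show ?thesis by (simp add: B_def)
  qed
  \<comment> \<open>Only \<open>s\<close> in \<open>[0, 1]\<close> matters: beyond it the line may
    meet the real axis, where the symbol is no bounded continuous function.\<close>
  define u where "u s = Bcontfun (\<lambda>t. (b - a) * rsym (?l s) t)" for s
  have u: "apply_bcontfun (u s) = (\<lambda>t. (b - a) * rsym (?l s) t)" if s: "s \<in> {0..1}" for s
    unfolding u_def
  proof (rule Bcontfun_inverse, rule bcontfun_normI)
    show "continuous_on UNIV (\<lambda>t. (b - a) * rsym (?l s) t)"
      by (intro continuous_intros rsym_continuous Iml s)
    show "norm ((b - a) * rsym (?l s) t) \<le> norm (b - a) * (norm (?l s) / \<bar>Im (?l s)\<bar>)" for t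
      unfolding norm_mult by (intro mult_left_mono norm_rsym_le Iml s) simp
  qed
  define C where "C = norm (b - a) * (norm (b - a) * (1 / d * (B / d)))"
  \<comment> \<open>The estimate from the resolvent identity is uniform in \<open>t\<close>, so the
    curve of symbols is Lipschitz in the supremum norm and has an integral there.\<close>
  have lip: "dist (u s) (u s') \<le> C * dist s s'" if s: "s \<in> {0..1}" "s' \<in> {0..1}" for s s'
  proof (rule dist_bound)
    fix t
    have "?l s - ?l s' = of_real (s - s') * (b - a)"
      by (simp add: linepath_def scaleR_conv_of_real algebra_simps)
    then have nd: "norm (?l s - ?l s') = \<bar>s - s'\<bar> * norm (b - a)" by (simp only: norm_mult norm_of_real)
    have "norm (rsym (?l s) t - rsym (?l s') t) \<le> norm (?l s - ?l s') * (1 / \<bar>Im (?l s)\<bar> * (norm (?l s') / \<bar>Im (?l s')\<bar>))"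
      by (intro norm_rsym_diff Iml s)
    also have "\<dots> \<le> norm (?l s - ?l s') * (1 / d * (B / d))"
      using Iml(1)[OF s(1)] Iml(1)[OF s(2)] nl[OF s(2)] d B
      by (intro mult_left_mono mult_mono frac_le) auto
    finally have "norm (b - a) * norm (rsym (?l s) t - rsym (?l s') t) \<le> norm (b - a) * (\<bar>s - s'\<bar> * norm (b - a) * (1 / d * (B / d)))"
      unfolding nd by (rule mult_left_mono) simp
    then show "dist (apply_bcontfun (u s) t) (apply_bcontfun (u s') t) \<le> C * dist s s'"
      by (simp add: u[OF s(1)] u[OF s(2)] dist_norm C_def right_diff_distrib[symmetric] norm_mult mult_ac)
  qed
  have "C \<ge> 0" using d by (simp add: C_def B_def)
  with lip have "C-lipschitz_on {0..1} u" by (simp add: lipschitz_on_def)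
  then have "continuous_on {0..1} u" by (rule lipschitz_on_continuous_on)
  then have "u integrable_on {0..1}" by (rule integrable_continuous_real)
  then obtain U where U: "(u has_integral U) {0..1}" unfolding integrable_on_def by (rule exE)
  \<comment> \<open>Evaluation at \<open>t\<close> is bounded and linear, hence commutes with the
    integral and identifies it with the scalar one.\<close>
  have "apply_bcontfun U t = seg_sym a b t" for t
  proof -
    have "bounded_linear (\<lambda>v :: real \<Rightarrow>\<^sub>C complex. apply_bcontfun v t)"
      by (rule bounded_linear_intro[of _ 1]) (auto intro: norm_bounded)
    from has_integral_linear[OF U this]
    have "((\<lambda>s. apply_bcontfun (u s) t) has_integral apply_bcontfun U t) {0..1}" by (simp add: o_def)
    then have "((\<lambda>s. (b - a) * rsym (?l s) t) has_integral apply_bcontfun U t) {0..1}"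
      by (rule has_integral_eq[rotated]) (simp add: u)
    with seg_sym_integral[OF ab] show ?thesis by (rule has_integral_unique[rotated])
  qed
  then have Useg: "apply_bcontfun U = seg_sym a b" by (rule ext)
  have fc: "fcalc (apply_bcontfun v) (op (apply_bcontfun v))" for v by (intro fcalc_op_continuous) simp
  show "fcalc (seg_sym a b) (op (seg_sym a b))" using fc[of U] by (simp add: Useg)
  have "bounded_linear (\<lambda>v. op (apply_bcontfun v) f)"
  proof (rule bounded_linear_intro[of _ "norm f"])
    fix v w :: "real \<Rightarrow>\<^sub>C complex" and r :: real
    show "op (apply_bcontfun (v + w)) f = op (apply_bcontfun v) f + op (apply_bcontfun w) f"
      using fun_cong[OF op_eq[OF fcalc_add[OF fc[of v] fc[of w]]], of f]
      by (simp add: plus_bcontfun.rep_eq)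
    have "apply_bcontfun (r *\<^sub>R v) = (\<lambda>t. of_real r * apply_bcontfun v t)"
      by (simp add: scaleR_conv_of_real fun_eq_iff)
    then show "op (apply_bcontfun (r *\<^sub>R v)) f = r *\<^sub>R op (apply_bcontfun v) f"
      using fun_cong[OF op_eq[OF fcalc_scale[OF fc[of v], of "of_real r"]], of f]
      by (simp add: scaleR_scaleC)
    show "norm (op (apply_bcontfun v) f) \<le> norm v * norm f"
      by (rule fcalc_norm_le[OF fc]) (auto intro: norm_bounded)
  qed
  from has_integral_linear[OF U this]
  have "((\<lambda>s. op (apply_bcontfun (u s)) f) has_integral op (seg_sym a b) f) {0..1}"
    by (simp add: o_def Useg)
  then show "((\<lambda>s. (b - a) *\<^sub>C op (rsym (linepath a b s)) f) has_integral op (seg_sym a b) f) {0..1}"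
  proof (rule has_integral_eq[rotated])
    fix s :: real assume s: "s \<in> {0..1}"
    show "op (apply_bcontfun (u s)) f = (b - a) *\<^sub>C op (rsym (?l s)) f"
      unfolding u[OF s] op_eq[OF fcalc_scale[OF fcalc_op_rsym[OF Iml(2)[OF s]]]] ..
  qed
qed

end

definition theta :: "real \<Rightarrow> real \<Rightarrow> real"
  where "theta x e = Im (Ln (Complex x (- e)))"

text \<open>Multiplied by \<open>t\<close>, this is the Cauchy integral of the scalar
  \<open>1 / t\<close> over the cut polygon: the angle swept between the two gaps, divided by
  \<open>pi\<close>.\<close>

definition cut_sym :: "real \<Rightarrow> real \<Rightarrow> real \<Rightarrow> real \<Rightarrow> complex"
  where "cut_sym \<delta> \<alpha> \<beta> t =
    of_real ((theta (1 - \<alpha> * t) (\<delta> * \<bar>t\<bar>) - theta (1 - \<beta> * t) (\<delta> * \<bar>t\<bar>)) / (pi * \<bar>t\<bar>))"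

lemma Ln_diff_cnj:
  assumes "t \<noteq> 0" "\<delta> > 0"
  shows "Ln (1 - Complex c \<delta> * of_real t) - Ln (1 - Complex c (- \<delta>) * of_real t) =
    2 * \<i> * of_real (sgn t * theta (1 - c * t) (\<delta> * \<bar>t\<bar>))"
proof -
  let ?z = "1 - Complex c \<delta> * of_real t"
  have ne: "?z \<notin> \<real>\<^sub>\<le>\<^sub>0" using assms by (auto simp: complex_nonpos_Reals_iff)
  have z: "1 - Complex c (- \<delta>) * of_real t = cnj ?z" by (simp add: complex_eq_iff)
  have "Ln ?z - Ln (1 - Complex c (- \<delta>) * of_real t) = Ln ?z - cnj (Ln ?z)"
    unfolding z cnj_Ln[OF ne] ..
  also have "\<dots> = 2 * \<i> * of_real (Im (Ln ?z))" by (simp add: complex_eq_iff)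
  also have "Im (Ln ?z) = sgn t * theta (1 - c * t) (\<delta> * \<bar>t\<bar>)"
  proof (cases "t > 0")
    case True
    then have "?z = Complex (1 - c * t) (- (\<delta> * \<bar>t\<bar>))" by (simp add: complex_eq_iff)
    then show ?thesis using True by (simp add: theta_def)
  next
    case False
    then have "?z = cnj (Complex (1 - c * t) (- (\<delta> * \<bar>t\<bar>)))" using assms(1) by (simp add: complex_eq_iff)
    moreover have "Complex (1 - c * t) (- (\<delta> * \<bar>t\<bar>)) \<notin> \<real>\<^sub>\<le>\<^sub>0"
      using assms by (auto simp: complex_nonpos_Reals_iff)
    ultimately have "Ln ?z = cnj (Ln (Complex (1 - c * t) (- (\<delta> * \<bar>t\<bar>))))" by (simp add: cnj_Ln)
    then show ?thesis using False assms(1) by (simp add: theta_def)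
  qed
  finally show ?thesis .
qed

text \<open>The logarithms cancel at all corners of the polygon and survive only at the ends of the
  two gaps. These ends are conjugate points, so each gap leaves twice an imaginary part.\<close>

lemma cut_sym_eq:
  assumes "\<delta> > 0"
  shows "(- 1 / (2 * complex_of_real pi * \<i>)) *
    (seg_sym (Complex \<beta> \<delta>) (Complex \<beta> 1) t + seg_sym (Complex \<beta> 1) (Complex \<alpha> 1) t +
     seg_sym (Complex \<alpha> 1) (Complex \<alpha> \<delta>) t + seg_sym (Complex \<alpha> (- \<delta>)) (Complex \<alpha> (- 1)) t +
     seg_sym (Complex \<alpha> (- 1)) (Complex \<beta> (- 1)) t + seg_sym (Complex \<beta> (- 1)) (Complex \<beta> (- \<delta>)) t) =
    cut_sym \<delta> \<alpha> \<beta> t"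
proof (cases "t = 0")
  case True
  have "seg_sym (Complex \<beta> \<delta>) (Complex \<beta> 1) t + seg_sym (Complex \<beta> 1) (Complex \<alpha> 1) t +
     seg_sym (Complex \<alpha> 1) (Complex \<alpha> \<delta>) t + seg_sym (Complex \<alpha> (- \<delta>)) (Complex \<alpha> (- 1)) t +
     seg_sym (Complex \<alpha> (- 1)) (Complex \<beta> (- 1)) t + seg_sym (Complex \<beta> (- 1)) (Complex \<beta> (- \<delta>)) t = 0"
    using True by (simp add: seg_sym_def complex_eq_iff)
  then show ?thesis using True by (simp add: cut_sym_def)
next
  case False
  let ?L = "\<lambda>a b. Ln (1 - Complex a b * of_real t)"
  let ?th = "\<lambda>c. theta (1 - c * t) (\<delta> * \<bar>t\<bar>)"
  have sgn: "sgn t / t = 1 / \<bar>t\<bar>" using False by (simp add: sgn_if abs_if)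
  have gen: "(- 1 / (2 * complex_of_real pi * \<i>)) * (2 * \<i> * of_real x) = of_real (- x / pi)" for x
    by (simp add: field_simps)
  have "(seg_sym (Complex \<beta> \<delta>) (Complex \<beta> 1) t + seg_sym (Complex \<beta> 1) (Complex \<alpha> 1) t +
     seg_sym (Complex \<alpha> 1) (Complex \<alpha> \<delta>) t + seg_sym (Complex \<alpha> (- \<delta>)) (Complex \<alpha> (- 1)) t +
     seg_sym (Complex \<alpha> (- 1)) (Complex \<beta> (- 1)) t + seg_sym (Complex \<beta> (- 1)) (Complex \<beta> (- \<delta>)) t) =
    ((?L \<beta> \<delta> - ?L \<beta> (- \<delta>)) - (?L \<alpha> \<delta> - ?L \<alpha> (- \<delta>))) / of_real t"
    using False by (simp add: seg_sym_def diff_divide_distrib add_divide_distrib)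
  also have "\<dots> = 2 * \<i> * of_real (sgn t / t * (?th \<beta> - ?th \<alpha>))"
    unfolding Ln_diff_cnj[OF False assms] by (simp add: field_simps)
  finally have S: "(seg_sym (Complex \<beta> \<delta>) (Complex \<beta> 1) t + seg_sym (Complex \<beta> 1) (Complex \<alpha> 1) t +
     seg_sym (Complex \<alpha> 1) (Complex \<alpha> \<delta>) t + seg_sym (Complex \<alpha> (- \<delta>)) (Complex \<alpha> (- 1)) t +
     seg_sym (Complex \<alpha> (- 1)) (Complex \<beta> (- 1)) t + seg_sym (Complex \<beta> (- 1)) (Complex \<beta> (- \<delta>)) t) =
    2 * \<i> * of_real (sgn t / t * (?th \<beta> - ?th \<alpha>))" .
  have "- (sgn t / t * (?th \<beta> - ?th \<alpha>)) / pi = (?th \<alpha> - ?th \<beta>) / (pi * \<bar>t\<bar>)"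
    unfolding sgn using False by (simp add: field_simps)
  then show ?thesis unfolding S gen cut_sym_def by (simp only:)
qed

section \<open>Uniform bounds and limits of the polygon symbols\<close>

lemma abs_theta_le: "e > 0 \<Longrightarrow> \<bar>theta x e\<bar> \<le> pi"
proof -
  assume "e > 0"
  then have "Complex x (- e) \<noteq> 0" by (simp add: complex_eq_iff)
  from Im_Ln_le_pi[OF this] mpi_less_Im_Ln[OF this] show ?thesis by (simp add: theta_def)
qed

lemma theta_small:
  assumes "\<bar>c\<bar> + \<delta> \<le> R" "0 < \<delta>" "R * \<bar>t\<bar> < 1/2"
  shows "\<bar>theta (1 - c * t) (\<delta> * \<bar>t\<bar>)\<bar> \<le> 2 * R * \<bar>t\<bar>"
proof -
  let ?z = "Complex (- c * t) (- (\<delta> * \<bar>t\<bar>))"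
  have "norm ?z \<le> \<bar>c * t\<bar> + \<bar>\<delta> * \<bar>t\<bar>\<bar>" using cmod_le[of ?z] by simp
  also have "\<dots> = (\<bar>c\<bar> + \<delta>) * \<bar>t\<bar>" using assms(2) by (simp add: abs_mult algebra_simps)
  also have "\<dots> \<le> R * \<bar>t\<bar>" using assms(1) by (rule mult_right_mono) simp
  finally have z: "norm ?z \<le> R * \<bar>t\<bar>" .
  have "1 + ?z = Complex (1 - c * t) (- (\<delta> * \<bar>t\<bar>))" by (simp add: complex_eq_iff)
  then have "\<bar>theta (1 - c * t) (\<delta> * \<bar>t\<bar>)\<bar> \<le> norm (Ln (1 + ?z))"
    unfolding theta_def by (metis abs_Im_le_cmod)
  also have "\<dots> \<le> 2 * norm ?z" using z assms(3) by (intro norm_Ln_le) simp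
  finally show ?thesis using z by simp
qed

text \<open>A bound uniform in the gap and in \<open>t\<close>, as bounded pointwise limits require.
  Near \<open>t = 0\<close> both angles are of order \<open>t\<close>, which compensates the
  division; otherwise \<open>t\<close> is at least \<open>1 / (2 R)\<close> in modulus and the
  trivial bound \<open>pi\<close> on the angles suffices.\<close>

lemma norm_cut_sym_le:
  assumes "0 < \<delta>" "\<delta> \<le> 1" "\<bar>\<alpha>\<bar> + 1 \<le> R" "\<bar>\<beta>\<bar> + 1 \<le> R"
  shows "norm (cut_sym \<delta> \<alpha> \<beta> t) \<le> 4 * R"
proof -
  let ?th = "\<lambda>c. theta (1 - c * t) (\<delta> * \<bar>t\<bar>)"
  have R: "R > 0" using assms(3) by linarith
  have pi: "pi \<ge> 1" using pi_ge_two by linarith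
  have n: "norm (cut_sym \<delta> \<alpha> \<beta> t) = \<bar>?th \<alpha> - ?th \<beta>\<bar> / (pi * \<bar>t\<bar>)"
    unfolding cut_sym_def norm_of_real by (simp add: abs_mult)
  consider "t = 0" | "t \<noteq> 0" "R * \<bar>t\<bar> < 1/2" | "t \<noteq> 0" "R * \<bar>t\<bar> \<ge> 1/2" by linarith
  then show ?thesis
  proof cases
    case 1
    then show ?thesis using R unfolding n by simp
  next
    case 2
    have "\<bar>?th \<alpha>\<bar> \<le> 2 * R * \<bar>t\<bar>" "\<bar>?th \<beta>\<bar> \<le> 2 * R * \<bar>t\<bar>"
      using assms 2 by (auto intro!: theta_small)
    then have "\<bar>?th \<alpha> - ?th \<beta>\<bar> \<le> 4 * R * \<bar>t\<bar>" by linarith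
    also have "\<dots> \<le> 4 * R * (pi * \<bar>t\<bar>)"
      using R pi mult_right_mono[OF pi, of "\<bar>t\<bar>"] by simp
    finally show ?thesis unfolding n using 2 by (simp add: divide_le_eq)
  next
    case 3
    have "\<bar>?th \<alpha>\<bar> \<le> pi" "\<bar>?th \<beta>\<bar> \<le> pi" using assms(1) 3 by (auto intro!: abs_theta_le)
    then have "\<bar>?th \<alpha> - ?th \<beta>\<bar> \<le> pi * 2" by linarith
    also have "\<dots> \<le> pi * (4 * (R * \<bar>t\<bar>))" using 3 by (intro mult_left_mono) auto
    finally show ?thesis unfolding n using 3 by (simp add: divide_le_eq mult_ac)
  qed
qed

text \<open>The limiting argument when the real axis is approached from below. The middle value at
  \<open>x = 0\<close> is the half weight that a Cauchy integral gives to an endpoint; the later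
  shift of the endpoints removes it.\<close>

definition theta0 :: "real \<Rightarrow> real"
  where "theta0 x = (if x > 0 then 0 else if x = 0 then - pi / 2 else - pi)"

lemma theta_tendsto: "((\<lambda>e. theta x e) \<longlongrightarrow> theta0 x) (at_right 0)"
proof -
  have C: "((\<lambda>e. Complex y (- e)) \<longlongrightarrow> Complex y 0) (at_right 0)" for y
  proof -
    have "((\<lambda>e::real. Complex y (- e)) \<longlongrightarrow> Complex y (- 0)) (at_right 0)" by (intro tendsto_intros)
    then show ?thesis by simp
  qed
  have C': "((\<lambda>e. Complex y e) \<longlongrightarrow> Complex y 0) (at_right 0)" for y
    by (intro tendsto_intros)
  consider "x > 0" | "x = 0" | "x < 0" by linarith
  then show ?thesis
  proof cases
    case 1
    then have ne: "Complex x 0 \<notin> \<real>\<^sub>\<le>\<^sub>0" by (simp add: complex_nonpos_Reals_iff)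
    have "((\<lambda>e. theta x e) \<longlongrightarrow> Im (Ln (Complex x 0))) (at_right 0)"
      unfolding theta_def by (intro tendsto_Im isCont_tendsto_compose[OF continuous_at_Ln[OF ne]] C)
    moreover have "Complex x 0 = of_real x" by (simp add: complex_eq_iff)
    then have "Im (Ln (Complex x 0)) = 0" using 1 by (simp add: Ln_of_real)
    ultimately show ?thesis using 1 by (simp add: theta0_def)
  next
    case 2
    have "theta 0 e = - pi / 2" if "e > 0" for e
    proof -
      have "Complex 0 (- e) = of_real e * (- \<i>)" by (simp add: complex_eq_iff)
      then have "Ln (Complex 0 (- e)) = of_real (ln e) + Ln (- \<i>)"
        using that Ln_times_of_real[of e "- \<i>"] by (simp add: Ln_of_real)
      then show ?thesis by (simp add: theta_def)
    qed
    then have "\<forall>\<^sub>F e in at_right 0. theta x e = theta0 x"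
      using 2 by (auto simp: theta0_def eventually_at_right_field intro!: exI[of _ 1])
    then show ?thesis by (rule tendsto_eventually)
  next
    case 3
    \<comment> \<open>Negative \<open>x\<close> lies on the branch cut of \<open>Ln\<close>; a half
      turn moves the point to the positive axis at the cost of \<open>pi\<close>.\<close>
    then have ne: "Complex (- x) 0 \<notin> \<real>\<^sub>\<le>\<^sub>0" by (simp add: complex_nonpos_Reals_iff)
    have "((\<lambda>e. Im (Ln (Complex (- x) e)) - pi) \<longlongrightarrow> Im (Ln (Complex (- x) 0)) - pi) (at_right 0)"
      by (intro tendsto_diff tendsto_const tendsto_Im isCont_tendsto_compose[OF continuous_at_Ln[OF ne]] C')
    moreover have "Complex (- x) 0 = of_real (- x)" by (simp add: complex_eq_iff)
    then have "Im (Ln (Complex (- x) 0)) = 0" using 3 Ln_of_real[of "- x"] by simp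
    moreover have "\<forall>\<^sub>F e in at_right 0. Im (Ln (Complex (- x) e)) - pi = theta x e"
    proof -
      have "Im (Ln (Complex (- x) e)) - pi = theta x e" if "e > 0" for e
      proof -
        have "Complex x (- e) = - Complex (- x) e" by (simp add: complex_eq_iff)
        moreover have "Complex (- x) e \<noteq> 0" using that by (simp add: complex_eq_iff)
        ultimately show ?thesis using that Ln_minus[of "Complex (- x) e"] by (simp add: theta_def)
      qed
      then show ?thesis by (auto simp: eventually_at_right_field intro!: exI[of _ 1])
    qed
    ultimately show ?thesis using 3 by (simp add: theta0_def filterlim_cong)
  qed
qed

definition cut_sym0 :: "real \<Rightarrow> real \<Rightarrow> real \<Rightarrow> complex"
  where "cut_sym0 \<alpha> \<beta> t = of_real ((theta0 (1 - \<alpha> * t) - theta0 (1 - \<beta> * t)) / (pi * \<bar>t\<bar>))"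

lemma cut_sym_tendsto: "((\<lambda>\<delta>. cut_sym \<delta> \<alpha> \<beta> t) \<longlongrightarrow> cut_sym0 \<alpha> \<beta> t) (at_right 0)"
proof (cases "t = 0")
  case False
  have "filterlim (\<lambda>\<delta>. \<delta> * \<bar>t\<bar>) (at_right 0) (at_right 0)"
    unfolding filterlim_at
  proof
    show "\<forall>\<^sub>F \<delta> in at_right 0. \<delta> * \<bar>t\<bar> \<in> {0<..} \<and> \<delta> * \<bar>t\<bar> \<noteq> 0"
      using False by (auto simp: eventually_at_right_field intro!: exI[of _ 1])
    have "((\<lambda>\<delta>. \<delta> * \<bar>t\<bar>) \<longlongrightarrow> 0 * \<bar>t\<bar>) (at_right 0)" by (intro tendsto_intros)
    then show "((\<lambda>\<delta>. \<delta> * \<bar>t\<bar>) \<longlongrightarrow> 0) (at_right 0)" by simp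
  qed
  then have "((\<lambda>\<delta>. theta x (\<delta> * \<bar>t\<bar>)) \<longlongrightarrow> theta0 x) (at_right 0)" for x
    by (rule filterlim_compose[OF theta_tendsto])
  then show ?thesis unfolding cut_sym_def cut_sym0_def
    using False by (intro tendsto_intros) auto
qed (simp add: cut_sym_def cut_sym0_def)

lemma norm_cut_sym0_le:
  assumes "\<bar>\<alpha>\<bar> + 1 \<le> R" "\<bar>\<beta>\<bar> + 1 \<le> R" shows "norm (cut_sym0 \<alpha> \<beta> t) \<le> 4 * R"
proof (rule tendsto_upperbound[OF tendsto_norm[OF cut_sym_tendsto]])
  show "\<forall>\<^sub>F \<delta> in at_right 0. norm (cut_sym \<delta> \<alpha> \<beta> t) \<le> 4 * R"
    using norm_cut_sym_le assms by (auto simp: eventually_at_right_field intro!: exI[of _ 1])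
qed simp

text \<open>The indicator of the interval for the spectral variable \<open>1 / t\<close> of
  \<open>T\<close>. The point \<open>t = 0\<close> stands for infinity and is excluded explicitly,
  because the convention \<open>1 / 0 = 0\<close> would place it in every interval around 0.\<close>

definition int_sym :: "real \<Rightarrow> real \<Rightarrow> real \<Rightarrow> complex"
  where "int_sym a b t = (if t \<noteq> 0 \<and> a \<le> 1 / t \<and> 1 / t \<le> b then 1 else 0)"

lemma theta0_tendsto:
  "((\<lambda>\<epsilon>. theta0 (1 - (b + \<epsilon>) * t)) \<longlongrightarrow>
    (if t > 0 then (if b * t \<ge> 1 then - pi else 0) else (if b * t > 1 then - pi else 0))) (at_right 0)"
  if "t \<noteq> 0" for b t
proof (rule tendsto_eventually)
  \<comment> \<open>The distance from \<open>b\<close> to \<open>1 / t\<close>. For a positive shift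
    below it the sign of \<open>1 - (b + \<epsilon>) * t\<close> is constant; if it is zero, any
    positive shift will do.\<close>
  define g where "g = \<bar>1 - b * t\<bar> / \<bar>t\<bar>"
  have "theta0 (1 - (b + \<epsilon>) * t) = (if t > 0 then (if b * t \<ge> 1 then - pi else 0) else (if b * t > 1 then - pi else 0))"
    if \<epsilon>: "0 < \<epsilon>" "\<epsilon> < (if g = 0 then 1 else g)" for \<epsilon>
  proof -
    have s: "0 < \<epsilon> * \<bar>t\<bar>" using \<epsilon> \<open>t \<noteq> 0\<close> by simp
    have l: "\<epsilon> * \<bar>t\<bar> < \<bar>1 - b * t\<bar>" if "b * t \<noteq> 1"
    proof -
      have "g \<noteq> 0" using that \<open>t \<noteq> 0\<close> by (simp add: g_def)
      then show ?thesis using \<epsilon>(2) \<open>t \<noteq> 0\<close> by (simp add: g_def less_divide_eq)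
    qed
    have e: "1 - (b + \<epsilon>) * t = (1 - b * t) - \<epsilon> * t" by (simp add: algebra_simps)
    show ?thesis
    proof (cases "t > 0")
      case True
      then show ?thesis using s l unfolding e theta0_def by (cases "b * t = 1") (auto simp: abs_if split: if_splits)
    next
      case False
      then show ?thesis using s l unfolding e theta0_def by (cases "b * t = 1") (auto simp: abs_if split: if_splits)
    qed
  qed
  moreover have "g \<ge> 0" by (simp add: g_def)
  ultimately show "\<forall>\<^sub>F \<epsilon> in at_right 0. theta0 (1 - (b + \<epsilon>) * t) =
      (if t > 0 then (if b * t \<ge> 1 then - pi else 0) else (if b * t > 1 then - pi else 0))"
    unfolding eventually_at_right_field by (intro exI[of _ "if g = 0 then 1 else g"]) auto
qed

lemma theta0_tendsto':
  "((\<lambda>\<epsilon>. theta0 (1 - (a - \<epsilon>) * t)) \<longlongrightarrow>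
    (if t > 0 then (if a * t > 1 then - pi else 0) else (if a * t \<ge> 1 then - pi else 0))) (at_right 0)"
  if "t \<noteq> 0" for a t
proof -
  have e: "1 - (a - \<epsilon>) * t = 1 - (- a + \<epsilon>) * (- t)" for \<epsilon> by (simp add: algebra_simps)
  show ?thesis unfolding e using theta0_tendsto[of "- t" "- a"] \<open>t \<noteq> 0\<close>
    by (cases "t > 0") (simp_all add: not_less)
qed

text \<open>Moving the endpoints outwards makes both of them count fully. The factor
  \<open>1 / t\<close> remains because a factor \<open>G\<close> was split off from the
  resolvent.\<close>

lemma cut_sym0_tendsto:
  assumes "a \<le> b"
  shows "((\<lambda>\<epsilon>. cut_sym0 (a - \<epsilon>) (b + \<epsilon>) t) \<longlongrightarrow> of_real (1 / t) * int_sym a b t) (at_right 0)"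
proof (cases "t = 0")
  case False
  let ?A = "if t > 0 then (if a * t > 1 then - pi else 0) else (if a * t \<ge> 1 then - pi else (0::real))"
  let ?B = "if t > 0 then (if b * t \<ge> 1 then - pi else 0) else (if b * t > 1 then - pi else (0::real))"
  have "((\<lambda>\<epsilon>. cut_sym0 (a - \<epsilon>) (b + \<epsilon>) t) \<longlongrightarrow> of_real ((?A - ?B) / (pi * \<bar>t\<bar>))) (at_right 0)"
    unfolding cut_sym0_def using False
    by (intro tendsto_of_real tendsto_divide tendsto_diff theta0_tendsto theta0_tendsto' tendsto_const) auto
  moreover have "complex_of_real ((?A - ?B) / (pi * \<bar>t\<bar>)) = of_real (1 / t) * int_sym a b t"
  proof (cases "t > 0")
    case True
    have "a * t \<le> b * t" using assms True by simp
    then have "1 < a * t \<longrightarrow> 1 \<le> b * t" by linarith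
    then show ?thesis using True unfolding int_sym_def
      by (auto simp: le_divide_eq divide_le_eq)
  next
    case neg: False
    then have "b * t \<le> a * t" using assms by (simp add: mult_right_mono_neg)
    then have "1 < b * t \<longrightarrow> 1 \<le> a * t" by linarith
    then show ?thesis using neg False unfolding int_sym_def
      by (auto simp: le_divide_eq divide_le_eq)
  qed
  ultimately show ?thesis by simp
qed (simp add: cut_sym0_def int_sym_def)

section \<open>Limits and integrals in the topology of a completion\<close>

lemma lim_in_eq:
  "limitin X g l F \<Longrightarrow> Hausdorff_space X \<Longrightarrow> F \<noteq> bot \<Longrightarrow> lim_in X g F = l"
  unfolding lim_in_def by (rule the_equality) (auto intro: limitin_Hausdorff_unique)

locale spectral_setup = inverse_operator G T + hermitian_bound G m
  for G :: "'h::chilbert_space \<Rightarrow> 'h" and T m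
begin

text \<open>The vector \<open>y\<close> solving \<open>y - mu G y = f\<close> equals
  \<open>f + mu G y\<close>, hence lies in \<open>K\<close> along with \<open>f\<close>. So the
  resolvent computed in \<open>H\<close> is that of the restriction.\<close>

lemma resolvent_restr:
  assumes c: "embedded_completion T K q" and f: "f \<in> K" and \<mu>: "Im \<mu> \<noteq> 0"
  shows "resolvent (restr K) \<mu> f = G (op (rsym \<mu>) f)"
  unfolding resolvent_def
proof (rule the_equality)
  have sub: "csubspace K" and GK: "G x \<in> K" for x
    using c operator_form_T
    by (auto simp: embedded_completion_def krein_completion_def krein_space_def sesquilinear_on_def)
  let ?y = "op (rsym \<mu>) f"
  have "?y = f + \<mu> *\<^sub>C G ?y" using op_rsym_inverse(1)[OF \<mu>, of f] by (metis diff_eq_eq)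
  then have yK: "?y \<in> K"
    using f GK complex_vector.subspace_add[OF sub] complex_vector.subspace_scale[OF sub] by metis
  then show "G ?y \<in> dom (restr K) \<and> the (restr K (G ?y)) - \<mu> *\<^sub>C G ?y = f"
    using op_rsym_inverse(1)[OF \<mu>, of f] unfolding dom_restr restr_G[OF yK] by simp
  fix u assume u: "u \<in> dom (restr K) \<and> the (restr K u) - \<mu> *\<^sub>C u = f"
  from u[unfolded dom_restr] obtain k where k: "k \<in> K" "u = G k" by blast
  have "k - \<mu> *\<^sub>C G k = f" using u k by (simp add: restr_G)
  then show "u = G ?y" using op_rsym_inverse(2)[OF \<mu>, of k] k(2) by simp
qed

text \<open>Each Riemann sum of the resolvent in \<open>K\<close> is \<open>G\<close> applied to a
  Riemann sum in \<open>H\<close>. In the chart \<open>G\<close> becomes the bounded map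
  \<open>J S\<close>, so convergence in \<open>H\<close> implies convergence in
  \<open>K\<close>.\<close>

lemma segment_integral_resolvent:
  assumes c: "embedded_completion T K q" and f: "f \<in> K" and ab: "Im a * Im b > 0"
  shows "segment_integral (krein_topology K q) a b (\<lambda>\<mu>. resolvent (restr K) \<mu> f) = G (op (seg_sym a b) f)"
proof -
  obtain S J where SJ: "positive S" "inj S" "range S = K" "hermitian J"
    "homeomorphic_maps euclidean (krein_topology K q) S (inv S)" "\<And>x. G x = S (J (S x))"
    by (rule completion_chart[OF c], rule that)
  have kr: "krein_space K q" using c by (simp add: embedded_completion_def krein_completion_def)
  have "hermitian S" using SJ(1) by (simp add: positive_def)
  then have bJS: "bounded_clinear (\<lambda>x. J (S x))"
    by (rule bounded_clinear_compose[OF hermitian_bounded_clinear[OF SJ(4)] hermitian_bounded_clinear])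
  let ?R = "\<lambda>s. (b - a) *\<^sub>C op (rsym (linepath a b s)) f"
  have "((\<lambda>p. \<Sum>(s, k)\<in>p. measure lborel k *\<^sub>R ?R s) \<longlongrightarrow> op (seg_sym a b) f) (division_filter {0..1})"
    using segment_fcalc(2)[OF ab, of f] has_integral_cbox[of ?R _ 0 1] by simp
  then have "((\<lambda>p. J (S (\<Sum>(s, k)\<in>p. measure lborel k *\<^sub>R ?R s))) \<longlongrightarrow> J (S (op (seg_sym a b) f))) (division_filter {0..1})"
    by (rule bounded_clinear_tendsto[OF bJS])
  then have lim: "limitin (krein_topology K q) (\<lambda>p. G (\<Sum>(s, k)\<in>p. measure lborel k *\<^sub>R ?R s))
      (G (op (seg_sym a b) f)) (division_filter {0..1})"
    unfolding SJ(6) chart_limitin[OF SJ(5,2)] .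
  have "\<forall>\<^sub>F p in division_filter {0..1::real}. G (\<Sum>(s, k)\<in>p. measure lborel k *\<^sub>R ?R s) =
     (\<Sum>(s, k)\<in>p. complex_of_real (measure lborel k) *\<^sub>C ((b - a) *\<^sub>C resolvent (restr K) (linepath a b s) f))"
    using eventually_division_filter_tagged_division
  proof eventually_elim
    fix p assume p: "p tagged_division_of {0..1::real}"
    have "linear G" using bG by (simp add: bounded_clinear_def bounded_linear.linear)
    then have "G (\<Sum>(s, k)\<in>p. measure lborel k *\<^sub>R ?R s) = (\<Sum>x\<in>p. G (case x of (s, k) \<Rightarrow> measure lborel k *\<^sub>R ?R s))"
      by (rule linear_sum)
    also have "\<dots> = (\<Sum>(s, k)\<in>p. complex_of_real (measure lborel k) *\<^sub>C ((b - a) *\<^sub>C resolvent (restr K) (linepath a b s) f))"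
    proof (rule sum.cong[OF refl])
      fix x assume x: "x \<in> p"
      obtain s k where sk: "x = (s, k)" by (cases x)
      have "s \<in> {0..1}" using tag_in_interval[OF p x[unfolded sk]] .
      then have "Im (linepath a b s) \<noteq> 0" by (rule Im_linepath_ge(2)[OF ab])
      then show "G (case x of (s, k) \<Rightarrow> measure lborel k *\<^sub>R ?R s) = (case x of (s, k) \<Rightarrow>
          complex_of_real (measure lborel k) *\<^sub>C ((b - a) *\<^sub>C resolvent (restr K) (linepath a b s) f))"
        by (simp add: sk resolvent_restr[OF c f] G_lin scaleR_scaleC)
    qed
    finally show "G (\<Sum>(s, k)\<in>p. measure lborel k *\<^sub>R ?R s) =
     (\<Sum>(s, k)\<in>p. complex_of_real (measure lborel k) *\<^sub>C ((b - a) *\<^sub>C resolvent (restr K) (linepath a b s) f))" .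
  qed
  from limitin_transform_eventually[OF this lim] show ?thesis
    unfolding segment_integral_def
    using division_filter_not_empty[of "0::real" 1]
    by (intro lim_in_eq Hausdorff_krein_topology[OF kr]) simp_all
qed

lemma cut_polygon_resolvent:
  assumes c: "embedded_completion T K q" and f: "f \<in> K" and \<delta>: "0 < \<delta>"
  shows "fcalc (cut_sym \<delta> \<alpha> \<beta>) (op (cut_sym \<delta> \<alpha> \<beta>))"
    "(- 1 / (2 * complex_of_real pi * \<i>)) *\<^sub>C
      cut_polygon_integral (krein_topology K q) \<alpha> \<beta> \<delta> (\<lambda>\<mu>. resolvent (restr K) \<mu> f) =
     G (op (cut_sym \<delta> \<alpha> \<beta>) f)"
proof -
  have pos: "Im (Complex \<beta> \<delta>) * Im (Complex \<beta> 1) > 0" "Im (Complex \<beta> 1) * Im (Complex \<alpha> 1) > 0"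
    "Im (Complex \<alpha> 1) * Im (Complex \<alpha> \<delta>) > 0" "Im (Complex \<alpha> (- \<delta>)) * Im (Complex \<alpha> (- 1)) > 0"
    "Im (Complex \<alpha> (- 1)) * Im (Complex \<beta> (- 1)) > 0" "Im (Complex \<beta> (- 1)) * Im (Complex \<beta> (- \<delta>)) > 0"
    using \<delta> by simp_all
  note s = pos[THEN segment_fcalc(1)]
  note F = fcalc_scale[OF fcalc_add[OF fcalc_add[OF fcalc_add[OF fcalc_add[OF fcalc_add[OF s(1) s(2)] s(3)] s(4)] s(5)] s(6)],
      of "- 1 / (2 * complex_of_real pi * \<i>)"]
  note F' = F[unfolded cut_sym_eq[OF \<delta>]]
  show "fcalc (cut_sym \<delta> \<alpha> \<beta>) (op (cut_sym \<delta> \<alpha> \<beta>))" by (rule fcalc_op[OF F'])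
  show "(- 1 / (2 * complex_of_real pi * \<i>)) *\<^sub>C
      cut_polygon_integral (krein_topology K q) \<alpha> \<beta> \<delta> (\<lambda>\<mu>. resolvent (restr K) \<mu> f) =
     G (op (cut_sym \<delta> \<alpha> \<beta>) f)"
    unfolding cut_polygon_integral_def pos[THEN segment_integral_resolvent[OF c f]] op_eq[OF F']
    by (simp only: G_lin)
qed

text \<open>Both nested limits are taken in \<open>H\<close> and carried into \<open>K\<close> by
  \<open>G\<close>. The limiting symbol, \<open>1 / t\<close> on \<open>a <= 1 / t <= b\<close>, is
  bounded, and the factor \<open>G\<close> finally cancels the \<open>1 / t\<close>.\<close>

lemma eigenspectral_interval:
  assumes c: "embedded_completion T K q" and f: "f \<in> K" and ab: "a \<le> b"
  shows "fcalc (int_sym a b) (op (int_sym a b))"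
    "eigenspectral K q (restr K) {a..b} f = op (int_sym a b) f"
proof -
  let ?X = "krein_topology K q"
  obtain S J where SJ: "positive S" "inj S" "range S = K" "hermitian J"
    "homeomorphic_maps euclidean (krein_topology K q) S (inv S)" "\<And>x. G x = S (J (S x))"
    by (rule completion_chart[OF c], rule that)
  have kr: "krein_space K q" using c by (simp add: embedded_completion_def krein_completion_def)
  note haus = Hausdorff_krein_topology[OF kr]
  have "hermitian S" using SJ(1) by (simp add: positive_def)
  then have bJS: "bounded_clinear (\<lambda>x. J (S x))"
    by (rule bounded_clinear_compose[OF hermitian_bounded_clinear[OF SJ(4)] hermitian_bounded_clinear])
  have lim: "limitin ?X (\<lambda>i. G (g i)) (G l) F" if "(g \<longlongrightarrow> l) F" for g l and F :: "real filter"
    unfolding SJ(6) chart_limitin[OF SJ(5,2)] by (rule bounded_clinear_tendsto[OF bJS that])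
  define R where "R = \<bar>a\<bar> + \<bar>b\<bar> + 2"
  have inner: "fcalc (cut_sym0 \<alpha> \<beta>) (op (cut_sym0 \<alpha> \<beta>)) \<and>
     lim_in ?X (\<lambda>\<delta>. (- 1 / (2 * complex_of_real pi * \<i>)) *\<^sub>C
        cut_polygon_integral ?X \<alpha> \<beta> \<delta> (\<lambda>\<mu>. resolvent (restr K) \<mu> f)) (at_right 0) =
     G (op (cut_sym0 \<alpha> \<beta>) f)" for \<alpha> \<beta>
  proof -
    obtain Y where Y: "fcalc (cut_sym0 \<alpha> \<beta>) Y"
      "\<And>x. ((\<lambda>\<delta>. op (cut_sym \<delta> \<alpha> \<beta>) x) \<longlongrightarrow> Y x) (at_right 0)"
    proof (rule fcalc_tendsto_at_right[where d = 1 and \<phi> = "\<lambda>\<delta>. cut_sym \<delta> \<alpha> \<beta>" and X = "\<lambda>\<delta>. op (cut_sym \<delta> \<alpha> \<beta>)"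
          and B = "4 * (\<bar>\<alpha>\<bar> + \<bar>\<beta>\<bar> + 1)" and \<psi> = "cut_sym0 \<alpha> \<beta>"])
      show "fcalc (cut_sym \<delta> \<alpha> \<beta>) (op (cut_sym \<delta> \<alpha> \<beta>))" if "0 < \<delta>" for \<delta>
        by (rule cut_polygon_resolvent(1)[OF c f that])
      show "norm (cut_sym \<delta> \<alpha> \<beta> t) \<le> 4 * (\<bar>\<alpha>\<bar> + \<bar>\<beta>\<bar> + 1)" if "0 < \<delta>" "\<delta> < 1" for \<delta> t
        using that by (intro norm_cut_sym_le) auto
    qed (use cut_sym_tendsto that in auto)
    have "limitin ?X (\<lambda>\<delta>. (- 1 / (2 * complex_of_real pi * \<i>)) *\<^sub>C
        cut_polygon_integral ?X \<alpha> \<beta> \<delta> (\<lambda>\<mu>. resolvent (restr K) \<mu> f)) (G (Y f)) (at_right 0)"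
    proof (rule limitin_transform_eventually[OF _ lim[OF Y(2)]])
      show "\<forall>\<^sub>F \<delta> in at_right 0. G (op (cut_sym \<delta> \<alpha> \<beta>) f) = (- 1 / (2 * complex_of_real pi * \<i>)) *\<^sub>C
        cut_polygon_integral ?X \<alpha> \<beta> \<delta> (\<lambda>\<mu>. resolvent (restr K) \<mu> f)"
        using cut_polygon_resolvent(2)[OF c f]
        by (auto simp: eventually_at_right_field intro!: exI[of _ 1] simp del: minus_divide_left)
    qed
    from lim_in_eq[OF this haus trivial_limit_at_right_real] show ?thesis
      using Y(1) unfolding op_eq[OF Y(1)] by (intro conjI)
  qed
  obtain Y where Y: "fcalc (\<lambda>t. of_real (1 / t) * int_sym a b t) Y"
    "\<And>x. ((\<lambda>\<epsilon>. op (cut_sym0 (a - \<epsilon>) (b + \<epsilon>)) x) \<longlongrightarrow> Y x) (at_right 0)"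
  proof (rule fcalc_tendsto_at_right[where d = 1 and \<phi> = "\<lambda>\<epsilon>. cut_sym0 (a - \<epsilon>) (b + \<epsilon>)"
        and X = "\<lambda>\<epsilon>. op (cut_sym0 (a - \<epsilon>) (b + \<epsilon>))"
        and B = "4 * R" and \<psi> = "\<lambda>t. of_real (1 / t) * int_sym a b t"])
    show "norm (cut_sym0 (a - \<epsilon>) (b + \<epsilon>) t) \<le> 4 * R" if "0 < \<epsilon>" "\<epsilon> < 1" for \<epsilon> t
      using that by (intro norm_cut_sym0_le) (auto simp: R_def)
  qed (use inner cut_sym0_tendsto[OF ab] that in auto)
  have GY: "fcalc (int_sym a b) (\<lambda>x. G (Y x))"
  proof -
    have "(\<lambda>t. of_real t * (of_real (1 / t) * int_sym a b t)) = int_sym a b"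
      by (auto simp: int_sym_def fun_eq_iff)
    then show ?thesis using fcalc_G[OF Y(1)] by simp
  qed
  show "fcalc (int_sym a b) (op (int_sym a b))" by (rule fcalc_op[OF GY])
  have "eigenspectral K q (restr K) {a..b} f = lim_in ?X (\<lambda>\<epsilon>. if a - \<epsilon> > b + \<epsilon> then 0 else G (op (cut_sym0 (a - \<epsilon>) (b + \<epsilon>)) f)) (at_right 0)"
    unfolding eigenspectral_def eigenspectral_bounded_def Let_def inner[THEN conjunct2]
    using ab by (simp cong: if_cong)
  also have "\<dots> = G (Y f)"
  proof (rule lim_in_eq[OF limitin_transform_eventually[OF _ lim[OF Y(2)]] haus])
    show "\<forall>\<^sub>F \<epsilon> in at_right 0. G (op (cut_sym0 (a - \<epsilon>) (b + \<epsilon>)) f) =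
       (if a - \<epsilon> > b + \<epsilon> then 0 else G (op (cut_sym0 (a - \<epsilon>) (b + \<epsilon>)) f))"
      using ab by (auto simp: eventually_at_right_field intro!: exI[of _ 1])
  qed simp
  also have "\<dots> = op (int_sym a b) f" by (simp add: op_eq[OF GY])
  finally show "eigenspectral K q (restr K) {a..b} f = op (int_sym a b) f" .
qed

end

section \<open>The regular closure\<close>

context spectral_setup
begin

lemma polar_decomposition:
  obtains S0 J0 A where "positive S0" "inj S0" "hermitian J0" "\<And>x. J0 (J0 x) = x"
    "\<And>x. G x = S0 (J0 (S0 x))" "positive A" "\<And>x. A (A x) = G (G x)" "\<And>x. S0 (S0 x) = A x"
    "\<And>x. A x = J0 (G x)" "fcalc (\<lambda>t. of_real (sgn t)) J0"
    "\<And>\<phi> X x. fcalc \<phi> X \<Longrightarrow> X (S0 x) = S0 (X x)"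
proof -
  obtain A where A: "fcalc (\<lambda>t. of_real \<bar>t\<bar>) A"
    by (rule fcalc_continuous_real[of "\<lambda>t. \<bar>t\<bar>"]) (intro continuous_intros, rule that)
  have "continuous_on I (\<lambda>t. max (- 1) (min 1 (real n * t)))" for n by (intro continuous_intros)
  then have "\<exists>X. fcalc (\<lambda>t. of_real (max (- 1) (min 1 (real n * t)))) X" for n
    by (metis fcalc_continuous_real)
  then obtain X where X: "\<And>n. fcalc (\<lambda>t. of_real (max (- 1) (min 1 (real n * t)))) (X n)" by metis
  \<comment> \<open>The continuous ramps \<open>n t\<close>, clamped to \<open>[-1, 1]\<close>,
    become equal to the sign as soon as \<open>n\<close> times the modulus of \<open>t\<close>
    exceeds 1.\<close>
  have lim: "(\<lambda>n. complex_of_real (max (- 1) (min 1 (real n * t)))) \<longlonglongrightarrow> of_real (sgn t)" for t :: real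
  proof (rule tendsto_eventually)
    obtain N where N: "1 < real N * \<bar>t\<bar> \<or> t = 0" using reals_Archimedean3[of "\<bar>t\<bar>"] by auto
    have "max (- 1) (min 1 (real n * t)) = sgn t" if n: "n \<ge> N" for n
    proof -
      have "real N * \<bar>t\<bar> \<le> real n * \<bar>t\<bar>" using n by (intro mult_right_mono) auto
      then have big: "1 < real n * \<bar>t\<bar>" if "t \<noteq> 0" using N that by linarith
      consider "t = 0" | "t > 0" | "t < 0" by linarith
      then show ?thesis
      proof cases
        case 2
        then have "1 < real n * t" using big by simp
        then show ?thesis using 2 by simp
      next
        case 3
        then have "real n * t < - 1" using big by simp
        then show ?thesis using 3 by simp
      qed simp
    qed
    then show "\<forall>\<^sub>F n in sequentially. complex_of_real (max (- 1) (min 1 (real n * t))) = of_real (sgn t)"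
      unfolding eventually_sequentially by (intro exI[of _ N]) simp
  qed
  obtain J0 where J0: "fcalc (\<lambda>t. of_real (sgn t)) J0"
  proof (rule fcalc_lim_ex[OF X _ lim])
    show "norm (complex_of_real (max (- 1) (min 1 (real n * t)))) \<le> 1" for n t
      unfolding norm_of_real by (simp add: abs_le_iff)
  qed (rule that)
  have hJ: "hermitian J0" by (rule fcalc_hermitian[OF J0]) simp
  have hA: "hermitian A" by (rule fcalc_hermitian[OF A]) simp
  have posA: "positive A" using hA fcalc_nonneg[OF A] by (simp add: positive_def)
  have AA: "A (A x) = G (G x)" for x
    by (rule fun_cong[OF fcalc_unique[OF fcalc_mult[OF A A] fcalc_mult[OF fcalc_self fcalc_self]], of x])
      (simp flip: of_real_mult)
  have AJG: "A x = J0 (G x)" for x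
    by (rule fun_cong[OF fcalc_unique[OF A fcalc_mult[OF J0 fcalc_self]], of x]) (simp flip: of_real_mult add: abs_sgn mult.commute)
  have GJ: "G x = J0 (A x)" for x
    by (rule fun_cong[OF fcalc_unique[OF fcalc_self fcalc_mult[OF J0 A]], of x]) (simp flip: of_real_mult add: sgn_mult_abs)
  \<comment> \<open>The squared sign fails to be 1 at \<open>t = 0\<close>. Multiplication by
    \<open>t\<close> hides this point, and injectivity of \<open>G\<close> cancels the factor
    again.\<close>
  have JJ: "J0 (J0 x) = x" for x
  proof -
    have "fcalc (\<lambda>t. of_real t * (1 + (-1) * (of_real (sgn t) * of_real (sgn t)))) (\<lambda>x. G (x + (-1) *\<^sub>C J0 (J0 x)))"
      by (rule fcalc_G[OF fcalc_add[OF fcalc_id fcalc_scale[OF fcalc_mult[OF J0 J0]]]])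
    from fcalc_unique[OF this fcalc_zero] have "G (x + (-1) *\<^sub>C J0 (J0 x)) = 0"
      by (simp add: sgn_if fun_eq_iff)
    then have "G (x - J0 (J0 x)) = G 0" by (simp add: G_lin)
    then have "x - J0 (J0 x) = 0" using injG by (simp only: inj_eq)
    then show ?thesis by simp
  qed
  \<comment> \<open>The root is taken through \<open>positive_sqrt_ex\<close> for its commutation
    clause, which yields commutation with all functions of \<open>G\<close>.\<close>
  obtain S0 where S0: "positive S0" "\<And>x. S0 (S0 x) = A x"
    "\<forall>C. bounded_clinear C \<longrightarrow> (\<forall>x. C (A x) = A (C x)) \<longrightarrow> (\<forall>x. C (S0 x) = S0 (C x))"
    using positive_sqrt_ex[OF posA] by blast
  have comm: "X (S0 x) = S0 (X x)" if X: "fcalc \<phi> X" for \<phi> X x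
  proof -
    have bX: "bounded_clinear X" by (rule fcalc_bounded_clinear[OF X])
    have "X (G x) = G (X x)" for x by (rule fcalc_commute[OF X bG, symmetric]) simp
    then have "X (A x) = A (X x)" for x by (rule fcalc_commute[OF A bX])
    then show ?thesis using S0(3) bX by blast
  qed
  have injS0: "inj S0"
  proof (rule injI)
    fix x y assume "S0 x = S0 y"
    then have "A x = A y" by (simp flip: S0(2))
    then have "G (G x) = G (G y)" by (simp flip: AA)
    then show "x = y" using injG by (simp add: inj_eq)
  qed
  have GS0: "G x = S0 (J0 (S0 x))" for x by (simp add: GJ S0(2)[symmetric] comm[OF J0])
  show thesis
    by (rule that[OF S0(1) injS0 hJ JJ GS0 posA AA S0(2) AJG J0]) (rule comm)
qed

section \<open>The spectral function near infinity\<close>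

lemma int_sym_tendsto_pos:
  "((\<lambda>r. int_sym \<epsilon> r t) \<longlongrightarrow> (if t \<noteq> 0 \<and> \<epsilon> \<le> 1 / t then 1 else 0)) at_top"
proof (rule tendsto_eventually)
  show "\<forall>\<^sub>F r in at_top. int_sym \<epsilon> r t = (if t \<noteq> 0 \<and> \<epsilon> \<le> 1 / t then 1 else 0)"
    using eventually_ge_at_top[of "1 / t"] by eventually_elim (simp add: int_sym_def)
qed

lemma int_sym_tendsto_neg:
  "((\<lambda>r. int_sym (- r) (- \<epsilon>) t) \<longlongrightarrow> (if t \<noteq> 0 \<and> 1 / t \<le> - \<epsilon> then 1 else 0)) at_top"
proof (rule tendsto_eventually)
  show "\<forall>\<^sub>F r in at_top. int_sym (- r) (- \<epsilon>) t = (if t \<noteq> 0 \<and> 1 / t \<le> - \<epsilon> then 1 else 0)"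
    using eventually_ge_at_top[of "- (1 / t)"] by eventually_elim (auto simp: int_sym_def)
qed

lemma norm_int_sym_le: "norm (int_sym a b t) \<le> 1" by (simp add: int_sym_def)

lemma int_sym_empty: "b < a \<Longrightarrow> int_sym a b = (\<lambda>_. 0)"
  by (auto simp: int_sym_def)

text \<open>In \<open>H\<close> both limits at infinity always exist. Whether infinity is singular
  depends on convergence in \<open>K\<close>.\<close>

lemma spectral_limits:
  assumes c: "embedded_completion T K q" and f0: "f0 \<in> K"
  obtains Yp Yn where "fcalc (\<lambda>t. if t \<noteq> 0 \<and> \<epsilon> \<le> 1 / t then 1 else 0) Yp"
    "fcalc (\<lambda>t. if t \<noteq> 0 \<and> 1 / t \<le> - \<epsilon> then 1 else 0) Yn"
    "\<And>x. ((\<lambda>r. op (int_sym \<epsilon> r) x) \<longlongrightarrow> Yp x) at_top"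
    "\<And>x. ((\<lambda>r. op (int_sym (- r) (- \<epsilon>)) x) \<longlongrightarrow> Yn x) at_top"
proof -
  have fc: "fcalc (int_sym a b) (op (int_sym a b))" for a b
  proof (cases "a \<le> b")
    case True
    then show ?thesis by (rule eigenspectral_interval(1)[OF c f0])
  next
    case False
    then show ?thesis using fcalc_op[OF fcalc_zero] by (simp add: int_sym_empty)
  qed
  obtain Yp where Yp: "fcalc (\<lambda>t. if t \<noteq> 0 \<and> \<epsilon> \<le> 1 / t then 1 else 0) Yp"
    "\<And>x. ((\<lambda>r. op (int_sym \<epsilon> r) x) \<longlongrightarrow> Yp x) at_top"
    by (rule fcalc_tendsto_at_top[of "\<lambda>r. int_sym \<epsilon> r" "\<lambda>r. op (int_sym \<epsilon> r)" 1, OF fc norm_int_sym_le int_sym_tendsto_pos])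
      (rule that)
  obtain Yn where Yn: "fcalc (\<lambda>t. if t \<noteq> 0 \<and> 1 / t \<le> - \<epsilon> then 1 else 0) Yn"
    "\<And>x. ((\<lambda>r. op (int_sym (- r) (- \<epsilon>)) x) \<longlongrightarrow> Yn x) at_top"
    by (rule fcalc_tendsto_at_top[of "\<lambda>r. int_sym (- r) (- \<epsilon>)" "\<lambda>r. op (int_sym (- r) (- \<epsilon>))" 1, OF fc norm_int_sym_le int_sym_tendsto_neg])
      (rule that)
  from that[OF Yp(1) Yn(1) Yp(2) Yn(2)] show thesis .
qed

lemma eventually_eigenspectral:
  assumes c: "embedded_completion T K q" and f: "f \<in> K"
  shows "\<forall>\<^sub>F r in at_top. op (int_sym \<epsilon> r) f = eigenspectral K q (restr K) {\<epsilon>..r} f"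
    "\<forall>\<^sub>F r in at_top. op (int_sym (- r) (- \<epsilon>)) f = eigenspectral K q (restr K) {-r..-\<epsilon>} f"
  using eventually_ge_at_top[of \<epsilon>]
  by (eventually_elim, simp add: eigenspectral_interval(2)[OF c f])+

lemma regular_completion_not_singular:
  assumes S0: "positive S0" "inj S0" and J0: "hermitian J0" "\<And>x. J0 (J0 x) = x"
    and q: "\<And>x y. q (S0 x) (S0 y) = cinner (J0 x) y" "zero_outside (range S0) q"
    and c: "embedded_completion T (range S0) q"
    and comm: "\<And>\<phi> X x. fcalc \<phi> X \<Longrightarrow> X (S0 x) = S0 (X x)"
  shows "\<not> infinity_singular_critical_point (range S0) q (restr (range S0))"
proof -
  let ?X = "krein_topology (range S0) q"
  have "hermitian S0" using S0(1) by (simp add: positive_def)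
  note hom = krein_space_chart(3)[OF hermitian_bounded_clinear[OF this] S0(2) J0 q]
  have "\<exists>l. limitin ?X (\<lambda>r. eigenspectral (range S0) q (restr (range S0)) {\<epsilon>..r} f) l at_top"
    and "\<exists>l. limitin ?X (\<lambda>r. eigenspectral (range S0) q (restr (range S0)) {-r..-\<epsilon>} f) l at_top"
    if e: "0 < \<epsilon>" and f: "f \<in> range S0" for \<epsilon> f
  proof -
    obtain y where y: "f = S0 y" using f by blast
    obtain Yp Yn where Y: "fcalc (\<lambda>t. if t \<noteq> 0 \<and> \<epsilon> \<le> 1 / t then 1 else 0) Yp"
      "fcalc (\<lambda>t. if t \<noteq> 0 \<and> 1 / t \<le> - \<epsilon> then 1 else 0) Yn"
      "\<And>x. ((\<lambda>r. op (int_sym \<epsilon> r) x) \<longlongrightarrow> Yp x) at_top"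
      "\<And>x. ((\<lambda>r. op (int_sym (- r) (- \<epsilon>)) x) \<longlongrightarrow> Yn x) at_top"
      by (rule spectral_limits[OF c f], rule that)
    \<comment> \<open>Functions of \<open>G\<close> pass through \<open>S0\<close>, so the limit is
      taken on the coordinate \<open>y\<close>, where convergence in \<open>H\<close> is
      enough.\<close>
    have fc: "op (int_sym a b) f = S0 (op (int_sym a b) y)" if "a \<le> b" for a b
      unfolding y by (rule comm[OF eigenspectral_interval(1)[OF c f that]])
    have 1: "limitin ?X (\<lambda>r. S0 (op (int_sym \<epsilon> r) y)) (S0 (Yp y)) at_top"
      "limitin ?X (\<lambda>r. S0 (op (int_sym (- r) (- \<epsilon>)) y)) (S0 (Yn y)) at_top"
      unfolding chart_limitin[OF hom S0(2)] by (rule Y(3), rule Y(4))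
    have 2: "\<forall>\<^sub>F r in at_top. S0 (op (int_sym \<epsilon> r) y) = eigenspectral (range S0) q (restr (range S0)) {\<epsilon>..r} f"
      "\<forall>\<^sub>F r in at_top. S0 (op (int_sym (- r) (- \<epsilon>)) y) = eigenspectral (range S0) q (restr (range S0)) {-r..-\<epsilon>} f"
      using eventually_ge_at_top[of \<epsilon>]
      by (eventually_elim, simp add: eigenspectral_interval(2)[OF c f] fc)+
    show "\<exists>l. limitin ?X (\<lambda>r. eigenspectral (range S0) q (restr (range S0)) {\<epsilon>..r} f) l at_top"
      by (rule exI, rule limitin_transform_eventually[OF 2(1) 1(1)])
    show "\<exists>l. limitin ?X (\<lambda>r. eigenspectral (range S0) q (restr (range S0)) {-r..-\<epsilon>} f) l at_top"
      by (rule exI, rule limitin_transform_eventually[OF 2(2) 1(2)])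
  qed
  then show ?thesis unfolding infinity_singular_critical_point_def by blast
qed

text \<open>
  If the limits exist in \<open>K\<close>, their difference \<open>sgn G\<close> maps \<open>K\<close> into itself, boundedly by the
  Hellinger-Toeplitz argument; this bounds \<open>\<bar>G\<bar>\<^sup>1\<^sup>/\<^sup>2\<close> by \<open>S\<close> and hence embeds the regular
  completion into \<open>K\<close>.
\<close>

lemma not_singular_range_subset:
  assumes c: "embedded_completion T K q"
    and ns: "\<not> infinity_singular_critical_point K q (restr K)"
    and S0: "positive S0" "\<And>x. S0 (S0 x) = J0 (G x)" and J0: "fcalc (\<lambda>t. of_real (sgn t)) J0"
  shows "range S0 \<subseteq> K"
proof -
  obtain S J where SJ: "positive S" "inj S" "range S = K" "hermitian J"
    "homeomorphic_maps euclidean (krein_topology K q) S (inv S)" "\<And>x. G x = S (J (S x))"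
    by (rule completion_chart[OF c], rule that)
  have hS: "hermitian S" using SJ(1) by (simp add: positive_def)
  note bS = hermitian_bounded_clinear[OF hS]
  \<comment> \<open>Every non-zero \<open>t\<close> in \<open>I\<close> has \<open>1 / t\<close> of
    modulus at least \<open>1 / m\<close>, beyond this threshold. Hence the two half-line
    projections differ exactly by the sign of \<open>t\<close>.\<close>
  define \<epsilon> where "\<epsilon> = 1 / (2 * m)"
  have e: "\<epsilon> > 0" using m by (simp add: \<epsilon>_def)
  have inK: "J0 f \<in> K" if f: "f \<in> K" for f
  proof -
    obtain Yp Yn where Y: "fcalc (\<lambda>t. if t \<noteq> 0 \<and> \<epsilon> \<le> 1 / t then 1 else 0) Yp"
      "fcalc (\<lambda>t. if t \<noteq> 0 \<and> 1 / t \<le> - \<epsilon> then 1 else 0) Yn"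
      "\<And>x. ((\<lambda>r. op (int_sym \<epsilon> r) x) \<longlongrightarrow> Yp x) at_top"
      "\<And>x. ((\<lambda>r. op (int_sym (- r) (- \<epsilon>)) x) \<longlongrightarrow> Yn x) at_top"
      by (rule spectral_limits[OF c f], rule that)
    \<comment> \<open>Through the continuous embedding, the limit assumed to exist in
      \<open>K\<close> must be the known limit in \<open>H\<close>.\<close>
    have lim: "y \<in> K" if l: "limitin (krein_topology K q) g l at_top" and ev: "\<forall>\<^sub>F r in at_top. h r = g r"
      and h: "(h \<longlongrightarrow> y) at_top" for g l y and h :: "real \<Rightarrow> 'h"
    proof -
      have kr: "krein_space K q" using c by (simp add: embedded_completion_def krein_completion_def)
      have "l \<in> K" using limitin_topspace[OF l] by (simp add: topspace_krein_topology[OF kr])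
      have "continuous_map (krein_topology K q) euclidean (\<lambda>x. x)"
        using c by (simp add: embedded_completion_def continuously_embedded_def)
      from continuous_map_limit[OF this l] have "(g \<longlongrightarrow> l) at_top" by (simp add: o_def)
      moreover have "(g \<longlongrightarrow> y) at_top" using h ev by (simp add: filterlim_cong)
      ultimately have "l = y" by (intro tendsto_unique[OF _ \<open>(g \<longlongrightarrow> l) at_top\<close>]) simp_all
      with \<open>l \<in> K\<close> show ?thesis by simp
    qed
    have ex: "\<exists>l. limitin (krein_topology K q) (\<lambda>r. eigenspectral K q (restr K) {\<epsilon>..r} f) l at_top"
      "\<exists>l. limitin (krein_topology K q) (\<lambda>r. eigenspectral K q (restr K) {-r..-\<epsilon>} f) l at_top"
      using ns e f unfolding infinity_singular_critical_point_def by blast+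
    have "Yp f \<in> K" using ex(1) by (elim exE) (rule lim[OF _ eventually_eigenspectral(1)[OF c f] Y(3)])
    moreover have "Yn f \<in> K" using ex(2) by (elim exE) (rule lim[OF _ eventually_eigenspectral(2)[OF c f] Y(4)])
    moreover have "csubspace K"
      using c by (auto simp: embedded_completion_def krein_completion_def krein_space_def sesquilinear_on_def)
    ultimately have "Yp f - Yn f \<in> K" by (intro complex_vector.subspace_diff)
    moreover have "J0 = (\<lambda>x. Yp x + (-1) *\<^sub>C Yn x)"
    proof (rule fcalc_unique[OF J0 fcalc_add[OF Y(1) fcalc_scale[OF Y(2)]]])
      fix t assume t: "t \<in> I"
      consider "t = 0" | "t > 0" | "t < 0" by linarith
      then show "complex_of_real (sgn t) = (if t \<noteq> 0 \<and> \<epsilon> \<le> 1 / t then 1 else 0) +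
          - 1 * (if t \<noteq> 0 \<and> 1 / t \<le> - \<epsilon> then 1 else 0)"
      proof cases
        case 2
        have "\<epsilon> * t \<le> 1" using t 2 m by (simp add: \<epsilon>_def)
        then have "\<epsilon> \<le> 1 / t" using 2 by (simp add: le_divide_eq)
        moreover have "\<not> 1 / t \<le> - \<epsilon>" using calculation e by linarith
        ultimately show ?thesis using 2 by simp
      next
        case 3
        have "- t \<le> 2 * m" using t m by simp
        then have "\<epsilon> * (- t) \<le> 1" using m by (simp add: \<epsilon>_def field_simps)
        then have "1 / t \<le> - \<epsilon>" using 3 by (simp add: divide_le_eq)
        moreover have "\<not> \<epsilon> \<le> 1 / t" using calculation e by linarith
        ultimately show ?thesis using 3 by simp
      qed simp
    qed
    ultimately show ?thesis by simp
  qed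
  have hJ: "hermitian J0" by (rule fcalc_hermitian[OF J0]) simp
  \<comment> \<open>The sign of \<open>G\<close> in the coordinates of \<open>K\<close>; its adjoint
    is explicit on the dense range of \<open>S\<close>.\<close>
  define M where "M y = inv S (J0 (S y))" for y
  have SM: "S (M y) = J0 (S y)" for y
    unfolding M_def using inK[of "S y"] SJ(3) by (intro f_inv_into_f) auto
  have adj: "cinner (M y) (S h) = cinner y (S (J0 h))" for y h
  proof -
    have "cinner (M y) (S h) = cinner (J0 (S y)) h" by (simp add: hermitianD[OF hS, symmetric] SM)
    then show ?thesis by (simp add: hermitianD[OF hJ] hermitianD[OF hS])
  qed
  have "bounded_clinear M"
    by (rule bounded_clinear_if_dense_adjoint[OF hermitian_dense_range[OF hS SJ(2)]]) (use adj in blast)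
  then obtain C where C: "C > 0" "\<And>x. norm (M (J x)) \<le> C * norm x"
    using bounded_clinear_bound[OF bounded_clinear_compose[OF _ hermitian_bounded_clinear[OF SJ(4)]]] by blast
  have hS0: "hermitian S0" using S0(1) by (simp add: positive_def)
  \<comment> \<open>The square of the norm of \<open>S0 h\<close> is
    \<open>cinner (J0 (G h)) h\<close>. Writing \<open>J0 G\<close> as \<open>S M J S\<close> and
    moving one \<open>S\<close> across leaves a bounded operator between two copies of
    \<open>S h\<close>.\<close>
  have le: "norm (S0 h) \<le> sqrt C * norm (S h)" for h
  proof -
    have 1: "cinner (S0 (S0 h)) h = complex_of_real ((norm (S0 h))\<^sup>2)"
      by (simp add: hermitianD[OF hS0] cinner_self)
    have 2: "cinner (S0 (S0 h)) h = cinner (M (J (S h))) (S h)"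
      by (simp add: S0(2) SJ(6) SM[symmetric] hermitianD[OF hS])
    have 3: "(norm (S0 h))\<^sup>2 = norm (cinner (S0 (S0 h)) h)"
      unfolding 1 norm_of_real by simp
    have 4: "norm (cinner (M (J (S h))) (S h)) \<le> norm (M (J (S h))) * norm (S h)"
      by (rule norm_cinner_le)
    have 5: "norm (M (J (S h))) * norm (S h) \<le> (C * norm (S h)) * norm (S h)"
      by (rule mult_right_mono[OF C(2) norm_ge_zero])
    have 6: "(C * norm (S h)) * norm (S h) = (sqrt C * norm (S h))\<^sup>2"
      using C(1) by (simp add: power2_eq_square power_mult_distrib)
    have "(norm (S0 h))\<^sup>2 \<le> (sqrt C * norm (S h))\<^sup>2"
      using 3 4 5 6 unfolding 2 by linarith
    then show ?thesis by (rule power2_le_imp_le) (use C(1) in simp)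
  qed
  from range_subset_if_norm_le[OF hS0 hS this] show ?thesis using SJ(3) by simp
qed

end

theorem theorem5p4:
  fixes T :: "'h::chilbert_space \<rightharpoonup> 'h"
  assumes "self_adjoint UNIV cinner T"
    and "boundedly_invertible UNIV cinner T"
  shows "\<exists>t\<^sub>0 K\<^sub>0 q\<^sub>0 A\<^sub>0. t\<^sub>0 \<in> \<M> T \<and> (K\<^sub>0, q\<^sub>0, A\<^sub>0) \<in> \<N> T \<and>
    \<comment> \<open>(i)\<close>
    (regular_form t\<^sub>0 \<and>
     (\<forall>t\<in>\<M> T. t = t\<^sub>0 \<longleftrightarrow> form_dom t = dom (op_sqrt (op_abs T))) \<and>
     (\<forall>t\<in>\<M> T. t \<noteq> t\<^sub>0 \<longrightarrow> \<not> regular_form t)) \<and>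
    \<comment> \<open>(ii)\<close>
    ((\<forall>(K, q, A)\<in>\<N> T. J_self_adjoint K q A \<and> J_non_negative K q A \<and>
        boundedly_invertible K (krein_ip K q) A) \<and>
     \<not> infinity_singular_critical_point K\<^sub>0 q\<^sub>0 A\<^sub>0 \<and>
     (\<forall>(K, q, A)\<in>\<N> T. (K, q, A) \<noteq> (K\<^sub>0, q\<^sub>0, A\<^sub>0) \<longrightarrow>
        infinity_singular_critical_point K q A)) \<and>
    \<comment> \<open>(iii)\<close>
    (K\<^sub>0, q\<^sub>0, A\<^sub>0) = \<Phi> t\<^sub>0 \<and>
    \<comment> \<open>(iv)\<close>
    (\<forall>t\<^sub>1\<in>\<M> T. \<forall>t\<^sub>2\<in>\<M> T. form_dom t\<^sub>1 \<subseteq> form_dom t\<^sub>2 \<longrightarrow> t\<^sub>1 = t\<^sub>2) \<and>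
    \<comment> \<open>(v)\<close>
    (\<forall>K\<^sub>1 q\<^sub>1 K\<^sub>2 q\<^sub>2. embedded_completion T K\<^sub>1 q\<^sub>1 \<and> embedded_completion T K\<^sub>2 q\<^sub>2 \<and> K\<^sub>1 \<subseteq> K\<^sub>2
       \<longrightarrow> K\<^sub>1 = K\<^sub>2 \<and> q\<^sub>1 = q\<^sub>2)"
proof -
  have "bij_betw (\<lambda>u. the (T u)) (dom T) UNIV" using assms(2) by (simp add: boundedly_invertible_def)
  then obtain G where G: "hermitian G" "inj G" "T = inv_map G"
    by (rule self_adjoint_bij_inverse[OF assms(1)])
  obtain m where "hermitian_bound G m" by (rule hermitian_bound_ex[OF G(1)])
  then interpret spectral_setup G T m
    using G by (simp add: spectral_setup_def inverse_operator_def)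
  obtain S0 J0 A where P: "positive S0" "inj S0" "hermitian J0" "\<And>x. J0 (J0 x) = x"
    "\<And>x. G x = S0 (J0 (S0 x))" "positive A" "\<And>x. A (A x) = G (G x)" "\<And>x. S0 (S0 x) = A x"
    "\<And>x. A x = J0 (G x)" "fcalc (\<lambda>t. of_real (sgn t)) J0"
    and comm: "\<forall>\<phi> X x. fcalc \<phi> X \<longrightarrow> X (S0 x) = S0 (X x)"
    by (rule polar_decomposition) blast
  have hS0: "hermitian S0" using P(1) by (simp add: positive_def)
  define K0 where "K0 = range S0"
  \<comment> \<open>The value 0 off \<open>K0\<close> is what \<open>zero_outside\<close> requires
    for a Krein space in this encoding.\<close>
  define q0 where "q0 x y = (if x \<in> K0 \<and> y \<in> K0 then cinner (J0 (inv S0 x)) (inv S0 y) else 0)" for x y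
  have q0: "q0 (S0 x) (S0 y) = cinner (J0 x) y" for x y using P(2) by (simp add: q0_def K0_def)
  have z0: "zero_outside (range S0) q0" by (auto simp: zero_outside_def q0_def K0_def)
  have c0: "embedded_completion T K0 q0"
    unfolding K0_def
    by (rule embedded_completionI[OF hermitian_bounded_clinear[OF hS0] P(2) hermitianD[OF hS0] P(3,4) q0 z0 P(5)])
  have injA: "inj A"
    using injG P(7) by (metis injD injI)
  have dom0: "dom (op_sqrt (op_abs T)) = K0"
    using op_abs_inv_map[OF G(1,2) P(6,7)] op_sqrt_inv_map[OF injA P(1,8)]
    by (simp add: G(3) dom_inv_map K0_def)
  have t0: "(K0, q0) \<in> \<M> T" by (rule completion_form_closure[OF c0])
  have iv: "t1 = t2" if "t1 \<in> \<M> T" "t2 \<in> \<M> T" "form_dom t1 \<subseteq> form_dom t2" for t1 t2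
    using completion_inclusion_unique[OF form_closure_completion form_closure_completion, OF that]
    by (simp add: prod_eq_iff)
  \<comment> \<open>Equal domains are in particular an inclusion, so \<open>iv\<close> upgrades the
    domain condition to equality of forms.\<close>
  have char: "t = (K0, q0) \<longleftrightarrow> form_dom t = dom (op_sqrt (op_abs T))" if "t \<in> \<M> T" for t
    using iv[OF that t0] by (auto simp: dom0)
  have regular: "regular_form t \<longleftrightarrow> t = (K0, q0)" if t: "t \<in> \<M> T" for t
  proof -
    have "closed_form t" using t by (simp add: form_closures_def form_closure_of_def)
    then show ?thesis by (simp add: regular_form_def form_operator_closure[OF t] char[OF t])
  qed
  have N: "(K, q, B) \<in> \<N> T \<longleftrightarrow> embedded_completion T K q \<and> B = restr K" for K q B
    by (simp add: krein_triples_def)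
  have ns: "\<not> infinity_singular_critical_point K0 q0 (restr K0)"
    unfolding K0_def
    by (rule regular_completion_not_singular[OF P(1-4) q0 z0 c0[unfolded K0_def]]) (use comm in blast)
  have sing: "infinity_singular_critical_point K q (restr K)"
    if c: "embedded_completion T K q" and ne: "(K, q, restr K) \<noteq> (K0, q0, restr K0)" for K q
  proof (rule ccontr)
    assume "\<not> infinity_singular_critical_point K q (restr K)"
    then have "K0 \<subseteq> K"
      unfolding K0_def by (rule not_singular_range_subset[OF c _ P(1) _ P(10)]) (simp add: P(8,9))
    then have "K0 = K \<and> q0 = q" by (rule completion_inclusion_unique[OF c0 c])
    with ne show False by simp
  qed
  show ?thesis
  proof (intro exI[of _ "(K0, q0)"] exI[of _ K0] exI[of _ q0] exI[of _ "restr K0"] conjI)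
    show "(K0, q0) \<in> \<M> T" by (rule t0)
    show "(K0, q0, restr K0) \<in> \<N> T" using c0 by (simp only: N)
    show "regular_form (K0, q0)" using regular[OF t0] by simp
    show "\<forall>t\<in>\<M> T. t = (K0, q0) \<longleftrightarrow> form_dom t = dom (op_sqrt (op_abs T))" using char by blast
    show "\<forall>t\<in>\<M> T. t \<noteq> (K0, q0) \<longrightarrow> \<not> regular_form t" using regular by blast
    show "\<forall>(K, q, A)\<in>\<N> T. J_self_adjoint K q A \<and> J_non_negative K q A \<and>
        boundedly_invertible K (krein_ip K q) A"
    proof clarify
      fix K q B assume "(K, q, B) \<in> \<N> T"
      then have "embedded_completion T K q" "B = restr K" by (simp_all only: N)
      then show "J_self_adjoint K q B \<and> J_non_negative K q B \<and> boundedly_invertible K (krein_ip K q) B"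
        using completion_operator_properties by blast
    qed
    show "\<not> infinity_singular_critical_point K0 q0 (restr K0)" by (rule ns)
    show "\<forall>(K, q, A)\<in>\<N> T. (K, q, A) \<noteq> (K0, q0, restr K0) \<longrightarrow> infinity_singular_critical_point K q A"
    proof
      fix x assume x: "x \<in> \<N> T"
      obtain K q B where K: "x = (K, q, B)" by (cases x)
      have "embedded_completion T K q" "B = restr K" using x unfolding K N by simp_all
      then show "case x of (K, q, A) \<Rightarrow> (K, q, A) \<noteq> (K0, q0, restr K0) \<longrightarrow> infinity_singular_critical_point K q A"
        unfolding K case_prod_conv using sing by blast
    qed
    show "(K0, q0, restr K0) = \<Phi> (K0, q0)" using form_triple_closure[OF t0] by simp
    show "\<forall>t\<^sub>1\<in>\<M> T. \<forall>t\<^sub>2\<in>\<M> T. form_dom t\<^sub>1 \<subseteq> form_dom t\<^sub>2 \<longrightarrow> t\<^sub>1 = t\<^sub>2" using iv by blast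
    show "\<forall>K\<^sub>1 q\<^sub>1 K\<^sub>2 q\<^sub>2. embedded_completion T K\<^sub>1 q\<^sub>1 \<and> embedded_completion T K\<^sub>2 q\<^sub>2 \<and> K\<^sub>1 \<subseteq> K\<^sub>2
       \<longrightarrow> K\<^sub>1 = K\<^sub>2 \<and> q\<^sub>1 = q\<^sub>2"
      using completion_inclusion_unique by blast
  qed
qed

end
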